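(* There is a polynomial-time algorithm that, given a positive integer $p$ and an oriented graph $D$ whose number of vertices is different from $p+1$, decides whether $D$ is $(=p)$-invertible.
   Context: For an oriented graph $D$ and $X\subseteq V(D)$, the inversion of $X$ reverses the orientation of every arc with both endpoints in $X$. A $(=p)$-inversion is the inversion of a set of exactly $p$ vertices. An oriented graph is $(=p)$-invertible if it can be made acyclic by a (finite, possibly empty) sequence of $(=p)$-inversions. *)

theory Defs
  imports "Graph_Theory.Pair_Digraph" "HOL-Computational_Algebra.Polynomial"
begin

section \<open>Oriented graphs and inversions\<close>

definition oriented_graph :: "'a pair_pre_digraph \<Rightarrow> bool" where
  "oriented_graph D \<longleftrightarrow>
     pair_digraph D \<and> (\<forall>u v. (u, v) \<in> parcs D \<longrightarrow> (v, u) \<notin> parcs D)"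

definition inversion :: "'a set \<Rightarrow> 'a pair_pre_digraph \<Rightarrow> 'a pair_pre_digraph" where
  "inversion X D = \<lparr> pverts = pverts D,
     parcs = {(u, v). (u, v) \<in> parcs D \<and> \<not> (u \<in> X \<and> v \<in> X)}
           \<union> {(v, u) | u v. (u, v) \<in> parcs D \<and> u \<in> X \<and> v \<in> X} \<rparr>"

definition eq_invertible :: "nat \<Rightarrow> 'a pair_pre_digraph \<Rightarrow> bool" where
  "eq_invertible p D \<longleftrightarrow>
     (\<exists>Xs. (\<forall>X \<in> set Xs. X \<subseteq> pverts D \<and> card X = p) \<and> acyclic (parcs (fold inversion Xs D)))"


section \<open>Polynomial-time decidability on random access machines\<close>

text \<open>
  The machine model is the random access machine with addition and truncated subtraction, with
  its control flow given by structured programs. A state consists of the registers (of which a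
  program mentions only finitely many) and of a memory that is accessed indirectly through
  registers; both hold natural numbers. Every instruction and every evaluation of a branching
  condition takes one unit of time. As there is no multiplication, a step lengthens the numbers
  that occur by at most one bit, so that this unit-cost measure is polynomially related to the
  logarithmic-cost measure and to the running time of Turing machines.
\<close>

datatype ram =
    Const nat nat      \<comment> \<open>\<open>r\<^sub>i := k\<close>\<close>
  | Add nat nat nat    \<comment> \<open>\<open>r\<^sub>i := r\<^sub>j + r\<^sub>k\<close>\<close>
  | Sub nat nat nat    \<comment> \<open>\<open>r\<^sub>i := r\<^sub>j - r\<^sub>k\<close>, truncated at 0\<close>
  | Load nat nat       \<comment> \<open>\<open>r\<^sub>i := mem[r\<^sub>j]\<close>\<close>
  | Store nat nat      \<comment> \<open>\<open>mem[r\<^sub>i] := r\<^sub>j\<close>\<close>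
  | Seq ram ram
  | Cond nat ram ram   \<comment> \<open>the first branch is taken if \<open>r\<^sub>i \<noteq> 0\<close>\<close>
  | While nat ram      \<comment> \<open>loop as long as \<open>r\<^sub>i \<noteq> 0\<close>\<close>

type_synonym ram_state = "(nat \<Rightarrow> nat) \<times> (nat \<Rightarrow> nat)"

inductive runs :: "ram \<Rightarrow> ram_state \<Rightarrow> nat \<Rightarrow> ram_state \<Rightarrow> bool" where
  Const: "runs (Const i k) (R, M) 1 (R(i := k), M)"
| Add: "runs (Add i j k) (R, M) 1 (R(i := R j + R k), M)"
| Sub: "runs (Sub i j k) (R, M) 1 (R(i := R j - R k), M)"
| Load: "runs (Load i j) (R, M) 1 (R(i := M (R j)), M)"
| Store: "runs (Store i j) (R, M) 1 (R, M(R i := R j))"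
| Seq: "runs a s t s' \<Longrightarrow> runs b s' t' s'' \<Longrightarrow> runs (Seq a b) s (t + t') s''"
| CondT: "fst s i \<noteq> 0 \<Longrightarrow> runs a s t s' \<Longrightarrow> runs (Cond i a b) s (Suc t) s'"
| CondF: "fst s i = 0 \<Longrightarrow> runs b s t s' \<Longrightarrow> runs (Cond i a b) s (Suc t) s'"
| WhileF: "fst s i = 0 \<Longrightarrow> runs (While i a) s 1 s"
| WhileT: "fst s i \<noteq> 0 \<Longrightarrow> runs a s t s' \<Longrightarrow> runs (While i a) s' t' s'' \<Longrightarrow>
    runs (While i a) s (Suc (t + t')) s''"

inductive_cases runs_elims:
  "runs (Const i k) s t s'" "runs (Add i j k) s t s'" "runs (Sub i j k) s t s'"
  "runs (Load i j) s t s'" "runs (Store i j) s t s'" "runs (Seq a b) s t s'"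
  "runs (Cond i a b) s t s'"
inductive_cases runs_While_elim: "runs (While i a) s t s'"

lemma runs_deterministic:
  "runs c s t s' \<Longrightarrow> runs c s u s'' \<Longrightarrow> u = t \<and> s'' = s'"
proof (induction arbitrary: u s'' rule: runs.induct)
  case (Seq a s t s' b t' s2)
  from Seq.prems show ?case
    by (rule runs_elims) (metis Seq.IH)
next
  case (CondT s i a t s' b)
  from CondT.prems show ?case
    by (rule runs_elims) (simp_all add: CondT.hyps CondT.IH)
next
  case (CondF s i b t s' a)
  from CondF.prems show ?case
    by (rule runs_elims) (simp_all add: CondF.hyps CondF.IH)
next
  case (WhileF s i a)
  from WhileF.prems show ?case
    by (rule runs_While_elim) (simp_all add: WhileF.hyps)
next
  case (WhileT s i a t s' t' s2)
  from WhileT.prems show ?case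
  proof (rule runs_While_elim)
    assume "fst s i = 0"
    with WhileT.hyps show ?case by simp
  next
    fix t1 s1 t2
    assume u: "u = Suc (t1 + t2)" and 1: "runs a s t1 s1" and 2: "runs (While i a) s1 t2 s''"
    from WhileT.IH(1)[OF 1] have e: "t1 = t" "s1 = s'" by simp_all
    from WhileT.IH(2)[OF 2[unfolded e]] u e show ?case by simp
  qed
qed (erule runs_elims, simp)+

text \<open>
  The input word is in the memory cells \<open>0, 1, \<dots>\<close>, one bit per cell, and its length is in
  register 0; all other registers and cells are 0.
\<close>

definition initial_state :: "bool list \<Rightarrow> ram_state" where
  "initial_state w =
     ((\<lambda>_. 0)(0 := length w), \<lambda>i. if i < length w then of_bool (w ! i) else 0)"

text \<open>
  A program decides \<open>P\<close> on the instances in \<open>I\<close>, with instances presented as bit strings by \<open>enc\<close>,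
  if on each of them it halts with a nonzero number in register 0 exactly if \<open>P\<close> holds; nothing
  is required of its behaviour on other inputs. The time bound is a polynomial in the length of
  the bit string.
\<close>

definition polytime_decidable_on :: "'i set \<Rightarrow> ('i \<Rightarrow> bool list) \<Rightarrow> ('i \<Rightarrow> bool) \<Rightarrow> bool" where
  "polytime_decidable_on I enc P \<longleftrightarrow>
     (\<exists>(c :: ram) (q :: nat poly). \<forall>x \<in> I. \<exists>t R M.
        runs c (initial_state (enc x)) t (R, M) \<and>
        t \<le> poly q (length (enc x)) \<and>
        (R 0 \<noteq> 0 \<longleftrightarrow> P x))"


section \<open>Presentation of the input\<close>

fun binary :: "nat \<Rightarrow> bool list" where
  "binary n = (if n = 0 then [] else odd n # binary (n div 2))"

declare binary.simps [simp del]

text \<open>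
  The number \<open>n\<close> of vertices in unary, a terminating 0, the \<open>n \<times> n\<close> adjacency matrix row by row
  (vertices in increasing order), and then \<open>p\<close> in binary, least significant bit first.
\<close>

definition encode :: "nat \<times> nat pair_pre_digraph \<Rightarrow> bool list" where
  "encode = (\<lambda>(p, D). let vs = sorted_list_of_set (pverts D) in
     replicate (length vs) True @ [False] @
     [(u, v) \<in> parcs D. u \<leftarrow> vs, v \<leftarrow> vs] @
     binary p)"

end

theory Submission
  imports Defs "HOL-Library.Z2"
begin

text \<open>
  If \<open>p = 1\<close> or \<open>p \<ge> n\<close>, an inversion reverses no arc or every arc, so invertibility means acyclicity.
  Otherwise \<open>n \<ge> p + 2\<close>, and the arcs that a sequence of inversions reverses form a sum modulo 2 of
  complete graphs on \<open>p\<close> vertices. Every 4-cycle is a sum of four such graphs, and the 4-cycles span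
  all graphs with even degrees and an even number of edges. Hence a tournament can be made transitive
  as soon as its out-degrees have the parities \<open>n - 1, n - 2, \<dots>, 0\<close> in some order: if the number of
  arcs to be reversed is odd, exchange the first and the third vertex of the order.

  If \<open>p\<close> is even, two complete graphs that differ in one vertex change the parities of two arbitrary
  vertices, and every oriented graph is invertible. If \<open>p\<close> is odd, inversions preserve the parities of
  all degrees. Completing \<open>D\<close> to a tournament, one may choose the arcs between nonadjacent vertices, and
  thus change the parities along paths of the complement. So \<open>D\<close> is invertible iff there is a set of
  \<open>\<lfloor>n / 2\<rfloor>\<close> vertices that meets every component of the complement in a prescribed parity. This
  holds iff neither too many components need an odd intersection nor too many need an odd rest,
  which is checked after a computation of the components by Warshall's algorithm.
\<close>

section \<open>Graphs over the two-element field\<close>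

text \<open>The excluded case \<open>n = p + 1\<close> is where this construction loses the
  4-cycles: writing one as a sum of four complete graphs takes \<open>p - 2\<close> further
  vertices, and only \<open>p - 3\<close> would be left. Since reversals commute and cancel in
  pairs, a sequence of inversions is one vector over the two-element field, and two tournaments are
  interchangeable iff they differ by a vector of the span. So only parities have to be matched. The
  parity of the number of edges costs nothing: exchanging the first and the third vertex of an order
  reverses the three arcs of a triangle, which keeps all degree parities. The size
  \<open>n div 2\<close> counts the odd out-degrees of a transitive tournament; its parity is right
  automatically, as the out-degrees of every tournament add up to the number of pairs. On the
  machine side, \<open>p\<close> is given in binary and may be huge, so the program only compares it
  and reads its lowest bit.\<close>

declare add_bit_eq_xor [simp del] mult_bit_eq_and [simp del]

lemma bit_add_self [simp]: "a + a = (0::bit)"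
  by (cases a) auto

lemma bit_add_self_left [simp]: "a + (a + b) = (b::bit)"
  by (simp flip: add.assoc)

lemma bit_add_eq_0_iff: "a + b = 0 \<longleftrightarrow> a = (b::bit)"
  by (cases a; cases b) auto

lemma of_nat_bit: "of_nat k = (of_bool (odd k) :: bit)"
  by (cases "even k") (auto elim!: evenE oddE)

lemma sum_bit_eq_card:
  "finite A \<Longrightarrow> (\<Sum>x\<in>A. g x) = (of_nat (card {x \<in> A. g x = 1}) :: bit)"
proof -
  assume A: "finite A"
  have "g x = of_bool (g x = 1)" for x by (cases "g x") auto
  then have "(\<Sum>x\<in>A. g x) = (\<Sum>x\<in>A. of_bool (g x = 1))" by metis
  also have "\<dots> = of_nat (card {x \<in> A. g x = 1})" using A by (simp add: Int_def)
  finally show ?thesis .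
qed

text \<open>
  A subgraph of the complete graph on \<open>V\<close> is a symmetric function into the two-element field. Values
  on the diagonal and outside \<open>V\<close> are irrelevant.
\<close>

definition deg :: "'a set \<Rightarrow> ('a \<Rightarrow> 'a \<Rightarrow> bit) \<Rightarrow> 'a \<Rightarrow> bit" where
  "deg V F u = (\<Sum>v\<in>V - {u}. F u v)"

definition edge_parity :: "'a::linorder set \<Rightarrow> ('a \<Rightarrow> 'a \<Rightarrow> bit) \<Rightarrow> bit" where
  "edge_parity V F = (\<Sum>(u, v)\<in>{(u, v). u \<in> V \<and> v \<in> V \<and> u < v}. F u v)"

definition sym_fun_on :: "'a set \<Rightarrow> ('a \<Rightarrow> 'a \<Rightarrow> bit) \<Rightarrow> bool" where
  "sym_fun_on V F \<longleftrightarrow> (\<forall>u\<in>V. \<forall>v\<in>V. u \<noteq> v \<longrightarrow> F u v = F v u)"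

definition edge :: "'a \<Rightarrow> 'a \<Rightarrow> 'a \<Rightarrow> 'a \<Rightarrow> bit" where
  "edge x y u v = of_bool (u = x \<and> v = y \<or> u = y \<and> v = x)"

text \<open>The scalars are 0 and 1, so a list of sets is a general linear combination, and it is at
  the same time a sequence of inversions. Equality is demanded off the diagonal only, where arcs can
  occur.\<close>

definition invspan :: "'a set \<Rightarrow> nat \<Rightarrow> ('a \<Rightarrow> 'a \<Rightarrow> bit) \<Rightarrow> bool" where
  "invspan V p F \<longleftrightarrow> (\<exists>Xs. (\<forall>X\<in>set Xs. X \<subseteq> V \<and> card X = p) \<and>
     (\<forall>u\<in>V. \<forall>v\<in>V. u \<noteq> v \<longrightarrow> F u v = (\<Sum>X\<leftarrow>Xs. of_bool (u \<in> X \<and> v \<in> X))))"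

lemma deg_add: "deg V (\<lambda>x y. F x y + G x y) u = deg V F u + deg V G u"
  by (simp add: deg_def sum.distrib)

lemma deg_cong:
  "(\<And>v. v \<in> V \<Longrightarrow> u \<noteq> v \<Longrightarrow> F u v = G u v) \<Longrightarrow> deg V F u = deg V G u"
  unfolding deg_def by (rule sum.cong) auto

lemma edge_parity_add:
  "edge_parity V (\<lambda>x y. F x y + G x y) = edge_parity V F + edge_parity V G"
  by (simp add: edge_parity_def sum.distrib case_prod_unfold)

lemma sym_fun_on_add:
  "sym_fun_on V F \<Longrightarrow> sym_fun_on V G \<Longrightarrow> sym_fun_on V (\<lambda>x y. F x y + G x y)"
  by (auto simp: sym_fun_on_def)

lemma finite_less_pairs: "finite V \<Longrightarrow> finite {(u, v). u \<in> V \<and> v \<in> V \<and> u < (v::'a::linorder)}"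
  by (rule finite_subset[of _ "V \<times> V"]) auto

lemma deg_edge:
  assumes "finite V" "x \<in> V" "y \<in> V" "x \<noteq> y"
  shows "deg V (edge x y) u = of_bool (u = x) + of_bool (u = y)"
proof -
  have "edge x y u v = of_bool (u = x) * of_bool (v = y) + of_bool (u = y) * of_bool (v = x)" for v
    using assms(4) by (auto simp: edge_def)
  moreover have "(\<Sum>v\<in>V - {u}. of_bool (v = z) :: bit) = of_bool (z \<noteq> u)" if "z \<in> V" for z
    using assms(1) that by (simp add: of_bool_def)
  ultimately show ?thesis
    using assms by (simp add: deg_def sum.distrib flip: sum_distrib_left)
qed

lemma edge_parity_edge:
  assumes "finite V" "x \<in> V" "y \<in> V" "x \<noteq> (y::'a::linorder)"
  shows "edge_parity V (edge x y) = 1"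
proof -
  have "edge_parity V (edge x y) = (\<Sum>e\<in>{(u, v). u \<in> V \<and> v \<in> V \<and> u < v}.
      if e = (min x y, max x y) then 1 else 0)"
    unfolding edge_parity_def
    by (rule sum.cong) (use assms in \<open>auto simp: edge_def min_def max_def\<close>)
  also have "\<dots> = 1"
    using assms by (subst sum.delta) (auto simp: finite_less_pairs min_def max_def)
  finally show ?thesis .
qed

lemma sym_fun_on_edge: "sym_fun_on V (edge x y)"
  by (auto simp: sym_fun_on_def edge_def)

text \<open>The handshake lemma modulo 2. A new vertex adds its row and its column of
  \<open>F\<close> to the sum, and these agree by symmetry. It is applied to the whole vertex set
  and also to single components of the complement.\<close>

lemma sum_symmetric_off_diagonal_eq_0:
  assumes "finite C" "sym_fun_on C F"
  shows "(\<Sum>u\<in>C. deg C F u) = 0"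
  using assms
proof (induction C rule: finite_induct)
  case (insert x C)
  have s: "sym_fun_on C F" using insert.prems by (auto simp: sym_fun_on_def)
  have "deg (insert x C) F u = deg C F u + F u x" if "u \<in> C" for u
  proof -
    have "insert x C - {u} = insert x (C - {u})" using that insert by auto
    then show ?thesis using that insert.hyps unfolding deg_def by (simp add: add.commute)
  qed
  then have "(\<Sum>u\<in>C. deg (insert x C) F u) = (\<Sum>u\<in>C. deg C F u) + (\<Sum>u\<in>C. F u x)"
    by (simp add: sum.distrib)
  moreover have "deg (insert x C) F x = (\<Sum>u\<in>C. F x u)"
    using insert.hyps by (simp add: deg_def)
  moreover have "(\<Sum>u\<in>C. F u x) = (\<Sum>u\<in>C. F x u)"
    using insert by (intro sum.cong) (auto simp: sym_fun_on_def)
  ultimately show ?case using insert s by simp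
qed simp


section \<open>The span of the complete graphs on \<open>p\<close> vertices\<close>

lemma invspan_0: "invspan V p (\<lambda>x y. 0)"
  unfolding invspan_def by (rule exI[of _ "[]"]) simp

lemma invspan_add:
  assumes "invspan V p F" "invspan V p G"
  shows "invspan V p (\<lambda>x y. F x y + G x y)"
proof -
  obtain Xs where Xs: "\<forall>X\<in>set Xs. X \<subseteq> V \<and> card X = p"
    and F: "\<forall>u\<in>V. \<forall>v\<in>V. u \<noteq> v \<longrightarrow> F u v = (\<Sum>X\<leftarrow>Xs. of_bool (u \<in> X \<and> v \<in> X))"
    using assms(1) unfolding invspan_def by blast
  obtain Ys where Ys: "\<forall>X\<in>set Ys. X \<subseteq> V \<and> card X = p"
    and G: "\<forall>u\<in>V. \<forall>v\<in>V. u \<noteq> v \<longrightarrow> G u v = (\<Sum>X\<leftarrow>Ys. of_bool (u \<in> X \<and> v \<in> X))"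
    using assms(2) unfolding invspan_def by blast
  have "\<forall>X\<in>set (Xs @ Ys). X \<subseteq> V \<and> card X = p" using Xs Ys by auto
  moreover have "\<forall>u\<in>V. \<forall>v\<in>V. u \<noteq> v \<longrightarrow>
      F u v + G u v = (\<Sum>X\<leftarrow>Xs @ Ys. of_bool (u \<in> X \<and> v \<in> X))"
    unfolding map_append sum_list_append using F G by metis
  ultimately show ?thesis unfolding invspan_def by blast
qed

lemma invspan_sum:
  "finite A \<Longrightarrow> (\<And>i. i \<in> A \<Longrightarrow> invspan V p (F i)) \<Longrightarrow> invspan V p (\<lambda>x y. \<Sum>i\<in>A. F i x y)"
  by (induction A rule: finite_induct) (auto simp: invspan_0 intro: invspan_add)

lemma invspan_scale: "invspan V p F \<Longrightarrow> invspan V p (\<lambda>x y. c * F x y)"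
  by (cases c) (auto simp: invspan_0)

lemma invspan_cong:
  "invspan V p F \<Longrightarrow> (\<And>u v. u \<in> V \<Longrightarrow> v \<in> V \<Longrightarrow> u \<noteq> v \<Longrightarrow> F u v = G u v) \<Longrightarrow> invspan V p G"
  unfolding invspan_def by metis

lemma invspan_complete:
  "X \<subseteq> V \<Longrightarrow> card X = p \<Longrightarrow> invspan V p (\<lambda>u v. of_bool (u \<in> X \<and> v \<in> X))"
  unfolding invspan_def by (rule exI[of _ "[X]"]) auto

lemma invspan_sym: "invspan V p F \<Longrightarrow> sym_fun_on V F"
  unfolding invspan_def sym_fun_on_def by (auto simp: conj_commute)

text \<open>A member of \<open>X\<close> is joined to the \<open>card X - 1\<close> others. So sets
  of odd size leave all degree parities alone, while sets of even size flip those of their members;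
  this is what separates odd from even \<open>p\<close>.\<close>

lemma deg_complete:
  assumes "finite V" "X \<subseteq> V"
  shows "deg V (\<lambda>u v. of_bool (u \<in> X \<and> v \<in> X)) u = of_bool (u \<in> X \<and> even (card X))"
proof (cases "u \<in> X")
  case True
  have fX: "finite X" using assms finite_subset by blast
  have "deg V (\<lambda>u v. of_bool (u \<in> X \<and> v \<in> X)) u = of_nat (card (X - {u}))"
  proof -
    have "(V - {u}) \<inter> X = X - {u}" using assms by blast
    then show ?thesis using True assms(1) by (simp add: deg_def)
  qed
  moreover have "odd (card (X - {u})) \<longleftrightarrow> even (card X)" using card.remove[OF fX True] even_Suc by metis
  ultimately show ?thesis using True by (simp add: of_nat_bit)
qed (simp add: deg_def)

lemma invspan_odd_deg_eq_0:
  assumes "finite V" "odd p" "invspan V p F" "u \<in> V"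
  shows "deg V F u = 0"
proof -
  obtain Xs where Xs: "\<forall>X\<in>set Xs. X \<subseteq> V \<and> card X = p"
    and F: "\<forall>u\<in>V. \<forall>v\<in>V. u \<noteq> v \<longrightarrow> F u v = (\<Sum>X\<leftarrow>Xs. of_bool (u \<in> X \<and> v \<in> X))"
    using assms(3) unfolding invspan_def by blast
  have "deg V F u = deg V (\<lambda>u v. \<Sum>X\<leftarrow>Xs. of_bool (u \<in> X \<and> v \<in> X)) u"
    using F assms(4) by (intro deg_cong) auto
  also have "\<dots> = 0" using Xs
  proof (induction Xs)
    case (Cons X Xs)
    then show ?case using deg_complete[OF assms(1), of X u] assms(2) by (simp add: deg_add)
  qed (simp add: deg_def)
  finally show ?thesis .
qed

section \<open>4-cycles as generators of the even graphs\<close>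

definition cycle4 :: "'a \<Rightarrow> 'a \<Rightarrow> 'a \<Rightarrow> 'a \<Rightarrow> 'a \<Rightarrow> 'a \<Rightarrow> bit" where
  "cycle4 a b c d x y = edge a b x y + edge b c x y + (edge c d x y + edge d a x y)"

definition even_graph :: "'a::linorder set \<Rightarrow> ('a \<Rightarrow> 'a \<Rightarrow> bit) \<Rightarrow> bool" where
  "even_graph V F \<longleftrightarrow> sym_fun_on V F \<and> (\<forall>u\<in>V. deg V F u = 0) \<and> edge_parity V F = 0"

lemma even_graph_0: "even_graph V (\<lambda>x y. 0)"
  by (simp add: even_graph_def sym_fun_on_def deg_def edge_parity_def)

lemma even_graph_add:
  "even_graph V F \<Longrightarrow> even_graph V G \<Longrightarrow> even_graph V (\<lambda>x y. F x y + G x y)"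
  by (simp add: even_graph_def sym_fun_on_add deg_add edge_parity_add)

lemma even_graph_sum:
  "finite A \<Longrightarrow> (\<And>i. i \<in> A \<Longrightarrow> even_graph V (F i)) \<Longrightarrow> even_graph V (\<lambda>x y. \<Sum>i\<in>A. F i x y)"
  by (induction A rule: finite_induct) (auto simp: even_graph_0 intro: even_graph_add)

lemma even_graph_scale: "even_graph V F \<Longrightarrow> even_graph V (\<lambda>x y. c * F x y)"
  by (cases c) (auto simp: even_graph_0)

lemma even_graph_cycle4:
  assumes "finite V" "a \<in> V" "b \<in> V" "c \<in> V" "d \<in> V" "distinct [a, b, c, d]"
  shows "even_graph V (cycle4 a b c d)"
proof -
  have "sym_fun_on V (cycle4 a b c d)"
    unfolding cycle4_def by (intro sym_fun_on_add sym_fun_on_edge)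
  moreover have "deg V (cycle4 a b c d) u = 0" for u
    using assms not_sym[of a d] by (simp add: cycle4_def[abs_def] deg_add deg_edge ac_simps)
  moreover have "edge_parity V (cycle4 a b c d) = 0"
    using assms not_sym[of a d] by (simp add: cycle4_def[abs_def] edge_parity_add edge_parity_edge)
  ultimately show ?thesis by (simp add: even_graph_def)
qed

text \<open>Add the same \<open>p - 2\<close> vertices \<open>Y\<close> to each of the four edges of
  the cycle. In the sum of the four complete graphs, pairs inside \<open>Y\<close> occur four times,
  pairs of a vertex of \<open>Y\<close> and a cycle vertex twice, since the latter lies on two of
  the edges, and the cycle edges once.\<close>

lemma invspan_cycle4:
  assumes fin: "finite V" and p: "2 \<le> p" "p + 2 \<le> card V"
    and V: "a \<in> V" "b \<in> V" "c \<in> V" "d \<in> V" "distinct [a, b, c, d]"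
  shows "invspan V p (cycle4 a b c d)"
proof -
  have "card (V - {a, b, c, d}) = card V - 4"
    using V fin by (subst card_Diff_subset) auto
  then have "p - 2 \<le> card (V - {a, b, c, d})" using p by linarith
  then obtain Y where Y: "Y \<subseteq> V - {a, b, c, d}" "card Y = p - 2"
    using obtain_subset_with_card_n by metis
  have fY: "finite Y" using Y(1) fin finite_subset by blast
  have card: "card (Y \<union> {x, y}) = p" if "x \<noteq> y" "x \<in> {a, b, c, d}" "y \<in> {a, b, c, d}" for x y
    using Y fY that p by (subst card_Un_disjoint) auto
  have sp: "invspan V p (\<lambda>u v. of_bool (u \<in> Y \<union> {x, y} \<and> v \<in> Y \<union> {x, y}))"
    if "x \<noteq> y" "x \<in> {a, b, c, d}" "y \<in> {a, b, c, d}" for x y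
    using that V Y card[OF that] by (intro invspan_complete) auto
  have "invspan V p (\<lambda>u v. of_bool (u \<in> Y \<union> {a, b} \<and> v \<in> Y \<union> {a, b}) +
      of_bool (u \<in> Y \<union> {b, c} \<and> v \<in> Y \<union> {b, c}) +
      (of_bool (u \<in> Y \<union> {c, d} \<and> v \<in> Y \<union> {c, d}) +
      of_bool (u \<in> Y \<union> {d, a} \<and> v \<in> Y \<union> {d, a})))"
    using V(5) by (intro invspan_add sp) auto
  then show ?thesis
  proof (rule invspan_cong)
    fix u v :: 'a assume "u \<noteq> v"
    have d: "a \<notin> Y" "b \<notin> Y" "c \<notin> Y" "d \<notin> Y" using Y by auto
    have ne: "a \<noteq> b" "a \<noteq> c" "a \<noteq> d" "b \<noteq> c" "b \<noteq> d" "c \<noteq> d"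
      "b \<noteq> a" "c \<noteq> a" "d \<noteq> a" "c \<noteq> b" "d \<noteq> b" "d \<noteq> c" using V(5) by auto
    consider "u \<in> Y" "u \<notin> {a, b, c, d}" | "u = a" | "u = b" | "u = c" | "u = d"
      | "u \<notin> Y" "u \<notin> {a, b, c, d}"
      using d by blast
    note cu = this
    consider "v \<in> Y" "v \<notin> {a, b, c, d}" | "v = a" | "v = b" | "v = c" | "v = d"
      | "v \<notin> Y" "v \<notin> {a, b, c, d}"
      using d by blast
    note cv = this
    show "of_bool (u \<in> Y \<union> {a, b} \<and> v \<in> Y \<union> {a, b}) +
      of_bool (u \<in> Y \<union> {b, c} \<and> v \<in> Y \<union> {b, c}) +
      (of_bool (u \<in> Y \<union> {c, d} \<and> v \<in> Y \<union> {c, d}) +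
      of_bool (u \<in> Y \<union> {d, a} \<and> v \<in> Y \<union> {d, a})) = cycle4 a b c d u v"
      by (rule cu; rule cv) (use d ne \<open>u \<noteq> v\<close> in \<open>simp_all add: cycle4_def edge_def\<close>)
  qed
qed

text \<open>
  4-cycles through two fixed vertices \<open>a\<close>, \<open>b\<close> remove all edges that avoid them. Then every vertex has
  either both or none of \<open>a\<close>, \<open>b\<close> as neighbours, and 4-cycles through \<open>a\<close>, \<open>b\<close> and a third vertex \<open>c\<close>
  reduce the graph to the triangle \<open>abc\<close> or to nothing, the former having an odd number of edges.
\<close>

lemma even_graph_imp_invspan:
  fixes V :: "'a::linorder set"
  assumes fin: "finite V" and p: "2 \<le> p" "p + 2 \<le> card V" and F: "even_graph V F"
  shows "invspan V p F"
proof -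
  \<comment> \<open>Taking \<open>a < b < c\<close> makes the triangle edges appear in
    \<open>edge_parity\<close> as \<open>(a, b)\<close>, \<open>(a, c)\<close>,
    \<open>(b, c)\<close>.\<close>
  obtain a b c where abc: "a \<in> V" "b \<in> V" "c \<in> V" "a < b" "b < c"
  proof -
    obtain X where X: "X \<subseteq> V" "card X = 3" using obtain_subset_with_card_n[of 3 V] p by auto
    define xs where "xs = sorted_list_of_set X"
    have fX: "finite X" using X(1) fin finite_subset by blast
    have xs: "sorted xs" "distinct xs" "set xs = X" "length xs = 3"
      using X fX by (auto simp: xs_def)
    then have "xs ! 0 < xs ! 1" "xs ! 1 < xs ! 2"
      using sorted_nth_mono[of xs 0 1] nth_eq_iff_index_eq[of xs 0 1]
        sorted_nth_mono[of xs 1 2] nth_eq_iff_index_eq[of xs 1 2] by simp_all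
    moreover have "xs ! 0 \<in> V" "xs ! 1 \<in> V" "xs ! 2 \<in> V"
      using xs X nth_mem[of 0 xs] nth_mem[of 1 xs] nth_mem[of 2 xs] by auto
    ultimately show ?thesis using that by blast
  qed
  define P where "P = {(u, v). u \<in> V - {a, b} \<and> v \<in> V - {a, b} \<and> u < v}"
  have finP: "finite P" unfolding P_def using fin finite_less_pairs[of "V - {a, b}"] by simp
  \<comment> \<open>Of the edges of \<open>cycle4 u v a b\<close> only \<open>uv\<close> avoids both
    \<open>a\<close> and \<open>b\<close>. So these cycles delete precisely the edges of
    \<open>F\<close> that avoid \<open>a\<close> and \<open>b\<close>, and create no new ones of
    that kind.\<close>
  define H where "H = (\<lambda>x y. \<Sum>e\<in>P. F (fst e) (snd e) * cycle4 (fst e) (snd e) a b x y)"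
  define G where "G = (\<lambda>x y. F x y + H x y)"
  have spH: "invspan V p H" unfolding H_def
    by (intro invspan_sum invspan_scale finP invspan_cycle4 fin p) (use abc in \<open>auto simp: P_def\<close>)
  have evH: "even_graph V H" unfolding H_def
    by (intro even_graph_sum even_graph_scale finP even_graph_cycle4 fin) (use abc in \<open>auto simp: P_def\<close>)
  have evG: "even_graph V G" unfolding G_def by (intro even_graph_add F evH)
  have G_less: "G x y = 0" if "x \<in> V - {a, b}" "y \<in> V - {a, b}" "x < y" for x y
  proof -
    have "H x y = (\<Sum>e\<in>P. if e = (x, y) then F x y else 0)"
      unfolding H_def by (rule sum.cong) (use that in \<open>auto simp: P_def cycle4_def edge_def\<close>)
    also have "\<dots> = F x y" using that finP by (subst sum.delta) (auto simp: P_def)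
    finally show ?thesis by (simp add: G_def)
  qed
  define Q where "Q = V - {a, b, c}"
  \<comment> \<open>The edges \<open>au\<close>, \<open>ub\<close>, \<open>bc\<close>,
    \<open>ca\<close> of the cycle all meet \<open>a\<close> or \<open>b\<close>, so the first
    reduction survives, and the coefficient \<open>G a u\<close> clears the edge
    \<open>au\<close>.\<close>
  define H2 where "H2 = (\<lambda>x y. \<Sum>u\<in>Q. G a u * cycle4 a u b c x y)"
  define K where "K = (\<lambda>x y. G x y + H2 x y)"
  have spH2: "invspan V p H2" unfolding H2_def
    by (intro invspan_sum invspan_scale invspan_cycle4 fin p) (use fin abc in \<open>auto simp: Q_def\<close>)
  have evH2: "even_graph V H2" unfolding H2_def
    by (intro even_graph_sum even_graph_scale even_graph_cycle4 fin) (use fin abc in \<open>auto simp: Q_def\<close>)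
  have evK: "even_graph V K" unfolding K_def by (intro even_graph_add evG evH2)
  have symK: "K x y = K y x" if "x \<in> V" "y \<in> V" "x \<noteq> y" for x y
    using evK that by (auto simp: even_graph_def sym_fun_on_def)
  have K_ab: "K x y = 0" if xy: "x \<in> V - {a, b}" "y \<in> V - {a, b}" "x \<noteq> y" for x y
  proof -
    have "K x y = 0" if "x \<in> V - {a, b}" "y \<in> V - {a, b}" "x < y" for x y
    proof -
      have "H2 x y = 0" unfolding H2_def
        by (rule sum.neutral) (use that in \<open>auto simp: cycle4_def edge_def\<close>)
      then show ?thesis using G_less[OF that] by (simp add: K_def)
    qed
    then show ?thesis using xy symK[of x y] by (metis DiffD1 linorder_neqE)
  qed
  have K_a: "K a x = 0" if "x \<in> Q" for x
  proof -
    have "H2 a x = (\<Sum>u\<in>Q. if u = x then G a x else 0)"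
      unfolding H2_def by (rule sum.cong) (use that abc in \<open>auto simp: Q_def cycle4_def edge_def\<close>)
    also have "\<dots> = G a x" using that fin by (subst sum.delta) (auto simp: Q_def)
    finally show ?thesis by (simp add: K_def)
  qed
  have degK: "(\<Sum>v\<in>V - {u}. K u v) = 0" if "u \<in> V" for u
    using evK that by (simp add: even_graph_def deg_def)
  \<comment> \<open>The only possible neighbours left for \<open>x\<close> are \<open>a\<close> and
    \<open>b\<close>; as its degree is even, losing \<open>a\<close> means losing
    \<open>b\<close>.\<close>
  have K_b: "K b x = 0" if x: "x \<in> Q" for x
  proof -
    have "(\<Sum>v\<in>V - {x}. K x v) = (\<Sum>v\<in>{a, b}. K x v)"
      by (rule sum.mono_neutral_right) (use x abc fin K_ab in \<open>auto simp: Q_def\<close>)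
    then show ?thesis using degK[of x] symK[of x a] symK[of x b] K_a[OF x] x abc by (auto simp: Q_def)
  qed
  have "(\<Sum>v\<in>V - {c}. K c v) = (\<Sum>v\<in>{a, b}. K c v)"
  proof (rule sum.mono_neutral_right)
    show "\<forall>i\<in>V - {c} - {a, b}. K c i = 0" using K_ab[of c] abc by (metis Diff_iff empty_iff insert_iff not_less_iff_gr_or_eq less_trans)
  qed (use abc fin in auto)
  then have c0: "K a c + K b c = 0"
    using degK[of c] symK[of c a] symK[of c b] abc by auto
  have "(\<Sum>v\<in>V - {a}. K a v) = (\<Sum>v\<in>{b, c}. K a v)"
    by (rule sum.mono_neutral_right) (use abc fin K_a in \<open>auto simp: Q_def\<close>)
  then have a0: "K a b + K a c = 0" using degK[of a] abc by auto
  have "edge_parity V K = (\<Sum>e\<in>{(a, b), (a, c), (b, c)}. K (fst e) (snd e))"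
    unfolding edge_parity_def case_prod_unfold
  proof (rule sum.mono_neutral_right)
    show "finite {e. fst e \<in> V \<and> snd e \<in> V \<and> fst e < snd e}"
      using finite_less_pairs[OF fin] by (simp add: case_prod_unfold)
    show "{(a, b), (a, c), (b, c)} \<subseteq> {e. fst e \<in> V \<and> snd e \<in> V \<and> fst e < snd e}"
      using abc by auto
    show "\<forall>e\<in>{e. fst e \<in> V \<and> snd e \<in> V \<and> fst e < snd e} - {(a, b), (a, c), (b, c)}.
        K (fst e) (snd e) = 0"
    proof
      fix e assume e: "e \<in> {e. fst e \<in> V \<and> snd e \<in> V \<and> fst e < snd e} - {(a, b), (a, c), (b, c)}"
      obtain x y where xy: "e = (x, y)" by force
      have "K x y = 0"
      proof (cases "x \<in> {a, b} \<or> y \<in> {a, b}")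
        case True
        have ne: "x \<in> V" "y \<in> V" "x < y" "(x, y) \<noteq> (a, b)" "(x, y) \<noteq> (a, c)" "(x, y) \<noteq> (b, c)"
          using e xy by auto
        have "x \<in> {a, b} \<and> y \<in> Q \<or> y \<in> {a, b} \<and> x \<in> Q"
        proof (cases "x \<in> {a, b}")
          case True
          have "y \<noteq> a" "y \<noteq> b" "y \<noteq> c" using True ne abc by auto
          then show ?thesis using True ne by (simp add: Q_def)
        next
          case False
          have "x \<noteq> c" using False \<open>x \<in> {a, b} \<or> y \<in> {a, b}\<close> ne abc by auto
          then show ?thesis using False \<open>x \<in> {a, b} \<or> y \<in> {a, b}\<close> ne by (simp add: Q_def)
        qed
        then show ?thesis
          using K_a K_b symK[of x y] ne by auto
      next
        case False
        then show ?thesis using K_ab[of x y] e xy by auto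
      qed
      then show "K (fst e) (snd e) = 0" using xy by simp
    qed
  qed
  moreover have "a \<noteq> b" "a \<noteq> c" "b \<noteq> c" using abc by auto
  ultimately have "K a b + (K a c + K b c) = 0" using evK by (simp add: even_graph_def)
  \<comment> \<open>The even degrees of \<open>a\<close> and \<open>c\<close> make the three
    triangle edges equal, and three equal bits with sum 0 vanish.\<close>
  then have z: "K a b = 0" "K a c = 0" "K b c = 0" using a0 c0 by (simp_all add: bit_add_eq_0_iff)
  have K0: "K x y = 0" if xy: "x \<in> V" "y \<in> V" "x \<noteq> y" for x y
  proof -
    have "K x y = 0" if "x \<in> {a, b}" "y \<in> V" "x \<noteq> y" for x y
      using that K_a[of y] K_b[of y] z symK[of a b] abc by (auto simp: Q_def)
    then show ?thesis using K_ab[of x y] symK[of x y] xy by (metis Diff_iff)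
  qed
  have "invspan V p (\<lambda>x y. H x y + H2 x y)" by (intro invspan_add spH spH2)
  then show ?thesis
  proof (rule invspan_cong)
    fix x y assume "x \<in> V" "y \<in> V" "x \<noteq> y"
    from K0[OF this] have "F x y + (H x y + H2 x y) = 0" by (simp add: K_def G_def add.assoc)
    then show "H x y + H2 x y = F x y" by (simp add: bit_add_eq_0_iff)
  qed
qed

section \<open>Tournaments\<close>

text \<open>\<open>T u v = 1\<close> stands for the arc from \<open>u\<close> to \<open>v\<close>.
  Then \<open>deg V T u\<close> is the parity of the out-degree, and reversing the arcs on the edges
  of a symmetric \<open>F\<close> is addition of \<open>F\<close>.\<close>

definition tournament_on :: "'a set \<Rightarrow> ('a \<Rightarrow> 'a \<Rightarrow> bit) \<Rightarrow> bool" where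
  "tournament_on V T \<longleftrightarrow> (\<forall>u\<in>V. \<forall>v\<in>V. u \<noteq> v \<longrightarrow> T u v + T v u = 1)"

lemma tournament_on_add_sym:
  assumes "tournament_on V T" "tournament_on V T'" 
  shows "sym_fun_on V (\<lambda>x y. T x y + T' x y)"
  unfolding sym_fun_on_def
proof (intro ballI impI)
  fix u v assume "u \<in> V" "v \<in> V" "u \<noteq> v"
  then have "T u v + T v u = 1" "T' u v + T' v u = 1" using assms by (auto simp: tournament_on_def)
  then show "T u v + T' u v = T v u + T' v u"
    by (cases "T u v"; cases "T v u"; cases "T' u v"; cases "T' v u") auto
qed

lemma tournament_on_flip:
  assumes "tournament_on V T" "sym_fun_on V F"
  shows "tournament_on V (\<lambda>x y. T x y + F x y)"
  unfolding tournament_on_def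
proof (intro ballI impI)
  fix u v assume "u \<in> V" "v \<in> V" "u \<noteq> v"
  then have "T u v + T v u = 1" "F u v = F v u"
    using assms by (auto simp: tournament_on_def sym_fun_on_def)
  then show "T u v + F u v + (T v u + F v u) = 1"
    by (cases "T u v"; cases "T v u"; cases "F v u") auto
qed

definition order_fun :: "('a \<Rightarrow> nat) \<Rightarrow> 'a \<Rightarrow> 'a \<Rightarrow> bit" where
  "order_fun f u v = of_bool (f u < f v)"

lemma tournament_on_order_fun: "inj_on f V \<Longrightarrow> tournament_on V (order_fun f)"
  unfolding tournament_on_def
proof (intro ballI impI)
  fix u v assume "inj_on f V" "u \<in> V" "v \<in> V" "u \<noteq> v"
  then have "f u < f v \<or> f v < f u" by (metis inj_onD linorder_neqE_nat)
  then show "order_fun f u v + order_fun f v u = 1" by (auto simp: order_fun_def)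
qed

lemma deg_order_fun:
  assumes f: "bij_betw f V {..<n}" and u: "u \<in> V"
  shows "deg V (order_fun f) u = of_bool (odd (n - Suc (f u)))"
proof -
  have fin: "finite V" using f bij_betw_finite by blast
  have "deg V (order_fun f) u = of_nat (card {v \<in> V. f u < f v})"
  proof -
    have "(V - {u}) \<inter> {v. f u < f v} = {v \<in> V. f u < f v}" by auto
    then show ?thesis unfolding deg_def order_fun_def using fin by simp
  qed
  also have "card {v \<in> V. f u < f v} = card (f ` {v \<in> V. f u < f v})"
    using f by (intro card_image[symmetric]) (auto simp: bij_betw_def inj_on_def)
  also have "f ` {v \<in> V. f u < f v} = {f u<..<n}"
  proof (intro equalityI subsetI)
    fix i assume i: "i \<in> {f u<..<n}"
    then obtain v where "v \<in> V" "i = f v" using f by (auto simp: bij_betw_def)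
    then show "i \<in> f ` {v \<in> V. f u < f v}" using i by auto
  qed (use f in \<open>auto simp: bij_betw_def\<close>)
  finally show ?thesis by (simp add: of_nat_bit)
qed

lemma card_odd_lessThan: "card {i. i < n \<and> odd i} = n div 2"
proof (induction n)
  case (Suc n)
  have "{i. i < Suc n \<and> odd i} = (if odd n then insert n {i. i < n \<and> odd i} else {i. i < n \<and> odd i})"
    by (auto simp: less_Suc_eq)
  then show ?case using Suc by auto
qed simp

lemma card_odd_reversed: "card {i. i < n \<and> odd (n - Suc i)} = n div 2"
proof -
  have "bij_betw (\<lambda>i. n - Suc i) {i. i < n \<and> odd (n - Suc i)} {i. i < n \<and> odd i}"
    by (rule bij_betwI[of _ _ _ "\<lambda>i. n - Suc i"]) (auto simp: Suc_diff_Suc)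
  then show ?thesis using card_odd_lessThan[of n] bij_betw_same_card by fastforce
qed

lemma card_odd_deg_order_fun:
  assumes f: "bij_betw f V {..<n}"
  shows "card {u \<in> V. deg V (order_fun f) u = 1} = n div 2"
proof -
  have "{u \<in> V. deg V (order_fun f) u = 1} = {u \<in> V. odd (n - Suc (f u))}"
    using deg_order_fun[OF f] by auto
  moreover have "bij_betw f {u \<in> V. odd (n - Suc (f u))} {i. i < n \<and> odd (n - Suc i)}"
    by (rule bij_betw_subset[OF f]) (use f in \<open>auto simp: bij_betw_def\<close>)
  ultimately show ?thesis using card_odd_reversed[of n] bij_betw_same_card by fastforce
qed

text \<open>Counting the odd out-degrees is enough because the order is free: the vertices of odd
  out-degree are sent by any bijection to the ranks that have odd out-degree in a transitive
  tournament. The difference \<open>F\<close> of the two tournaments then has even degrees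
  everywhere.\<close>

lemma tournament_to_order:
  fixes V :: "'a::linorder set"
  assumes fin: "finite V" and p: "2 \<le> p" "p + 2 \<le> card V" and T: "tournament_on V T"
    and S: "card {u \<in> V. deg V T u = 1} = card V div 2"
  shows "\<exists>F f. invspan V p F \<and> inj_on f V \<and>
    (\<forall>u\<in>V. \<forall>v\<in>V. u \<noteq> v \<longrightarrow> T u v + F u v = order_fun f u v)"
proof -
  define n where "n = card V"
  define S where "S = {u \<in> V. deg V T u = 1}"
  \<comment> \<open>Arcs lead to higher ranks, so the vertex of rank \<open>i\<close> has out-degree
    \<open>n - Suc i\<close>.\<close>
  define I where "I = {i. i < n \<and> odd (n - Suc i)}"
  have SV: "S \<subseteq> V" and IV: "I \<subseteq> {..<n}" and cS: "card S = card I"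
    using S card_odd_reversed[of n] by (auto simp: S_def I_def n_def)
  have "finite S" "finite I" using SV IV fin finite_subset by blast+
  then obtain g where g: "bij_betw g S I" using cS finite_same_card_bij by blast
  have "card (V - S) = card ({..<n} - I)"
    using SV IV cS fin \<open>finite S\<close> \<open>finite I\<close> by (simp add: card_Diff_subset n_def)
  then obtain h where h: "bij_betw h (V - S) ({..<n} - I)"
    using fin finite_same_card_bij[of "V - S" "{..<n} - I"] by auto
  define f where "f = (\<lambda>u. if u \<in> S then g u else h u)"
  have f1: "bij_betw f S I" using g by (rule bij_betw_cong[THEN iffD1, rotated]) (simp add: f_def)
  have f2: "bij_betw f (V - S) ({..<n} - I)"
    using h by (rule bij_betw_cong[THEN iffD1, rotated]) (simp add: f_def)
  have f: "bij_betw f V {..<n}"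
    using bij_betw_combine[OF f1 f2] SV IV by (simp add: Un_absorb1)
  have fI: "f u \<in> I \<longleftrightarrow> u \<in> S" if "u \<in> V" for u
    using f1 f2 that by (auto simp: bij_betw_def)
  have fn: "f u < n" if "u \<in> V" for u using f that by (auto simp: bij_betw_def)
  have deg: "deg V T u = deg V (order_fun f) u" if u: "u \<in> V" for u
    using deg_order_fun[OF f u] fI[OF u] fn[OF u] u by (auto simp: S_def I_def)
  define F where "F = (\<lambda>x y. T x y + order_fun f x y)"
  have inj: "inj_on f V" using f by (simp add: bij_betw_def)
  have symF: "sym_fun_on V F"
    unfolding F_def by (intro tournament_on_add_sym T tournament_on_order_fun inj)
  have degF: "deg V F u = 0" if "u \<in> V" for u
    using deg[OF that] by (simp add: F_def deg_add)
  show ?thesis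
  proof (cases "edge_parity V F = 0")
    case True
    then have "invspan V p F"
      using symF degF by (intro even_graph_imp_invspan fin p) (simp add: even_graph_def)
    then show ?thesis using inj by (intro exI[of _ F] exI[of _ f]) (simp add: F_def)
  next
    case False
    \<comment> \<open>\<open>F\<close> has an odd number of edges. The ranks 0, 1, 2 needed for the
      repair exist since \<open>card V\<close> is at least \<open>p + 2\<close>, hence at least
      4.\<close>
    have "\<exists>x\<in>V. f x = i" if "i < 3" for i
    proof -
      have "i \<in> f ` V" using f p that by (simp add: bij_betw_def n_def)
      then show ?thesis by auto
    qed
    from this[of 0] this[of 1] this[of 2]
    obtain x y z where xyz: "x \<in> V" "y \<in> V" "z \<in> V" "f x = 0" "f y = 1" "f z = 2" by auto
    \<comment> \<open>All other vertices rank above \<open>x\<close>, \<open>y\<close>,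
      \<open>z\<close>, so exchanging the ranks 0 and 2 reverses just the three arcs among these.
      They form the triangle \<open>K\<close>, with even degrees and three edges.\<close>
    define \<tau> :: "nat \<Rightarrow> nat" where "\<tau> = (\<lambda>i. if i = 0 then 2 else if i = 2 then 0 else i)"
    define f' where "f' = \<tau> \<circ> f"
    define K where "K = (\<lambda>u v. edge x y u v + (edge y z u v + edge x z u v))"
    have d: "x \<noteq> y" "y \<noteq> z" "x \<noteq> z" using xyz by auto
    have inj': "inj_on f' V"
      unfolding f'_def by (intro comp_inj_on inj) (auto simp: \<tau>_def inj_on_def split: if_splits)
    have fK: "order_fun f' u v = order_fun f u v + K u v" if uv: "u \<in> V" "v \<in> V" "u \<noteq> v" for u v
    proof -
      have eq: "w = x \<longleftrightarrow> f w = 0" "w = y \<longleftrightarrow> f w = 1" "w = z \<longleftrightarrow> f w = 2" if "w \<in> V" for w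
        using inj_onD[OF inj, of w x] inj_onD[OF inj, of w y] inj_onD[OF inj, of w z] that xyz by auto
      have ne: "f u \<noteq> f v" using inj uv by (auto dest: inj_onD)
      show ?thesis
        unfolding order_fun_def f'_def K_def edge_def eq[OF uv(1)] eq[OF uv(2)]
        using ne by (cases "f u < 3"; cases "f v < 3")
          (auto simp: \<tau>_def numeral_3_eq_3 less_Suc_eq)
    qed
    define F' where "F' = (\<lambda>u v. F u v + K u v)"
    have "sym_fun_on V F'" unfolding F'_def K_def by (intro sym_fun_on_add symF sym_fun_on_edge)
    moreover have "deg V F' u = 0" if "u \<in> V" for u
      using degF[OF that] d xyz(1-3) fin by (simp add: F'_def K_def deg_add deg_edge ac_simps)
    moreover have "edge_parity V F' = 0"
      using False d xyz(1-3) fin by (simp add: F'_def K_def edge_parity_add edge_parity_edge)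
    ultimately have "invspan V p F'"
      by (intro even_graph_imp_invspan fin p) (simp add: even_graph_def)
    moreover have "T u v + F' u v = order_fun f' u v" if "u \<in> V" "v \<in> V" "u \<noteq> v" for u v
      unfolding fK[OF that] by (simp add: F'_def F_def add.assoc)
    ultimately show ?thesis using inj' by (intro exI[of _ F'] exI[of _ f']) simp
  qed
qed

text \<open>A nonempty \<open>Z\<close> that meets every class evenly contains two related elements,
  and removing both keeps all intersections even. \<open>P Z\<close> will say that the parities
  exactly at \<open>Z\<close> can be flipped, so only the flipping of two vertices has to be
  realised. For even \<open>p\<close> there is one class, for odd \<open>p\<close> the classes are
  the components of the complement.\<close>

lemma pairing_induct:
  assumes fin: "finite V" and r: "equiv V r" and Z: "Z \<subseteq> V"
    and even: "\<And>u. u \<in> V \<Longrightarrow> even (card (Z \<inter> r `` {u}))"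
    and empty: "P {}"
    and step: "\<And>Z x y. P Z \<Longrightarrow> (x, y) \<in> r \<Longrightarrow> x \<noteq> y \<Longrightarrow> x \<notin> Z \<Longrightarrow> y \<notin> Z \<Longrightarrow> Z \<subseteq> V \<Longrightarrow>
      P (insert x (insert y Z))"
  shows "P Z"
  using Z even
proof (induction "card Z" arbitrary: Z rule: less_induct)
  case less
  have finZ: "finite Z" using less.prems(1) fin finite_subset by blast
  show ?case
  proof (cases "Z = {}")
    case False
    then obtain x where x: "x \<in> Z" by blast
    then have xV: "x \<in> V" using less.prems by blast
    have refl: "(u, u) \<in> r" if "u \<in> V" for u using r that by (simp add: equiv_def refl_on_def)
    have "Z \<inter> r `` {x} \<noteq> {x}" using less.prems(2)[OF xV] by (metis card_1_singleton_iff One_nat_def odd_one)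
    then obtain y where y: "y \<in> Z" "(x, y) \<in> r" "x \<noteq> y" using x refl[OF xV] by blast
    define Z' where "Z' = Z - {x, y}"
    have Z: "Z = insert x (insert y Z')" and nZ: "x \<notin> Z'" "y \<notin> Z'" using x y by (auto simp: Z'_def)
    have "even (card (Z' \<inter> r `` {u}))" if u: "u \<in> V" for u
    proof (cases "(u, x) \<in> r")
      case True
      then have "(u, y) \<in> r" using y(2) r by (meson equivE transD)
      then have "Z \<inter> r `` {u} = insert x (insert y (Z' \<inter> r `` {u}))" using True x y by (auto simp: Z'_def)
      then show ?thesis using less.prems(2)[OF u] y(3) nZ finZ
        by (simp add: Z'_def)
    next
      case False
      then have "(u, y) \<notin> r" using y(2) r by (meson equivE transD symD)
      then have "Z \<inter> r `` {u} = Z' \<inter> r `` {u}" using False by (auto simp: Z'_def)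
      then show ?thesis using less.prems(2)[OF u] by simp
    qed
    moreover have "card Z' < card Z" unfolding Z'_def using x finZ by (intro psubset_card_mono) auto
    moreover have "Z' \<subseteq> V" using less.prems(1) by (auto simp: Z'_def)
    ultimately have "P Z'" using less.hyps by blast
    then show ?thesis unfolding Z using step y nZ \<open>Z' \<subseteq> V\<close> by blast
  qed (simp add: empty)
qed

section \<open>Invertibility of oriented graphs\<close>

text \<open>Only arcs of \<open>E\<close> and their reversals are produced, so the values of
  \<open>F\<close> on nonadjacent pairs are irrelevant.\<close>

definition flip_arcs :: "('a \<Rightarrow> 'a \<Rightarrow> bit) \<Rightarrow> 'a rel \<Rightarrow> 'a rel" where
  "flip_arcs F E = {(u, v). (u, v) \<in> E \<and> F u v = 0 \<or> (v, u) \<in> E \<and> F u v = 1}"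

lemma parcs_inversion:
  "parcs (inversion X D) = flip_arcs (\<lambda>u v. of_bool (u \<in> X \<and> v \<in> X)) (parcs D)"
  by (auto simp: inversion_def flip_arcs_def)

lemma flip_arcs_flip_arcs:
  assumes "\<And>u v. G u v = G v u"
  shows "flip_arcs F (flip_arcs G E) = flip_arcs (\<lambda>u v. F u v + G u v) E"
proof -
  have "(u, v) \<in> flip_arcs F (flip_arcs G E) \<longleftrightarrow> (u, v) \<in> flip_arcs (\<lambda>u v. F u v + G u v) E" for u v
    using assms[of u v] unfolding flip_arcs_def by (cases "F u v"; cases "G v u") auto
  then show ?thesis by auto
qed

lemma parcs_fold_inversion:
  "parcs (fold inversion Xs D) = flip_arcs (\<lambda>u v. \<Sum>X\<leftarrow>Xs. of_bool (u \<in> X \<and> v \<in> X)) (parcs D)"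
proof (induction Xs arbitrary: D)
  case (Cons X Xs)
  have "parcs (fold inversion (X # Xs) D) =
      flip_arcs (\<lambda>u v. \<Sum>X\<leftarrow>Xs. of_bool (u \<in> X \<and> v \<in> X))
        (flip_arcs (\<lambda>u v. of_bool (u \<in> X \<and> v \<in> X)) (parcs D))"
    by (simp add: Cons.IH parcs_inversion)
  then show ?case by (subst (asm) flip_arcs_flip_arcs) (auto simp: add.commute)
qed (simp add: flip_arcs_def)

lemma oriented_graphD:
  assumes "oriented_graph D"
  shows "finite (pverts D)" "\<And>u v. (u, v) \<in> parcs D \<Longrightarrow> u \<in> pverts D \<and> v \<in> pverts D"
    "\<And>u v. (u, v) \<in> parcs D \<Longrightarrow> (v, u) \<notin> parcs D"
proof -
  have fin: "pair_fin_digraph D"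
    using assms unfolding oriented_graph_def by (simp add: pair_digraph.axioms(1))
  then have wf: "pair_wf_digraph D" by (rule pair_fin_digraph.axioms(1))
  show "finite (pverts D)" by (rule pair_fin_digraph.pair_finite_verts[OF fin])
  show "\<And>u v. (u, v) \<in> parcs D \<Longrightarrow> u \<in> pverts D \<and> v \<in> pverts D"
    using pair_wf_digraph.in_arcsD1[OF wf] pair_wf_digraph.in_arcsD2[OF wf] by simp
  show "\<And>u v. (u, v) \<in> parcs D \<Longrightarrow> (v, u) \<notin> parcs D"
    using assms by (simp add: oriented_graph_def)
qed

text \<open>A sequence of inversions acts through the sum of the indicator functions of its sets.
  \<open>invspan\<close> fixes this sum off the diagonal, which suffices because an oriented graph
  has no loops.\<close>

lemma eq_invertible_iff_invspan:
  assumes D: "oriented_graph D"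
  shows "eq_invertible p D \<longleftrightarrow> (\<exists>F. invspan (pverts D) p F \<and> acyclic (flip_arcs F (parcs D)))"
proof
  assume "eq_invertible p D"
  then obtain Xs where Xs: "\<forall>X\<in>set Xs. X \<subseteq> pverts D \<and> card X = p"
    "acyclic (flip_arcs (\<lambda>u v. \<Sum>X\<leftarrow>Xs. of_bool (u \<in> X \<and> v \<in> X)) (parcs D))"
    unfolding eq_invertible_def parcs_fold_inversion by blast
  moreover from Xs(1) have "invspan (pverts D) p (\<lambda>u v. \<Sum>X\<leftarrow>Xs. of_bool (u \<in> X \<and> v \<in> X))"
    unfolding invspan_def by blast
  ultimately show "\<exists>F. invspan (pverts D) p F \<and> acyclic (flip_arcs F (parcs D))" by blast
next
  assume "\<exists>F. invspan (pverts D) p F \<and> acyclic (flip_arcs F (parcs D))"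
  then obtain F Xs where Xs: "\<forall>X\<in>set Xs. X \<subseteq> pverts D \<and> card X = p"
    and F: "\<forall>u\<in>pverts D. \<forall>v\<in>pverts D. u \<noteq> v \<longrightarrow> F u v = (\<Sum>X\<leftarrow>Xs. of_bool (u \<in> X \<and> v \<in> X))"
    and ac: "acyclic (flip_arcs F (parcs D))"
    unfolding invspan_def by blast
  have E: "u \<in> pverts D \<and> v \<in> pverts D \<and> u \<noteq> v" if "(u, v) \<in> parcs D \<or> (v, u) \<in> parcs D" for u v
    using oriented_graphD[OF D] that by blast
  have "flip_arcs F (parcs D) = flip_arcs (\<lambda>u v. \<Sum>X\<leftarrow>Xs. of_bool (u \<in> X \<and> v \<in> X)) (parcs D)"
  proof -
    have "F u v = (\<Sum>X\<leftarrow>Xs. of_bool (u \<in> X \<and> v \<in> X))" if "(u, v) \<in> parcs D \<or> (v, u) \<in> parcs D" for u v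
      using F E[OF that] by blast
    then show ?thesis unfolding flip_arcs_def by (metis (no_types, lifting))
  qed
  then show "eq_invertible p D" unfolding eq_invertible_def parcs_fold_inversion using Xs ac by auto
qed

text \<open>Topological sorting: the converse of a finite acyclic relation is well-founded, so there
  is a sink, which gets the last rank. The ranks fill an initial segment so that out-degrees in the
  order can be read off from them.\<close>

lemma acyclic_imp_rank:
  assumes "finite V" "E \<subseteq> V \<times> V" "acyclic E"
  shows "\<exists>f. bij_betw f V {..<card V} \<and> (\<forall>(u, v)\<in>E. f u < (f v::nat))"
  using assms
proof (induction "card V" arbitrary: V E)
  case 0
  then show ?case by (auto simp: bij_betw_def)
next
  case (Suc n)
  have "finite E" using Suc.prems finite_subset by blast
  then have wf: "wf (E\<inverse>)" using Suc.prems by (intro finite_acyclic_wf_converse)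
  have "V \<noteq> {}" using Suc.hyps by auto
  then obtain z where z: "z \<in> V" "\<And>y. (z, y) \<in> E \<Longrightarrow> y \<notin> V"
    using wf unfolding wf_eq_minimal by (metis converse_iff ex_in_conv)
  define E' where "E' = {(u, v) \<in> E. u \<noteq> z \<and> v \<noteq> z}"
  have n: "n = card (V - {z})" using Suc.hyps(2) Suc.prems z by simp
  have "acyclic E'" by (rule acyclic_subset[OF Suc.prems(3)]) (auto simp: E'_def)
  then obtain g where g: "bij_betw g (V - {z}) {..<n}" "\<forall>(u, v)\<in>E'. g u < g v"
    using Suc.hyps(1)[OF n, of E'] Suc.prems n by (auto simp: E'_def)
  define f where "f = g(z := n)"
  have "bij_betw f (V - {z}) {..<n}" using g(1) by (rule bij_betw_cong[THEN iffD1, rotated]) (simp add: f_def)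
  then have "bij_betw f ((V - {z}) \<union> {z}) ({..<n} \<union> {f z})"
    by (rule notIn_Un_bij_betw[rotated 2]) (auto simp: f_def)
  moreover have "(V - {z}) \<union> {z} = V" "{..<n} \<union> {f z} = {..<card V}"
    using z Suc.hyps(2) by (auto simp: f_def)
  moreover have "f u < f v" if "(u, v) \<in> E" for u v
  proof -
    have V: "u \<in> V" "v \<in> V" "u \<noteq> z" using that Suc.prems z by auto
    show ?thesis
    proof (cases "v = z")
      case True
      then show ?thesis using V g(1) by (auto simp: f_def bij_betw_def)
    next
      case False
      then show ?thesis using V g(2) that by (auto simp: f_def E'_def)
    qed
  qed
  ultimately show ?case by (intro exI[of _ f]) auto
qed

lemma acyclicI_rank: "(\<And>u v. (u, v) \<in> E \<Longrightarrow> f u < (f v::nat)) \<Longrightarrow> acyclic E"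
  by (rule wf_acyclic, rule wf_subset[OF wf_measure[of f]]) auto

text \<open>It suffices to make some tournament \<open>T\<close> that contains \<open>D\<close>
  transitive: under the same reversals the arcs of \<open>D\<close> stay among those of the
  tournament.\<close>

lemma acyclic_flip_arcs:
  assumes D: "oriented_graph D" and T: "tournament_on (pverts D) T"
    and TE: "\<And>u v. (u, v) \<in> parcs D \<Longrightarrow> T u v = 1"
    and f: "\<forall>u\<in>pverts D. \<forall>v\<in>pverts D. u \<noteq> v \<longrightarrow> T u v + F u v = order_fun f u v"
  shows "acyclic (flip_arcs F (parcs D))"
proof (rule acyclicI_rank)
  fix u v assume uv: "(u, v) \<in> flip_arcs F (parcs D)"
  then have V: "u \<in> pverts D" "v \<in> pverts D" "u \<noteq> v"
    using oriented_graphD[OF D] by (auto simp: flip_arcs_def)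
  have "T u v + T v u = 1" using T V by (auto simp: tournament_on_def)
  moreover have "T u v = 1 \<and> F u v = 0 \<or> T v u = 1 \<and> F u v = 1"
    using uv TE by (auto simp: flip_arcs_def)
  ultimately have "T u v + F u v = 1" by (cases "T u v") auto
  then show "f u < f v" using f V by (auto simp: order_fun_def)
qed

text \<open>One arbitrary tournament containing \<open>E\<close>, with nonadjacent pairs oriented
  upwards because the program can compare vertex numbers directly.\<close>

definition completion :: "'a::linorder rel \<Rightarrow> 'a \<Rightarrow> 'a \<Rightarrow> bit" where
  "completion E u v = of_bool ((u, v) \<in> E \<or> (v, u) \<notin> E \<and> u < v)"

lemma tournament_on_completion:
  fixes D :: "'a::linorder pair_pre_digraph"
  assumes D: "oriented_graph D"
  shows "tournament_on V (completion (parcs D))"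
  unfolding tournament_on_def
proof (intro ballI impI)
  fix u v :: 'a assume "u \<noteq> v"
  then have "u < v \<or> v < u" by auto
  then show "completion (parcs D) u v + completion (parcs D) v u = 1"
    using oriented_graphD(3)[OF D, of u v] by (auto simp: completion_def)
qed

section \<open>Invertibility for \<open>p + 2 \<le> n\<close>, by the parity of
  \<open>p\<close>\<close>

lemma card_parity_sum:
  "finite A \<Longrightarrow> (\<Sum>x\<in>A. g x) = (of_bool (odd (card {x \<in> A. g x = 1})) :: bit)"
  by (simp add: sum_bit_eq_card of_nat_bit)

theorem eq_invertible_even:
  fixes D :: "'a::linorder pair_pre_digraph"
  assumes D: "oriented_graph D" and p: "even p" "2 \<le> p" "p + 2 \<le> card (pverts D)"
  shows "eq_invertible p D"
proof -
  define V where "V = pverts D"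
  define T where "T = completion (parcs D)"
  have fin: "finite V" using oriented_graphD[OF D] by (simp add: V_def)
  have T: "tournament_on V T" unfolding T_def by (rule tournament_on_completion[OF D])
  have pV: "p + 2 \<le> card V" using p by (simp add: V_def)
  obtain g where g: "bij_betw g V {..<card V}"
    using ex_bij_betw_finite_nat[OF fin] by (auto simp: atLeast0LessThan)
  \<comment> \<open>\<open>J\<close> compares \<open>T\<close> with an arbitrary transitive
    tournament. By the handshake lemma the set \<open>Z\<close> of vertices with the wrong parity
    has even size, so it can be corrected in pairs.\<close>
  define J where "J = (\<lambda>x y. T x y + order_fun g x y)"
  have symJ: "sym_fun_on V J"
    unfolding J_def using g by (intro tournament_on_add_sym T tournament_on_order_fun) (simp add: bij_betw_def)
  define Z where "Z = {u \<in> V. deg V J u = 1}"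
  have "even (card Z)"
    using sum_symmetric_off_diagonal_eq_0[OF fin symJ] fin by (simp add: card_parity_sum Z_def)
  have "\<exists>Q. invspan V p Q \<and> (\<forall>u\<in>V. deg V Q u = of_bool (u \<in> Z))"
  proof (rule pairing_induct[of V "V \<times> V"])
    show "equiv V (V \<times> V)" by (auto simp: equiv_def refl_on_def sym_def trans_def)
    show "Z \<subseteq> V" by (auto simp: Z_def)
    have "Z \<inter> (V \<times> V) `` {u} = Z" if "u \<in> V" for u using that by (auto simp: Z_def)
    then show "even (card (Z \<inter> (V \<times> V) `` {u}))" if "u \<in> V" for u
      using that \<open>even (card Z)\<close> by simp
    show "\<exists>Q. invspan V p Q \<and> (\<forall>u\<in>V. deg V Q u = of_bool (u \<in> {}))"
      by (rule exI[of _ "\<lambda>x y. 0"]) (simp add: invspan_0 deg_def)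
  next
    fix Z x y
    assume IH: "\<exists>Q. invspan V p Q \<and> (\<forall>u\<in>V. deg V Q u = of_bool (u \<in> Z))"
      and xy: "(x, y) \<in> V \<times> V" "x \<noteq> y" and nZ: "x \<notin> Z" "y \<notin> Z"
    obtain Q where Q: "invspan V p Q" "\<forall>u\<in>V. deg V Q u = of_bool (u \<in> Z)" using IH by blast
    have "card (V - {x, y}) = card V - 2" using xy fin by (simp add: card_Diff_subset)
    then have "p - 1 \<le> card (V - {x, y})" using pV by linarith
    then obtain Y where Y: "Y \<subseteq> V - {x, y}" "card Y = p - 1"
      using obtain_subset_with_card_n by metis
    have fY: "finite Y" using Y(1) fin finite_subset by blast
    define KX where "KX = (\<lambda>w u v. of_bool (u \<in> insert w Y \<and> v \<in> insert w Y) :: bit)"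
    have "x \<notin> Y" "y \<notin> Y" using Y by auto
    then have c: "card (insert x Y) = p" "card (insert y Y) = p" using Y(2) fY p(2) by simp_all
    have "insert x Y \<subseteq> V" "insert y Y \<subseteq> V" using Y xy by auto
    with c have sp: "invspan V p (KX x)" "invspan V p (KX y)" unfolding KX_def
      by (blast intro: invspan_complete)+
    have dg: "deg V (KX w) u = of_bool (u \<in> insert w Y)" if "w \<in> {x, y}" for u w
      unfolding KX_def using c that p(1) \<open>insert x Y \<subseteq> V\<close> \<open>insert y Y \<subseteq> V\<close>
      by (subst deg_complete[OF fin]) auto
    have "deg V (\<lambda>a b. Q a b + (KX x a b + KX y a b)) u = of_bool (u \<in> insert x (insert y Z))"
      if "u \<in> V" for u
      using Q(2) that xy(2) nZ dg \<open>x \<notin> Y\<close> \<open>y \<notin> Y\<close> by (auto simp: deg_add)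
    then show "\<exists>Q. invspan V p Q \<and> (\<forall>u\<in>V. deg V Q u = of_bool (u \<in> insert x (insert y Z)))"
      by (intro exI[of _ "\<lambda>a b. Q a b + (KX x a b + KX y a b)"] conjI invspan_add Q sp) blast
  qed (rule fin)
  then obtain Q where Q: "invspan V p Q" "\<forall>u\<in>V. deg V Q u = of_bool (u \<in> Z)" by blast
  define T' where "T' = (\<lambda>x y. T x y + Q x y)"
  have "tournament_on V T'" unfolding T'_def by (intro tournament_on_flip T invspan_sym[OF Q(1)])
  moreover have "deg V T' u = deg V (order_fun g) u" if u: "u \<in> V" for u
  proof -
    have "deg V Q u = deg V J u" using Q(2) u by (auto simp: Z_def)
    then show ?thesis by (simp add: T'_def J_def deg_add)
  qed
  then have "{u \<in> V. deg V T' u = 1} = {u \<in> V. deg V (order_fun g) u = 1}" by auto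
  then have "card {u \<in> V. deg V T' u = 1} = card V div 2" using card_odd_deg_order_fun[OF g] by simp
  ultimately obtain F f where F: "invspan V p F"
    "\<forall>u\<in>V. \<forall>v\<in>V. u \<noteq> v \<longrightarrow> T' u v + F u v = order_fun f u v"
    using tournament_to_order[OF fin p(2) pV] by blast
  have "acyclic (flip_arcs (\<lambda>x y. Q x y + F x y) (parcs D))"
  proof (rule acyclic_flip_arcs[OF D])
    show "tournament_on (pverts D) T" using T by (simp add: V_def)
    show "\<forall>u\<in>pverts D. \<forall>v\<in>pverts D. u \<noteq> v \<longrightarrow> T u v + (Q u v + F u v) = order_fun f u v"
      using F(2) by (simp add: T'_def V_def add.assoc)
  qed (simp add: T_def completion_def)
  moreover have "invspan V p (\<lambda>x y. Q x y + F x y)" by (intro invspan_add Q F)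
  ultimately show ?thesis using eq_invertible_iff_invspan[OF D] by (auto simp: V_def)
qed

text \<open>For loopless \<open>E\<close> this contains the diagonal of \<open>V\<close>. Hence the
  transitive closure, which Warshall's algorithm delivers, is already an equivalence relation; its
  classes are the components of the complement.\<close>

definition nonadj :: "'a set \<Rightarrow> 'a rel \<Rightarrow> 'a rel" where
  "nonadj V E = {(u, v). u \<in> V \<and> v \<in> V \<and> (u, v) \<notin> E \<and> (v, u) \<notin> E}"

lemma equiv_nonadj:
  assumes D: "oriented_graph D"
  shows "equiv (pverts D) ((nonadj (pverts D) (parcs D))\<^sup>+)"
proof (rule equivI)
  have sub: "nonadj (pverts D) (parcs D) \<subseteq> pverts D \<times> pverts D" by (auto simp: nonadj_def)
  show "(nonadj (pverts D) (parcs D))\<^sup>+ \<subseteq> pverts D \<times> pverts D" by (rule trancl_subset_Sigma[OF sub])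
  have "(u, u) \<in> nonadj (pverts D) (parcs D)" if "u \<in> pverts D" for u
    using that oriented_graphD(3)[OF D] by (auto simp: nonadj_def)
  then show "refl_on (pverts D) ((nonadj (pverts D) (parcs D))\<^sup>+)" by (auto simp: refl_on_def)
  have "sym (nonadj (pverts D) (parcs D))" by (auto simp: sym_def nonadj_def)
  then show "sym ((nonadj (pverts D) (parcs D))\<^sup>+)" by (rule sym_trancl)
qed (rule trans_trancl)

text \<open>Sum up the edges of a walk in the complement: inner vertices are met twice and cancel.
  Steps from a vertex to itself, which \<open>nonadj\<close> may contain, contribute
  nothing.\<close>

lemma path_toggle:
  assumes fin: "finite V" and xy: "(x, y) \<in> (nonadj V E)\<^sup>+"
  shows "\<exists>J. sym_fun_on V J \<and> (\<forall>u v. J u v = 1 \<longrightarrow> (u, v) \<in> nonadj V E) \<and>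
    (\<forall>u\<in>V. deg V J u = of_bool (u = x) + of_bool (u = y))"
proof -
  have arc: "\<exists>J. sym_fun_on V J \<and> (\<forall>u v. J u v = 1 \<longrightarrow> (u, v) \<in> nonadj V E) \<and>
    (\<forall>u\<in>V. deg V J u = of_bool (u = y) + of_bool (u = z))" if "(y, z) \<in> nonadj V E" for y z
  proof (cases "y = z")
    case True
    then show ?thesis by (intro exI[of _ "\<lambda>u v. 0"]) (auto simp: deg_def sym_fun_on_def)
  next
    case False
    with that show ?thesis using fin
      by (intro exI[of _ "edge y z"] conjI sym_fun_on_edge) (auto simp: deg_edge edge_def nonadj_def)
  qed
  from xy show ?thesis
  proof (induction rule: trancl_induct)
    case (base y)
    then show ?case by (rule arc)
  next
    case (step y z)
    obtain J where J: "sym_fun_on V J" "\<forall>u v. J u v = 1 \<longrightarrow> (u, v) \<in> nonadj V E"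
      "\<forall>u\<in>V. deg V J u = of_bool (u = x) + of_bool (u = y)" using step.IH by blast
    obtain K where K: "sym_fun_on V K" "\<forall>u v. K u v = 1 \<longrightarrow> (u, v) \<in> nonadj V E"
      "\<forall>u\<in>V. deg V K u = of_bool (u = y) + of_bool (u = z)" using arc[OF step.hyps(2)] by blast
    have "(u, v) \<in> nonadj V E" if "J u v + K u v = 1" for u v
      using that J(2) K(2) by (cases "J u v"; cases "K u v") auto
    moreover have "deg V (\<lambda>a b. J a b + K a b) u = of_bool (u = x) + of_bool (u = z)" if "u \<in> V" for u
      using J(3) K(3) that by (simp add: deg_add add.assoc)
    ultimately show ?case
      by (intro exI[of _ "\<lambda>a b. J a b + K a b"] conjI sym_fun_on_add J K) blast+
  qed
qed

lemma card_Int_parity_sum: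
  "finite C \<Longrightarrow> (\<Sum>u\<in>C. of_bool (u \<in> A)) = (of_bool (odd (card (A \<inter> C))) :: bit)"
  by (simp add: of_nat_bit Int_def conj_commute)

text \<open>\<open>S\<close> is the set of vertices of odd out-degree in the transitive tournament
  finally reached. Since inversions keep all parities, \<open>W\<close> can turn into
  \<open>S\<close> only by another choice of the arcs between nonadjacent vertices, which changes an
  even number of parities in each component. Conversely, the necessary changes are made along paths
  of the complement, and the size of \<open>S\<close> makes \<open>tournament_to_order\<close>
  applicable.\<close>

theorem eq_invertible_odd_iff:
  fixes D :: "'a::linorder pair_pre_digraph"
  assumes D: "oriented_graph D" and p: "odd p" "2 \<le> p" "p + 2 \<le> card (pverts D)"
  defines "r \<equiv> (nonadj (pverts D) (parcs D))\<^sup>+"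
  defines "W \<equiv> {u \<in> pverts D. deg (pverts D) (completion (parcs D)) u = 1}"
  shows "eq_invertible p D \<longleftrightarrow> (\<exists>S \<subseteq> pverts D. card S = card (pverts D) div 2 \<and>
    (\<forall>u\<in>pverts D. even (card (S \<inter> r `` {u})) = even (card (W \<inter> r `` {u}))))"
    (is "_ \<longleftrightarrow> ?rhs")
proof -
  define V where "V = pverts D"
  define E where "E = parcs D"
  define T where "T = completion E"
  have fin: "finite V" using oriented_graphD[OF D] by (simp add: V_def)
  have T: "tournament_on V T" unfolding T_def E_def by (rule tournament_on_completion[OF D])
  have pV: "p + 2 \<le> card V" using p by (simp add: V_def)
  have r: "equiv V r" unfolding V_def r_def by (rule equiv_nonadj[OF D])
  have rV: "r `` {u} \<subseteq> V" for u using equiv_type[OF r] by auto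
  have fr: "finite (r `` {u})" for u using rV fin finite_subset by metis
  have W: "W = {u \<in> V. deg V T u = 1}" by (simp add: W_def V_def T_def E_def)
  have degT: "deg V T u = of_bool (u \<in> W)" if "u \<in> V" for u using that by (simp add: W)
  show ?thesis
  proof
    assume "eq_invertible p D"
    then obtain F where F: "invspan V p F" "acyclic (flip_arcs F E)"
      using eq_invertible_iff_invspan[OF D] by (auto simp: V_def E_def)
    have "flip_arcs F E \<subseteq> V \<times> V"
      using oriented_graphD(2)[OF D] by (auto simp: flip_arcs_def V_def E_def)
    then obtain f where f: "bij_betw f V {..<card V}" "\<forall>(u, v)\<in>flip_arcs F E. f u < f v"
      using acyclic_imp_rank[OF fin _ F(2)] by blast
    define S where "S = {u \<in> V. deg V (order_fun f) u = 1}"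
    have "card S = card V div 2" unfolding S_def by (rule card_odd_deg_order_fun[OF f(1)])
    moreover have "even (card (S \<inter> r `` {w})) = even (card (W \<inter> r `` {w}))" if w: "w \<in> V" for w
    proof -
      define C where "C = r `` {w}"
      have CV: "C \<subseteq> V" "finite C" using rV fr by (auto simp: C_def)
      \<comment> \<open>The difference between \<open>T\<close> after the reversals \<open>F\<close>
        and the order \<open>f\<close>. As \<open>f\<close> increases along all arcs of the
        resulting graph, \<open>J\<close> vanishes on adjacent pairs.\<close>
      define J where "J = (\<lambda>x y. (T x y + order_fun f x y) + F x y)"
      have symF: "sym_fun_on V F" by (rule invspan_sym[OF F(1)])
      have symJ: "sym_fun_on V J" unfolding J_def using f(1)
        by (intro sym_fun_on_add[OF tournament_on_add_sym] T tournament_on_order_fun symF)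
          (simp add: bij_betw_def)
      have J0: "J u v = 0" if uv: "u \<in> V" "v \<in> V" "u \<noteq> v" "(u, v) \<notin> nonadj V E" for u v
      proof -
        have J0': "J u v = 0" if uv: "u \<in> V" "v \<in> V" "u \<noteq> v" "(u, v) \<in> E" for u v
        proof (cases "F u v")
          case zero
          then have "f u < f v" using f(2) uv by (auto simp: flip_arcs_def)
          then show ?thesis using uv zero by (simp add: J_def T_def completion_def order_fun_def)
        next
          case one
          then have "F v u = 1" using symF uv by (auto simp: sym_fun_on_def)
          then have "f v < f u" using f(2) uv by (auto simp: flip_arcs_def)
          then show ?thesis using uv one by (simp add: J_def T_def completion_def order_fun_def)
        qed
        have "(u, v) \<in> E \<or> (v, u) \<in> E" using uv by (auto simp: nonadj_def)
        then show ?thesis using J0'[of u v] J0'[of v u] uv symJ by (auto simp: sym_fun_on_def)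
      qed
      \<comment> \<open>No edge of \<open>J\<close> leaves the component \<open>C\<close>, so the
        handshake lemma can be applied inside \<open>C\<close>.\<close>
      have degJ: "deg V J u = deg C J u" if u: "u \<in> C" for u
        unfolding deg_def
      proof (rule sum.mono_neutral_right)
        show "\<forall>v\<in>V - {u} - (C - {u}). J u v = 0"
        proof
          fix v assume v: "v \<in> V - {u} - (C - {u})"
          have "(u, v) \<notin> nonadj V E"
          proof
            assume "(u, v) \<in> nonadj V E"
            then have "(u, v) \<in> r" by (auto simp: r_def V_def E_def)
            then have "v \<in> C" using u r unfolding C_def by (meson Image_singleton_iff equivE transD)
            then show False using v by simp
          qed
          then show "J u v = 0" using J0[of u v] v u CV by auto
        qed
      qed (use fin CV in auto)
      have "(\<Sum>u\<in>C. deg V J u) = 0"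
        using sum_symmetric_off_diagonal_eq_0[OF CV(2), of J] degJ symJ CV
        by (auto simp: sym_fun_on_def)
      moreover have "deg V J u = of_bool (u \<in> W) + of_bool (u \<in> S)" if "u \<in> C" for u
      proof -
        have "u \<in> V" using that CV by auto
        then show ?thesis using invspan_odd_deg_eq_0[OF fin p(1) F(1)] degT
          by (simp add: J_def deg_add S_def)
      qed
      ultimately have "(\<Sum>u\<in>C. of_bool (u \<in> W) + of_bool (u \<in> S) :: bit) = 0" by simp
      then show ?thesis
        unfolding sum.distrib card_Int_parity_sum[OF CV(2)] bit_add_eq_0_iff
        by (auto simp: C_def)
    qed
    ultimately show ?rhs by (intro exI[of _ S]) (auto simp: V_def S_def)
  next
    assume ?rhs
    then obtain S where S: "S \<subseteq> V" "card S = card V div 2"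
      "\<And>u. u \<in> V \<Longrightarrow> even (card (S \<inter> r `` {u})) = even (card (W \<inter> r `` {u}))"
      unfolding V_def by blast
    \<comment> \<open>The symmetric difference of \<open>W\<close> and \<open>S\<close>: the
      vertices whose parity has to change.\<close>
    define Z where "Z = {u \<in> V. of_bool (u \<in> W) + of_bool (u \<in> S) = (1::bit)}"
    have "\<exists>J. sym_fun_on V J \<and> (\<forall>u v. J u v = 1 \<longrightarrow> (u, v) \<in> nonadj V E) \<and>
      (\<forall>u\<in>V. deg V J u = of_bool (u \<in> Z))"
    proof (rule pairing_induct[OF fin r])
      show "Z \<subseteq> V" by (auto simp: Z_def)
      show "even (card (Z \<inter> r `` {u}))" if "u \<in> V" for u
      proof -
        have "(\<Sum>v\<in>r `` {u}. of_bool (v \<in> W) + of_bool (v \<in> S) :: bit) = 0"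
          unfolding sum.distrib card_Int_parity_sum[OF fr] using S(3)[OF that] by simp
        moreover have "{v \<in> r `` {u}. of_bool (v \<in> W) + of_bool (v \<in> S) = (1::bit)} = Z \<inter> r `` {u}"
          using rV by (auto simp: Z_def)
        ultimately show ?thesis unfolding card_parity_sum[OF fr] by simp
      qed
      show "\<exists>J. sym_fun_on V J \<and> (\<forall>u v. J u v = 1 \<longrightarrow> (u, v) \<in> nonadj V E) \<and>
        (\<forall>u\<in>V. deg V J u = of_bool (u \<in> {}))"
        by (rule exI[of _ "\<lambda>x y. 0"]) (simp add: sym_fun_on_def deg_def)
    next
      fix Z x y
      assume "\<exists>J. sym_fun_on V J \<and> (\<forall>u v. J u v = 1 \<longrightarrow> (u, v) \<in> nonadj V E) \<and>
          (\<forall>u\<in>V. deg V J u = of_bool (u \<in> Z))"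
        and xy: "(x, y) \<in> r" "x \<noteq> y" and nZ: "x \<notin> Z" "y \<notin> Z"
      then obtain J where J: "sym_fun_on V J" "\<forall>u v. J u v = 1 \<longrightarrow> (u, v) \<in> nonadj V E"
        "\<forall>u\<in>V. deg V J u = of_bool (u \<in> Z)" by blast
      obtain K where K: "sym_fun_on V K" "\<forall>u v. K u v = 1 \<longrightarrow> (u, v) \<in> nonadj V E"
        "\<forall>u\<in>V. deg V K u = of_bool (u = x) + of_bool (u = y)"
        using path_toggle[OF fin, of x y E] xy by (auto simp: r_def V_def E_def)
      have "(u, v) \<in> nonadj V E" if "J u v + K u v = 1" for u v
        using that J(2) K(2) by (cases "J u v"; cases "K u v") auto
      moreover have "deg V (\<lambda>a b. J a b + K a b) u = of_bool (u \<in> insert x (insert y Z))" if "u \<in> V" for u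
        using J(3) K(3) that nZ xy by (auto simp: deg_add)
      ultimately show "\<exists>J. sym_fun_on V J \<and> (\<forall>u v. J u v = 1 \<longrightarrow> (u, v) \<in> nonadj V E) \<and>
          (\<forall>u\<in>V. deg V J u = of_bool (u \<in> insert x (insert y Z)))"
        by (intro exI[of _ "\<lambda>a b. J a b + K a b"] conjI sym_fun_on_add J K) blast+
    qed
    then obtain J where J: "sym_fun_on V J" "\<forall>u v. J u v = 1 \<longrightarrow> (u, v) \<in> nonadj V E"
      "\<forall>u\<in>V. deg V J u = of_bool (u \<in> Z)" by blast
    define T' where "T' = (\<lambda>x y. T x y + J x y)"
    have T': "tournament_on V T'" unfolding T'_def by (intro tournament_on_flip T J)
    have "deg V T' u = of_bool (u \<in> S)" if "u \<in> V" for u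
      using that J(3) degT[OF that] by (auto simp: T'_def deg_add Z_def)
    then have "{u \<in> V. deg V T' u = 1} = S" using S(1) by auto
    then obtain F f where F: "invspan V p F"
      "\<forall>u\<in>V. \<forall>v\<in>V. u \<noteq> v \<longrightarrow> T' u v + F u v = order_fun f u v"
      using tournament_to_order[OF fin p(2) pV T'] S(2) by auto
    have "acyclic (flip_arcs F (parcs D))"
    proof (rule acyclic_flip_arcs[OF D])
      show "T' u v = 1" if "(u, v) \<in> parcs D" for u v
      proof -
        have "J u v = 0" using J(2) that by (cases "J u v") (auto simp: nonadj_def E_def)
        then show ?thesis using that by (simp add: T'_def T_def completion_def E_def)
      qed
    qed (use T' F(2) in \<open>auto simp: V_def\<close>)
    then show "eq_invertible p D" using eq_invertible_iff_invspan[OF D] F(1) by (auto simp: V_def)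
  qed
qed

section \<open>Sets with prescribed parities on the classes of an equivalence relation\<close>

lemma of_bool_odd_bitD: "of_bool (odd a) = (of_bool (odd b) :: bit) \<Longrightarrow> even b = even a"
  by (cases "even a"; cases "even b") simp_all

text \<open>The least element represents its class, which a program recognises by a look at the
  smaller vertices.\<close>

definition class_reps :: "'a::linorder set \<Rightarrow> 'a rel \<Rightarrow> 'a set" where
  "class_reps V r = {u \<in> V. \<forall>v. (u, v) \<in> r \<longrightarrow> u \<le> v}"

lemma card_eq_sum_classes:
  fixes V :: "'a::linorder set"
  assumes fin: "finite V" and r: "equiv V r" and X: "X \<subseteq> V"
  shows "card X = (\<Sum>u\<in>class_reps V r. card (X \<inter> r `` {u}))"
proof -
  have refl: "(u, u) \<in> r" if "u \<in> V" for u using r that by (simp add: equiv_def refl_on_def)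
  have sub: "r \<subseteq> V \<times> V" by (rule equiv_type[OF r])
  have "X = (\<Union>u\<in>class_reps V r. X \<inter> r `` {u})"
  proof (intro equalityI subsetI)
    fix x assume x: "x \<in> X"
    define m where "m = Min (r `` {x})"
    have fx: "finite (r `` {x})" using sub fin by (auto intro: finite_subset[of _ V])
    have "m \<in> r `` {x}" unfolding m_def using refl[of x] x X by (intro Min_in fx) auto
    then have xm: "(x, m) \<in> r" by simp
    then have mx: "(m, x) \<in> r" using r by (meson equivE symD)
    have "m \<le> v" if "(m, v) \<in> r" for v
    proof -
      have "(x, v) \<in> r" using xm that r by (meson equivE transD)
      then show ?thesis unfolding m_def using fx by (intro Min_le) auto
    qed
    then have "m \<in> class_reps V r" using xm sub by (auto simp: class_reps_def)
    then show "x \<in> (\<Union>u\<in>class_reps V r. X \<inter> r `` {u})" using mx x by auto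
  qed auto
  moreover have "card (\<Union>u\<in>class_reps V r. X \<inter> r `` {u}) = (\<Sum>u\<in>class_reps V r. card (X \<inter> r `` {u}))"
  proof (rule card_UN_disjoint)
    show "finite (class_reps V r)" using fin by (simp add: class_reps_def)
    show "\<forall>u\<in>class_reps V r. finite (X \<inter> r `` {u})" using X fin finite_subset by blast
    show "\<forall>u\<in>class_reps V r. \<forall>v\<in>class_reps V r. u \<noteq> v \<longrightarrow> X \<inter> r `` {u} \<inter> (X \<inter> r `` {v}) = {}"
    proof (intro ballI impI)
      fix u v assume uv: "u \<in> class_reps V r" "v \<in> class_reps V r" "u \<noteq> v"
      have "(u, v) \<notin> r"
      proof
        assume "(u, v) \<in> r"
        moreover then have "(v, u) \<in> r" using r by (meson equivE symD)
        ultimately have "u \<le> v" "v \<le> u" using uv by (auto simp: class_reps_def)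
        then show False using uv(3) by simp
      qed
      then have "(v, w) \<notin> r" if "(u, w) \<in> r" for w using r that by (meson equivE symD transD)
      then show "X \<inter> r `` {u} \<inter> (X \<inter> r `` {v}) = {}" by auto
    qed
  qed
  ultimately show ?thesis by metis
qed

lemma card_odd_le_sum:
  fixes h :: "'a \<Rightarrow> nat"
  assumes "finite A"
  shows "card {u \<in> A. odd (h u)} \<le> (\<Sum>u\<in>A. h u)"
proof -
  have "card {u \<in> A. odd (h u)} = (\<Sum>u\<in>A. of_bool (odd (h u)))" using assms by (simp add: Int_def)
  also have "\<dots> \<le> (\<Sum>u\<in>A. h u)" by (intro sum_mono) (auto elim: oddE)
  finally show ?thesis .
qed

text \<open>Necessity: a class with odd prescribed parity has a vertex in \<open>S\<close>, and a
  class with odd rest has one in \<open>V - S\<close>. Sufficiency: one vertex from each odd class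
  is a valid start, and adding two vertices of one class preserves validity. A largest valid set of
  size at most \<open>h\<close> has size \<open>h\<close>, for otherwise no class has two vertices
  left and the second inequality fails.\<close>

lemma class_parity_subset_iff:
  fixes V :: "'a::linorder set"
  assumes fin: "finite V" and r: "equiv V r" and W: "W \<subseteq> V"
    and h: "even h = even (card W)"
  shows "(\<exists>S \<subseteq> V. card S = h \<and> (\<forall>u\<in>V. even (card (S \<inter> r `` {u})) = even (card (W \<inter> r `` {u})))) \<longleftrightarrow>
    card {u \<in> class_reps V r. odd (card (W \<inter> r `` {u}))} \<le> h \<and>
    card {u \<in> class_reps V r. odd (card (W \<inter> r `` {u}) + card (r `` {u}))} + h \<le> card V"
    (is "?lhs \<longleftrightarrow> ?a \<le> h \<and> ?b + h \<le> card V")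
proof -
  let ?R = "class_reps V r"
  have RV: "?R \<subseteq> V" by (auto simp: class_reps_def)
  have finR: "finite ?R" using RV fin finite_subset by blast
  have rV: "r `` {u} \<subseteq> V" for u using equiv_type[OF r] by auto
  have fr: "finite (r `` {u})" for u using rV fin finite_subset by metis
  have fS: "finite S" if "S \<subseteq> V" for S using that fin finite_subset by blast
  have compl: "odd (card ((V - S) \<inter> r `` {u})) \<longleftrightarrow> odd (card (S \<inter> r `` {u}) + card (r `` {u}))" for S u
  proof -
    have "card (r `` {u}) = card (S \<inter> r `` {u}) + card ((V - S) \<inter> r `` {u})"
      using rV fr by (subst card_Un_disjoint[symmetric]) (auto intro: arg_cong[where f = card])
    then show ?thesis by auto
  qed
  show ?thesis
  proof
    assume ?lhs
    then obtain S where S: "S \<subseteq> V" "card S = h"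
      "\<And>u. u \<in> V \<Longrightarrow> even (card (S \<inter> r `` {u})) = even (card (W \<inter> r `` {u}))" by blast
    have "{u \<in> ?R. odd (card (W \<inter> r `` {u}))} = {u \<in> ?R. odd (card (S \<inter> r `` {u}))}"
      using S(3) RV by auto
    then have "?a \<le> (\<Sum>u\<in>?R. card (S \<inter> r `` {u}))"
      using card_odd_le_sum[OF finR, of "\<lambda>u. card (S \<inter> r `` {u})"] by simp
    then have a: "?a \<le> h" using card_eq_sum_classes[OF fin r S(1)] S(2) by simp
    have "{u \<in> ?R. odd (card (W \<inter> r `` {u}) + card (r `` {u}))} = {u \<in> ?R. odd (card ((V - S) \<inter> r `` {u}))}"
      unfolding compl using S(3) RV by auto
    then have "?b \<le> (\<Sum>u\<in>?R. card ((V - S) \<inter> r `` {u}))"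
      using card_odd_le_sum[OF finR, of "\<lambda>u. card ((V - S) \<inter> r `` {u})"] by simp
    then have "?b \<le> card (V - S)" using card_eq_sum_classes[OF fin r, of "V - S"] by simp
    moreover have "card (V - S) = card V - h" "h \<le> card V"
      using S fS fin by (auto simp: card_Diff_subset card_mono)
    ultimately show "?a \<le> h \<and> ?b + h \<le> card V" using a by simp
  next
    assume ab: "?a \<le> h \<and> ?b + h \<le> card V"
    define good where "good S \<longleftrightarrow> S \<subseteq> V \<and> card S \<le> h \<and>
      (\<forall>u\<in>?R. even (card (S \<inter> r `` {u})) = even (card (W \<inter> r `` {u})))" for S
    have same: "\<exists>v\<in>?R. r `` {u} = r `` {v}" if "u \<in> V" for u
    proof -
      \<comment> \<open>If no represented class contained \<open>u\<close>, counting
        \<open>{u}\<close> by classes would give 0 instead of 1.\<close>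
      have "{u} = (\<Union>v\<in>?R. {u} \<inter> r `` {v})"
      proof (rule ccontr)
        assume "\<not> ?thesis"
        then have "{u} \<inter> r `` {v} = {}" if "v \<in> ?R" for v using that by blast
        then show False using card_eq_sum_classes[OF fin r, of "{u}"] \<open>u \<in> V\<close> by simp
      qed
      then obtain v where "v \<in> ?R" "(v, u) \<in> r" by blast
      then show ?thesis using equiv_class_eq[OF r, of v u] by auto
    qed
    have "good {u \<in> ?R. odd (card (W \<inter> r `` {u}))}" (is "good ?S0")
      unfolding good_def
    proof (intro conjI ballI)
      fix u assume u: "u \<in> ?R"
      have "?S0 \<inter> r `` {u} = (if odd (card (W \<inter> r `` {u})) then {u} else {})"
      proof -
        have "v = u" if v: "v \<in> ?R" "(u, v) \<in> r" for v
        proof -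
          have "(v, u) \<in> r" using v r by (meson equivE symD)
          then show ?thesis using u v by (auto simp: class_reps_def intro: antisym)
        qed
        moreover have "(u, u) \<in> r" using u r by (auto simp: class_reps_def equiv_def refl_on_def)
        ultimately show ?thesis using u by auto
      qed
      then show "even (card (?S0 \<inter> r `` {u})) = even (card (W \<inter> r `` {u}))" by simp
    qed (use RV ab in auto)
    then have ex: "\<exists>k S. good S \<and> card S = k" by blast
    have "k \<le> h" if "\<exists>S. good S \<and> card S = k" for k using that by (auto simp: good_def)
    then obtain S where S: "good S" and max: "\<And>S'. good S' \<Longrightarrow> card S' \<le> card S"
      using ex Nat.ex_has_greatest_nat[of "\<lambda>k. \<exists>S. good S \<and> card S = k" _ h]
      by metis
    have SV: "S \<subseteq> V" "card S \<le> h" using S by (auto simp: good_def)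
    have "even (card S) = even (card W)"
    proof -
      have "(of_nat (card S) :: bit) = (\<Sum>u\<in>?R. of_nat (card (S \<inter> r `` {u})))"
        unfolding card_eq_sum_classes[OF fin r SV(1)] by simp
      also have "\<dots> = (\<Sum>u\<in>?R. of_nat (card (W \<inter> r `` {u})))"
        using S by (intro sum.cong) (auto simp: of_nat_bit good_def)
      also have "\<dots> = of_nat (card W)"
        unfolding card_eq_sum_classes[OF fin r W] by simp
      finally show ?thesis unfolding of_nat_bit by (rule of_bool_odd_bitD[symmetric])
    qed
    have "card S = h"
    proof (rule ccontr)
      assume "card S \<noteq> h"
      \<comment> \<open>Both numbers have the parity of \<open>card W\<close>, so a shortfall is at
        least two and leaves room for a pair.\<close>
      then have lt: "card S + 2 \<le> h" using SV(2) h \<open>even (card S) = even (card W)\<close>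
        by (metis Suc_leI add_2_eq_Suc' even_Suc le_neq_implies_less not_less_eq_eq)
      have small: "card ((V - S) \<inter> r `` {u}) \<le> 1" if u: "u \<in> ?R" for u
      proof (rule ccontr)
        assume "\<not> ?thesis"
        then obtain A where A: "A \<subseteq> (V - S) \<inter> r `` {u}" "card A = 2"
          using obtain_subset_with_card_n[of 2 "(V - S) \<inter> r `` {u}"] by force
        have fA: "finite A" using A(2) card.infinite by fastforce
        have AS: "A \<inter> S = {}" using A by auto
        have cS: "card (S \<union> A) = card S + 2" using A fA fS[OF SV(1)] AS by (subst card_Un_disjoint) auto
        have "good (S \<union> A)" unfolding good_def
        proof (intro conjI ballI)
          show "S \<union> A \<subseteq> V" using SV A by auto
          show "card (S \<union> A) \<le> h" using cS lt by simp
          fix v assume v: "v \<in> ?R"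
          have "even (card ((S \<union> A) \<inter> r `` {v})) = even (card (S \<inter> r `` {v}))"
          proof (cases "(u, v) \<in> r")
            case True
            then have eq: "r `` {u} = r `` {v}" by (rule equiv_class_eq[OF r])
            have "(S \<union> A) \<inter> r `` {v} = (S \<inter> r `` {v}) \<union> A" using A eq by auto
            moreover have "card ((S \<inter> r `` {v}) \<union> A) = card (S \<inter> r `` {v}) + 2"
              using A fA fr AS by (subst card_Un_disjoint) auto
            ultimately show ?thesis by simp
          next
            case False
            have "r `` {u} \<inter> r `` {v} = {}" using False equiv_class_nondisjoint[OF r, of _ u v] by blast
            then have "(S \<union> A) \<inter> r `` {v} = S \<inter> r `` {v}" using A by auto
            then show ?thesis by simp
          qed
          then show "even (card ((S \<union> A) \<inter> r `` {v})) = even (card (W \<inter> r `` {v}))"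
            using S v by (simp add: good_def)
        qed
        then show False using max[of "S \<union> A"] cS by simp
      qed
      \<comment> \<open>With at most one vertex of each class outside \<open>S\<close>, these
        vertices are as many as the classes with odd rest.\<close>
      have "card (V - S) = (\<Sum>u\<in>?R. card ((V - S) \<inter> r `` {u}))"
        by (rule card_eq_sum_classes[OF fin r]) auto
      also have "\<dots> = (\<Sum>u\<in>?R. of_bool (odd (card ((V - S) \<inter> r `` {u}))))"
      proof (rule sum.cong)
        fix u assume "u \<in> ?R"
        from small[OF this] have "card ((V - S) \<inter> r `` {u}) = 0 \<or> card ((V - S) \<inter> r `` {u}) = 1" by linarith
        then show "card ((V - S) \<inter> r `` {u}) = of_bool (odd (card ((V - S) \<inter> r `` {u})))"
          by (elim disjE) (simp_all only: odd_one even_zero not_True_eq_False not_False_eq_True of_bool_eq)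
      qed simp
      also have "\<dots> = card {u \<in> ?R. odd (card ((V - S) \<inter> r `` {u}))}"
        using finR by (simp add: Int_def)
      also have "{u \<in> ?R. odd (card ((V - S) \<inter> r `` {u}))} =
          {u \<in> ?R. odd (card (W \<inter> r `` {u}) + card (r `` {u}))}"
        unfolding compl using S by (auto simp: good_def)
      finally have "card (V - S) = ?b" .
      moreover have "card (V - S) = card V - card S" using fS SV by (simp add: card_Diff_subset)
      ultimately show False using ab lt by linarith
    qed
    moreover have "even (card (S \<inter> r `` {u})) = even (card (W \<inter> r `` {u}))" if "u \<in> V" for u
      using same[OF that] S by (auto simp: good_def)
    ultimately show ?lhs using SV(1) by blast
  qed
qed

text \<open>The parity condition on \<open>h = n div 2\<close> holds because all tournaments on
  \<open>V\<close> have the same sum of out-degrees modulo 2. Doubling the two inequalities removes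
  the division: \<open>b + n div 2 \<le> n\<close> is the same as
  \<open>2 * b \<le> n + 1\<close>.\<close>

theorem eq_invertible_odd_iff_classes:
  fixes D :: "'a::linorder pair_pre_digraph"
  assumes D: "oriented_graph D" and p: "odd p" "2 \<le> p" "p + 2 \<le> card (pverts D)"
  defines "r \<equiv> (nonadj (pverts D) (parcs D))\<^sup>+"
  defines "W \<equiv> {u \<in> pverts D. deg (pverts D) (completion (parcs D)) u = 1}"
  shows "eq_invertible p D \<longleftrightarrow>
    2 * card {u \<in> class_reps (pverts D) r. odd (card (W \<inter> r `` {u}))} \<le> card (pverts D) \<and>
    2 * card {u \<in> class_reps (pverts D) r. odd (card (W \<inter> r `` {u}) + card (r `` {u}))} \<le> card (pverts D) + 1"
proof -
  define V where "V = pverts D"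
  define T where "T = completion (parcs D)"
  have fin: "finite V" using oriented_graphD[OF D] by (simp add: V_def)
  have T: "tournament_on V T" unfolding T_def by (rule tournament_on_completion[OF D])
  have r: "equiv V r" unfolding V_def r_def by (rule equiv_nonadj[OF D])
  have W: "W = {u \<in> V. deg V T u = 1}" by (simp add: W_def V_def T_def)
  obtain g where g: "bij_betw g V {..<card V}"
    using ex_bij_betw_finite_nat[OF fin] by (auto simp: atLeast0LessThan)
  have "sym_fun_on V (\<lambda>x y. T x y + order_fun g x y)"
    using g by (intro tournament_on_add_sym T tournament_on_order_fun) (simp add: bij_betw_def)
  from sum_symmetric_off_diagonal_eq_0[OF fin this]
  have "(\<Sum>u\<in>V. deg V T u) = (\<Sum>u\<in>V. deg V (order_fun g) u)"
    by (simp add: deg_add sum.distrib bit_add_eq_0_iff)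
  then have "even (card V div 2) = even (card W)"
    unfolding card_parity_sum[OF fin] card_odd_deg_order_fun[OF g] W by (rule of_bool_odd_bitD)
  moreover have "W \<subseteq> V" by (auto simp: W)
  ultimately show ?thesis
    unfolding eq_invertible_odd_iff[OF D p, folded r_def W_def] V_def[symmetric]
    by (subst class_parity_subset_iff[OF fin r]) auto
qed

lemma eq_invertible_trivial:
  assumes D: "oriented_graph D" and p: "card (pverts D) \<le> p \<or> p = 1"
  shows "eq_invertible p D \<longleftrightarrow> acyclic (parcs D)"
proof
  assume "acyclic (parcs D)"
  then show "eq_invertible p D" unfolding eq_invertible_def by (intro exI[of _ "[]"]) simp
next
  assume "eq_invertible p D"
  then obtain Xs where Xs: "\<forall>X\<in>set Xs. X \<subseteq> pverts D \<and> card X = p"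
    "acyclic (parcs (fold inversion Xs D))" unfolding eq_invertible_def by blast
  from Xs(1) have "parcs (fold inversion Xs D) = parcs D \<or> parcs (fold inversion Xs D) = (parcs D)\<inverse>"
  proof (induction Xs rule: rev_induct)
    case (snoc X Xs)
    define G where "G = parcs (fold inversion Xs D)"
    have IH: "G = parcs D \<or> G = (parcs D)\<inverse>" using snoc by (auto simp: G_def)
    then have G: "u \<in> pverts D \<and> v \<in> pverts D \<and> u \<noteq> v" if "(u, v) \<in> G" for u v
      using oriented_graphD[OF D] that by blast
    have "parcs (fold inversion (Xs @ [X]) D) = flip_arcs (\<lambda>u v. of_bool (u \<in> X \<and> v \<in> X)) G"
      by (simp add: parcs_inversion G_def)
    moreover have "flip_arcs (\<lambda>u v. of_bool (u \<in> X \<and> v \<in> X)) G \<in> {G, G\<inverse>}"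
    proof (cases "p = 1")
      case True
      then obtain x where "X = {x}" using snoc.prems by (auto simp: card_1_singleton_iff)
      then have "flip_arcs (\<lambda>u v. of_bool (u \<in> X \<and> v \<in> X)) G = G"
        using G by (auto simp: flip_arcs_def)
      then show ?thesis by simp
    next
      case False
      have "X = pverts D"
        using snoc.prems p False oriented_graphD(1)[OF D] by (intro card_subset_eq) (auto intro: card_mono antisym)
      then have "flip_arcs (\<lambda>u v. of_bool (u \<in> X \<and> v \<in> X)) G = G\<inverse>"
        using G by (auto simp: flip_arcs_def)
      then show ?thesis by simp
    qed
    ultimately show ?case using IH by auto
  qed simp
  then show "acyclic (parcs D)" using Xs(2) by (metis acyclic_converse)
qed

section \<open>Renaming the vertices to an initial segment of the natural numbers\<close>

definition pullback :: "'b set \<Rightarrow> ('b \<Rightarrow> 'a) \<Rightarrow> 'a pair_pre_digraph \<Rightarrow> 'b pair_pre_digraph" where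
  "pullback V f D = \<lparr> pverts = V, parcs = {(i, j). i \<in> V \<and> j \<in> V \<and> (f i, f j) \<in> parcs D} \<rparr>"

lemma parcs_pullback_fold_inversion:
  "parcs (pullback V f (fold inversion Xs D)) =
    parcs (fold inversion (map (\<lambda>X. {i \<in> V. f i \<in> X}) Xs) (pullback V f D))"
proof (induction Xs arbitrary: D)
  case (Cons X Xs)
  have "pullback V f (inversion X D) = inversion {i \<in> V. f i \<in> X} (pullback V f D)"
    by (auto simp: pullback_def inversion_def)
  then show ?case by (simp add: Cons.IH)
qed simp

lemma acyclic_pullback: "acyclic (parcs D) \<Longrightarrow> acyclic (parcs (pullback V f D))"
proof -
  assume D: "acyclic (parcs D)"
  have "(f i, f j) \<in> (parcs D)\<^sup>+" if "(i, j) \<in> (parcs (pullback V f D))\<^sup>+" for i j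
    using that by (induction rule: trancl_induct) (auto simp: pullback_def intro: trancl_into_trancl)
  then show ?thesis using D unfolding acyclic_def by blast
qed

lemma eq_invertible_pullback:
  assumes f: "bij_betw f V (pverts D)" and D: "eq_invertible p D"
  shows "eq_invertible p (pullback V f D)"
proof -
  obtain Xs where Xs: "\<forall>X\<in>set Xs. X \<subseteq> pverts D \<and> card X = p"
    "acyclic (parcs (fold inversion Xs D))" using D unfolding eq_invertible_def by blast
  have "card {i \<in> V. f i \<in> X} = p" if "X \<in> set Xs" for X
  proof -
    have "bij_betw f {i \<in> V. f i \<in> X} X"
    proof (rule bij_betw_subset[OF f])
      have "X \<subseteq> f ` V" using f Xs(1) that by (simp add: bij_betw_def)
      then show "f ` {i \<in> V. f i \<in> X} = X" by blast
    qed blast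
    then show ?thesis using Xs(1) that bij_betw_same_card by fastforce
  qed
  moreover have "acyclic (parcs (fold inversion (map (\<lambda>X. {i \<in> V. f i \<in> X}) Xs) (pullback V f D)))"
    unfolding parcs_pullback_fold_inversion[symmetric] by (rule acyclic_pullback[OF Xs(2)])
  ultimately show ?thesis unfolding eq_invertible_def
    by (intro exI[of _ "map (\<lambda>X. {i \<in> V. f i \<in> X}) Xs"]) (auto simp: pullback_def)
qed

text \<open>The encoding shows a program only positions in the sorted list of vertices, not their
  names. The converse direction pulls back once more, along the inverse bijection.\<close>

lemma eq_invertible_pullback_iff:
  assumes f: "bij_betw f V (pverts D)" and D: "oriented_graph D"
  shows "eq_invertible p (pullback V f D) \<longleftrightarrow> eq_invertible p D"
proof
  define g where "g = inv_into V f"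
  assume "eq_invertible p (pullback V f D)"
  moreover have g: "bij_betw g (pverts D) (pverts (pullback V f D))"
    using bij_betw_inv_into[OF f] by (simp add: g_def pullback_def)
  ultimately have "eq_invertible p (pullback (pverts D) g (pullback V f D))"
    by (rule eq_invertible_pullback[rotated])
  moreover have "pullback (pverts D) g (pullback V f D) = D"
  proof -
    have gf: "g u \<in> V" "f (g u) = u" if "u \<in> pverts D" for u
      using f that by (auto simp: g_def bij_betw_def inv_into_into f_inv_into_f)
    have "parcs (pullback (pverts D) g (pullback V f D)) = parcs D"
      using oriented_graphD(2)[OF D] gf by (auto simp: pullback_def)
    then show ?thesis by (simp add: pullback_def)
  qed
  ultimately show "eq_invertible p D" by simp
qed (rule eq_invertible_pullback[OF f])

lemma oriented_graph_pullback:
  assumes "oriented_graph D" "finite V"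
  shows "oriented_graph (pullback V f D)"
proof -
  have "finite (parcs (pullback V f D))"
    by (rule finite_subset[of _ "V \<times> V"]) (use assms(2) in \<open>auto simp: pullback_def\<close>)
  moreover have "(u, u) \<notin> parcs D" for u using oriented_graphD(3)[OF assms(1)] by blast
  ultimately have "pair_digraph (pullback V f D)"
    using assms(2) by unfold_locales (auto simp: pullback_def)
  then show ?thesis
    using oriented_graphD(3)[OF assms(1)] by (auto simp: oriented_graph_def pullback_def)
qed

section \<open>The criterion in the form in which it is computed\<close>

definition odd_out :: "nat \<Rightarrow> nat rel \<Rightarrow> nat \<Rightarrow> bool" where
  "odd_out n A v \<longleftrightarrow> odd (card {x. x < n \<and> ((v, x) \<in> A \<or> (x, v) \<notin> A \<and> v < x)})"

definition invertibility_test :: "nat \<Rightarrow> nat \<Rightarrow> nat rel \<Rightarrow> bool" where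
  "invertibility_test p n A \<longleftrightarrow>
    (if n \<le> p \<or> p = 1 then acyclic A
     else even p \<or>
      (let r = (nonadj {..<n} A)\<^sup>+; odds = (\<lambda>u. card {v. v < n \<and> (u, v) \<in> r \<and> odd_out n A v});
           R = {u. u < n \<and> (\<forall>v<u. (u, v) \<notin> r)}
       in 2 * card {u \<in> R. odd (odds u)} \<le> n \<and>
          2 * card {u \<in> R. odd (odds u + card {v. v < n \<and> (u, v) \<in> r})} \<le> n + 1))"

theorem eq_invertible_iff_test:
  assumes D: "oriented_graph D" and p: "p > 0" "card (pverts D) \<noteq> p + 1"
    and f: "bij_betw f {..<n} (pverts D)"
  shows "eq_invertible p D \<longleftrightarrow>
    invertibility_test p n {(i, j). i < n \<and> j < n \<and> (f i, f j) \<in> parcs D}"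
proof -
  define G where "G = pullback {..<n} f D"
  define A where "A = {(i, j). i < n \<and> j < n \<and> (f i, f j) \<in> parcs D}"
  have A: "parcs G = A" and V: "pverts G = {..<n}" by (auto simp: G_def A_def pullback_def)
  have G: "oriented_graph G" unfolding G_def by (rule oriented_graph_pullback[OF D]) simp
  have n: "card (pverts D) = n" using bij_betw_same_card[OF f] by simp
  have iff: "eq_invertible p D \<longleftrightarrow> eq_invertible p G"
    unfolding G_def using eq_invertible_pullback_iff[OF f D] by simp
  consider "n \<le> p \<or> p = 1" | "\<not> (n \<le> p \<or> p = 1)" "even p" | "\<not> (n \<le> p \<or> p = 1)" "odd p" by blast
  then have "eq_invertible p G \<longleftrightarrow> invertibility_test p n A"
  proof cases
    case 1
    then show ?thesis using eq_invertible_trivial[OF G] by (simp add: V A invertibility_test_def)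
  next
    case 2
    \<comment> \<open>Here \<open>n \<noteq> p + 1\<close> turns \<open>n > p\<close> into
      \<open>n \<ge> p + 2\<close>.\<close>
    then have "2 \<le> p" "p + 2 \<le> card (pverts G)" using p n by (auto simp: V)
    then show ?thesis using eq_invertible_even[OF G] 2 by (simp add: invertibility_test_def)
  next
    case 3
    then have p': "2 \<le> p" "p + 2 \<le> card (pverts G)" using p n by (auto simp: V)
    define r where "r = (nonadj {..<n} A)\<^sup>+"
    have r: "equiv {..<n} r" unfolding r_def using equiv_nonadj[OF G] by (simp add: V A)
    have rn: "r \<subseteq> {..<n} \<times> {..<n}" by (rule equiv_type[OF r])
    \<comment> \<open>The count in \<open>odd_out\<close> also covers \<open>x = v\<close>, which is
      harmless as \<open>A\<close> has no loops.\<close>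
    have degs: "deg {..<n} (completion A) v = 1 \<longleftrightarrow> odd_out n A v" if "v < n" for v
    proof -
      have irr: "(v, v) \<notin> A" using oriented_graphD(3)[OF G, of v v] by (auto simp: A)
      have "deg {..<n} (completion A) v = of_bool (odd (card {x \<in> {..<n} - {v}. completion A v x = 1}))"
        unfolding deg_def by (rule card_parity_sum) simp
      also have "{x \<in> {..<n} - {v}. completion A v x = 1} = {x. x < n \<and> ((v, x) \<in> A \<or> (x, v) \<notin> A \<and> v < x)}"
        using irr by (auto simp: completion_def)
      finally show ?thesis by (simp add: odd_out_def)
    qed
    have odds: "{u \<in> {..<n}. deg {..<n} (completion A) u = 1} \<inter> r `` {u} =
        {v. v < n \<and> (u, v) \<in> r \<and> odd_out n A v}" for u
      using degs by auto
    have cls: "r `` {u} = {v. v < n \<and> (u, v) \<in> r}" for u using rn by auto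
    have reps: "class_reps {..<n} r = {u. u < n \<and> (\<forall>v<u. (u, v) \<notin> r)}"
      unfolding class_reps_def by (auto simp: not_less[symmetric])
    show ?thesis
      using 3(1) unfolding eq_invertible_odd_iff_classes[OF G 3(2) p'] V A r_def[symmetric] odds reps
        invertibility_test_def Let_def unfolding cls using 3(2) by simp
  qed
  then show ?thesis using iff by (simp add: A_def)
qed

section \<open>Timed weakest preconditions for random access machines\<close>

text \<open>Total correctness: a halting run is asserted to exist. The postcondition also sees the
  running time, so that the rules add up time bounds along with the functional
  specification.\<close>

definition wp :: "ram \<Rightarrow> ram_state \<Rightarrow> (nat \<Rightarrow> ram_state \<Rightarrow> bool) \<Rightarrow> bool" where
  "wp c s Q \<longleftrightarrow> (\<exists>t s'. runs c s t s' \<and> Q t s')"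

lemma wp_mono: "wp c s Q \<Longrightarrow> (\<And>t s'. Q t s' \<Longrightarrow> Q' t s') \<Longrightarrow> wp c s Q'"
  unfolding wp_def by blast

lemma wp_Const: "Q 1 (R(i := k), M) \<Longrightarrow> wp (Const i k) (R, M) Q"
  and wp_Add: "Q 1 (R(i := R j + R l), M) \<Longrightarrow> wp (Add i j l) (R, M) Q"
  and wp_Sub: "Q 1 (R(i := R j - R l), M) \<Longrightarrow> wp (Sub i j l) (R, M) Q"
  and wp_Load: "Q 1 (R(i := M (R j)), M) \<Longrightarrow> wp (Load i j) (R, M) Q"
  and wp_Store: "Q 1 (R, M(R i := R j)) \<Longrightarrow> wp (Store i j) (R, M) Q"
  unfolding wp_def by (blast intro: runs.intros)+

lemma wp_Seq: "wp a s (\<lambda>t s'. wp b s' (\<lambda>t'. Q (t + t'))) \<Longrightarrow> wp (Seq a b) s Q"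
  unfolding wp_def by (blast intro: runs.Seq)

lemma wp_Cond:
  assumes "R i \<noteq> 0 \<Longrightarrow> wp a (R, M) (\<lambda>t. Q (Suc t))" "R i = 0 \<Longrightarrow> wp b (R, M) (\<lambda>t. Q (Suc t))"
  shows "wp (Cond i a b) (R, M) Q"
  using assms unfolding wp_def by (cases "R i = 0") (force intro: runs.CondT runs.CondF)+

lemmas wp_straight = wp_Const wp_Add wp_Sub wp_Load wp_Store

text \<open>The number \<open>m\<close> of rounds is known in advance and the invariant is indexed
  by the rounds done, so termination and time bound come together: each round costs at most
  \<open>T\<close> plus one test, and a last test fails.\<close>

lemma wp_While:
  assumes init: "I 0 s"
    and step: "\<And>j s. j < m \<Longrightarrow> I j s \<Longrightarrow> fst s i \<noteq> 0 \<and> wp body s (\<lambda>t s'. t \<le> T \<and> I (Suc j) s')"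
    and stop: "\<And>s. I m s \<Longrightarrow> fst s i = 0"
    and post: "\<And>t s'. t \<le> m * (T + 1) + 1 \<Longrightarrow> I m s' \<Longrightarrow> Q t s'"
  shows "wp (While i body) s Q"
proof -
  have "\<exists>t s'. runs (While i body) s t s' \<and> t \<le> k * (T + 1) + 1 \<and> I m s'"
    if "I j s" "j + k = m" for k j s
    using that
  proof (induction k arbitrary: j s)
    case 0
    then have "I m s" by simp
    moreover have "runs (While i body) s 1 s" by (intro runs.WhileF stop) fact
    ultimately show ?case by (intro exI[of _ "1::nat"] exI[of _ s]) simp
  next
    case (Suc k)
    have j: "j < m" "Suc j + k = m" using Suc.prems(2) by simp_all
    obtain t1 s1 where 1: "runs body s t1 s1" "t1 \<le> T" "I (Suc j) s1" and nz: "fst s i \<noteq> 0"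
      using step[OF j(1) Suc.prems(1)] unfolding wp_def by blast
    obtain t2 s2 where 2: "runs (While i body) s1 t2 s2" "t2 \<le> k * (T + 1) + 1" "I m s2"
      using Suc.IH[OF 1(3) j(2)] by blast
    have "runs (While i body) s (Suc (t1 + t2)) s2" by (rule runs.WhileT[OF nz 1(1) 2(1)])
    moreover have "Suc (t1 + t2) \<le> Suc k * (T + 1) + 1" using 1(2) 2(2) by simp
    ultimately show ?case using 2(3) by blast
  qed
  from this[OF init, of m] obtain t s' where "runs (While i body) s t s'" "t \<le> m * (T + 1) + 1" "I m s'"
    unfolding add_0 by blast
  then show ?thesis unfolding wp_def using post by blast
qed

text \<open>
  Register conventions: 1 holds the number \<open>n\<close> of vertices, 2 the constant 1, 5 loop conditions,
  6 and 10 the base addresses of the adjacency matrix and of the work matrix, 12 and 13 serve for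
  address computations.
\<close>

definition for_loop :: "nat \<Rightarrow> ram \<Rightarrow> ram" where
  "for_loop i body = Seq (Const i 0) (Seq (Sub 5 1 i)
     (While 5 (Seq body (Seq (Add i i 2) (Sub 5 1 i)))))"

text \<open>Besides the body, a round increments the counter, recomputes register 5 and tests it; 3
  more steps are two initialisations and the last test. Recomputing register 5 before every test
  lets nested loops share it.\<close>

lemma wp_for_loop:
  assumes i: "i \<notin> {1, 2, 5}" and R: "R 1 = n" "R 2 = 1"
    and init: "I 0 (R(i := 0, 5 := n)) M"
    and step: "\<And>j R M. j < n \<Longrightarrow> I j R M \<Longrightarrow> R i = j \<Longrightarrow> R 1 = n \<Longrightarrow> R 2 = 1 \<Longrightarrow>
      wp body (R, M) (\<lambda>t (R', M'). t \<le> T \<and> R' i = j \<and> R' 1 = n \<and> R' 2 = 1 \<and>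
        I (Suc j) (R'(i := Suc j, 5 := n - Suc j)) M')"
    and post: "\<And>t R' M'. t \<le> n * (T + 3) + 3 \<Longrightarrow> I n R' M' \<Longrightarrow> R' 1 = n \<Longrightarrow> R' 2 = 1 \<Longrightarrow> Q t (R', M')"
  shows "wp (for_loop i body) (R, M) Q"
proof -
  define J where "J = (\<lambda>j (R :: nat \<Rightarrow> nat, M :: nat \<Rightarrow> nat).
    I j R M \<and> R i = j \<and> R 1 = n \<and> R 2 = 1 \<and> R 5 = n - j)"
  have loop: "wp (While 5 (Seq body (Seq (Add i i 2) (Sub 5 1 i)))) (R(i := 0, 5 := n), M)
    (\<lambda>t. Q (1 + (1 + t)))"
  proof (rule wp_While[where I = J and m = n and T = "T + 2"])
    show "J 0 (R(i := 0, 5 := n), M)" using init i R by (auto simp: J_def)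
    fix j s assume j: "j < n" and J: "J j s"
    obtain R M where s: "s = (R, M)" by force
    have b: "wp body (R, M) (\<lambda>t (R', M'). t \<le> T \<and> R' i = j \<and> R' 1 = n \<and> R' 2 = 1 \<and>
        I (Suc j) (R'(i := Suc j, 5 := n - Suc j)) M')"
      using step[of j R M] j J by (simp add: J_def s)
    show "fst s 5 \<noteq> 0 \<and> wp (Seq body (Seq (Add i i 2) (Sub 5 1 i))) s (\<lambda>t s'. t \<le> T + 2 \<and> J (Suc j) s')"
    proof
      show "fst s 5 \<noteq> 0" using J j by (simp add: J_def s)
      show "wp (Seq body (Seq (Add i i 2) (Sub 5 1 i))) s (\<lambda>t s'. t \<le> T + 2 \<and> J (Suc j) s')"
        unfolding s
      proof (rule wp_Seq, rule wp_mono[OF b])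
        fix t s' assume Q: "case s' of (R', M') \<Rightarrow> t \<le> T \<and> R' i = j \<and> R' 1 = n \<and> R' 2 = 1 \<and>
          I (Suc j) (R'(i := Suc j, 5 := n - Suc j)) M'"
        obtain R' M' where s': "s' = (R', M')" by force
        show "wp (Seq (Add i i 2) (Sub 5 1 i)) s' (\<lambda>t' s''. t + t' \<le> T + 2 \<and> J (Suc j) s'')"
          unfolding s' by (intro wp_Seq wp_straight) (use Q i in \<open>auto simp: J_def s'\<close>)
      qed
    qed
  next
    fix s assume "J n s" then show "fst s 5 = 0" by (auto simp: J_def split: prod.splits)
  next
    fix t s' assume t: "t \<le> n * (T + 2 + 1) + 1" and J: "J n s'"
    obtain R' M' where s': "s' = (R', M')" by force
    show "Q (1 + (1 + t)) s'" unfolding s'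
      by (rule post) (use t J in \<open>auto simp: J_def s' algebra_simps\<close>)
  qed
  show ?thesis unfolding for_loop_def
    by (intro wp_Seq wp_straight) (use loop R i in \<open>simp add: fun_upd_twist\<close>)
qed

text \<open>Without multiplication, the offset of row \<open>u\<close> is obtained by adding
  \<open>n\<close> as often as register 13, a copy of the row index, can be decremented. The address
  is left in register 12.\<close>

definition matrix_address :: "nat \<Rightarrow> nat \<Rightarrow> nat \<Rightarrow> ram" where
  "matrix_address b u v = Seq (Add 12 b v) (Seq (Const 13 0) (Seq (Add 13 13 u)
     (While 13 (Seq (Add 12 12 1) (Sub 13 13 2)))))"

lemma wp_matrix_address:
  assumes R: "R 2 = 1" and uv: "u \<notin> {12, 13}"
    and post: "\<And>t. t \<le> 3 * R u + 4 \<Longrightarrow> Q t (R(12 := R b + R v + R u * R 1, 13 := 0), M)"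
  shows "wp (matrix_address b u v) (R, M) Q"
proof -
  define J where "J = (\<lambda>j s. s = (R(12 := R b + R v + j * R 1, 13 := R u - j), M))"
  have "wp (While 13 (Seq (Add 12 12 1) (Sub 13 13 2))) (R(12 := R b + R v, 13 := R u), M)
    (\<lambda>t. Q (3 + t))"
  proof (rule wp_While[where I = J and m = "R u" and T = 2])
    fix j s assume "j < R u" "J j s"
    then show "fst s 13 \<noteq> 0 \<and> wp (Seq (Add 12 12 1) (Sub 13 13 2)) s (\<lambda>t s'. t \<le> 2 \<and> J (Suc j) s')"
      unfolding J_def by (auto intro!: wp_Seq wp_straight simp: R fun_upd_twist)
  next
    fix t s' assume "t \<le> R u * (2 + 1) + 1" "J (R u) s'"
    then show "Q (3 + t) s'" using post[of "3 + t"] by (simp add: J_def)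
  qed (auto simp: J_def)
  then show ?thesis unfolding matrix_address_def
    by (intro wp_Seq wp_straight) (use uv in \<open>simp add: eval_nat_numeral\<close>)
qed

definition get_entry :: "nat \<Rightarrow> nat \<Rightarrow> nat \<Rightarrow> nat \<Rightarrow> ram" where
  "get_entry d b u v = Seq (matrix_address b u v) (Load d 12)"

definition put_entry :: "nat \<Rightarrow> nat \<Rightarrow> nat \<Rightarrow> nat \<Rightarrow> ram" where
  "put_entry b u v r = Seq (matrix_address b u v) (Store 12 r)"

lemma wp_get_entry:
  assumes R: "R 2 = 1" "R u \<le> n" and uv: "u \<notin> {12, 13}"
    and post: "\<And>t. t \<le> 3 * n + 5 \<Longrightarrow> Q t (R(12 := R b + R v + R u * R 1, 13 := 0,
      d := M (R b + R v + R u * R 1)), M)"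
  shows "wp (get_entry d b u v) (R, M) Q"
  unfolding get_entry_def
  by (intro wp_Seq wp_matrix_address wp_straight R(1) uv) (use post R(2) in simp)

lemma wp_put_entry:
  assumes R: "R 2 = 1" "R u \<le> n" and uv: "u \<notin> {12, 13}" "r \<notin> {12, 13}"
    and post: "\<And>t. t \<le> 3 * n + 5 \<Longrightarrow> Q t (R(12 := R b + R v + R u * R 1, 13 := 0),
      M(R b + R v + R u * R 1 := R r))"
  shows "wp (put_entry b u v r) (R, M) Q"
  unfolding put_entry_def
  by (intro wp_Seq wp_matrix_address wp_straight R(1) uv(1)) (use post R(2) uv in simp)

section \<open>Matrices in memory\<close>

definition mat :: "nat \<Rightarrow> nat \<Rightarrow> (nat \<Rightarrow> nat) \<Rightarrow> nat rel \<Rightarrow> bool" where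
  "mat b n M X \<longleftrightarrow> (\<forall>x<n. \<forall>y<n. M (b + y + x * n) = of_bool ((x, y) \<in> X))"

lemma matrix_address_inj:
  assumes "y < n" "y' < n"
  shows "b + y + x * n = b + y' + x' * n \<longleftrightarrow> x = x' \<and> y = (y'::nat)"
proof
  assume "b + y + x * n = b + y' + x' * n"
  then have e: "y + x * n = y' + x' * n" by simp
  have "(y + x * n) div n = x" "(y' + x' * n) div n = x'" using assms by auto
  then have "x = x'" using e by metis
  then show "x = x' \<and> y = y'" using e by simp
qed simp

lemma mat_insert:
  "mat b n M X \<Longrightarrow> x < n \<Longrightarrow> y < n \<Longrightarrow> mat b n (M(b + y + x * n := 1)) (insert (x, y) X)"
  unfolding mat_def by (auto simp: matrix_address_inj)

lemma matD: "mat b n M X \<Longrightarrow> x < n \<Longrightarrow> y < n \<Longrightarrow> M (b + y + x * n) = of_bool ((x, y) \<in> X)"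
  by (simp add: mat_def)

lemma mat_cong: "mat b n M X \<Longrightarrow> (\<And>x y. x < n \<Longrightarrow> y < n \<Longrightarrow> (x, y) \<in> X \<longleftrightarrow> (x, y) \<in> Y) \<Longrightarrow> mat b n M Y"
  by (simp add: mat_def)

lemma mat_low:
  assumes "mat b n M X" "\<And>a. a < L \<Longrightarrow> M' a = M a" "b + n * n \<le> L"
  shows "mat b n M' X"
  unfolding mat_def
proof (intro allI impI)
  fix x y assume xy: "x < n" "y < n"
  have "y + x * n < Suc x * n" using xy by simp
  also have "\<dots> \<le> n * n" using xy by (intro mult_le_mono1) simp
  finally show "M' (b + y + x * n) = of_bool ((x, y) \<in> X)" using assms matD[OF assms(1) xy] by simp
qed

section \<open>The decision program\<close>

text \<open>The standing invariant. The work matrix starts at \<open>L\<close>, behind the adjacency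
  matrix, so that writing to it cannot damage the latter.\<close>

definition ctx :: "nat \<Rightarrow> nat \<Rightarrow> nat \<Rightarrow> nat rel \<Rightarrow> (nat \<Rightarrow> nat) \<Rightarrow> (nat \<Rightarrow> nat) \<Rightarrow> bool" where
  "ctx n b L A R M \<longleftrightarrow> R 1 = n \<and> R 2 = 1 \<and> R 6 = b \<and> R 10 = L \<and> b + n * n \<le> L \<and> mat b n M A"

lemma ctx_upd: "i \<notin> {1, 2, 6, 10} \<Longrightarrow> ctx n b L A (R(i := x)) M \<longleftrightarrow> ctx n b L A R M"
  by (auto simp: ctx_def)

lemma ctx_store: "ctx n b L A R M \<Longrightarrow> L \<le> a \<Longrightarrow> ctx n b L A R (M(a := x))"
  unfolding ctx_def using mat_low[of b n M A L "M(a := x)"] by auto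

lemma ctx_store_entry: "ctx n b L A R M \<Longrightarrow> ctx n b L A R (M(L + y + x * n := z))"
  by (rule ctx_store) auto

lemma ctxD:
  assumes "ctx n b L A R M"
  shows "R 1 = n" "R (Suc 0) = n" "R 2 = 1" "R 6 = b" "R 10 = L" "mat b n M A"
  using assms by (auto simp: ctx_def)

text \<open>Progress in row-major order. The positions \<open>(u, n)\<close> and
  \<open>(Suc u, 0)\<close> describe the same state, which links the inner loop to the outer
  one.\<close>

definition filled :: "nat \<Rightarrow> nat \<Rightarrow> nat \<Rightarrow> nat \<Rightarrow> (nat \<Rightarrow> nat) \<Rightarrow> nat rel \<Rightarrow> bool" where
  "filled b n u v M X \<longleftrightarrow>
    (\<forall>x y. y < n \<longrightarrow> x < u \<or> x = u \<and> y < v \<longrightarrow> M (b + y + x * n) = of_bool ((x, y) \<in> X))"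

lemma filled_step:
  assumes "filled b n u v M X" "v < n" "z = of_bool ((u, v) \<in> X)"
  shows "filled b n u (Suc v) (M(b + v + u * n := z)) X"
  using assms unfolding filled_def by (auto simp: matrix_address_inj less_Suc_eq)

lemma filled_row: "filled b n u n M X \<longleftrightarrow> filled b n (Suc u) 0 M X"
  unfolding filled_def by (auto simp: less_Suc_eq)

lemma filled_0: "filled b n 0 0 M X"
  by (simp add: filled_def)

lemma filled_all: "filled b n n 0 M X \<longleftrightarrow> mat b n M X"
  by (auto simp: filled_def mat_def)

text \<open>One routine prepares both closures: if register 11 is set it copies \<open>A\<close>,
  for the acyclicity test, and otherwise it writes 1 minus the sum of the entries at
  \<open>(u, v)\<close> and \<open>(v, u)\<close>, which is nonadjacency.\<close>

definition build_matrix :: ram where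
  "build_matrix = for_loop 14 (for_loop 15 (Seq (get_entry 16 6 14 15) (Seq (get_entry 17 6 15 14)
     (Seq (Cond 11 (Seq (Const 18 0) (Add 18 18 16)) (Seq (Add 18 16 17) (Sub 18 2 18)))
       (put_entry 10 14 15 18)))))"

lemma wp_build_matrix:
  assumes C: "ctx n b L A R M" and m: "R 11 = of_bool m"
    and X: "X = (if m then A else {(x, y). (x, y) \<notin> A \<and> (y, x) \<notin> A})"
    and post: "\<And>t R' M'. t \<le> n * ((n * ((9 * n + 20) + 3) + 3) + 3) + 3 \<Longrightarrow> ctx n b L A R' M' \<Longrightarrow>
      mat L n M' X \<Longrightarrow> Q t (R', M')"
  shows "wp build_matrix (R, M) Q"
  unfolding build_matrix_def
proof (rule wp_for_loop[where n = n and T = "n * ((9 * n + 20) + 3) + 3" and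
    I = "\<lambda>u R M. ctx n b L A R M \<and> R 11 = of_bool m \<and>
      filled L n u 0 M X"])
  fix u R M
  assume u: "u < n" and I: "ctx n b L A R M \<and> R 11 = of_bool m \<and>
      filled L n u 0 M X" and R14: "R 14 = u"
  note R0 = ctxD[OF conjunct1[OF I]]
  show "wp (for_loop 15 (Seq (get_entry 16 6 14 15) (Seq (get_entry 17 6 15 14)
     (Seq (Cond 11 (Seq (Const 18 0) (Add 18 18 16)) (Seq (Add 18 16 17) (Sub 18 2 18)))
       (put_entry 10 14 15 18))))) (R, M)
    (\<lambda>t (R', M'). t \<le> n * ((9 * n + 20) + 3) + 3 \<and> R' 14 = u \<and> R' 1 = n \<and> R' 2 = 1 \<and>
      ctx n b L A (R'(14 := Suc u, 5 := n - Suc u)) M' \<and> (R'(14 := Suc u, 5 := n - Suc u)) 11 = of_bool m \<and>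
      filled L n (Suc u) 0 M' X)"
  proof (rule wp_for_loop[where n = n and T = "9 * n + 20" and
      I = "\<lambda>v R M. ctx n b L A R M \<and> R 11 = of_bool m \<and> R 14 = u \<and>
        filled L n u v M X"])
    fix v R M
    assume v: "v < n" and R15: "R 15 = v" and
      I: "ctx n b L A R M \<and> R 11 = of_bool m \<and> R 14 = u \<and>
        filled L n u v M X"
    then have C: "ctx n b L A R M" and I': "R 11 = of_bool m" "R 14 = u"
      and F: "filled L n u v M X" by auto
    note R = ctxD[OF C]
    have Auv: "M (b + v + u * n) = of_bool ((u, v) \<in> A)" "M (b + u + v * n) = of_bool ((v, u) \<in> A)"
      by (rule matD[OF R(6) u v], rule matD[OF R(6) v u])
    have z: "of_bool ((u, v) \<in> X) =
        (if m then of_bool ((u, v) \<in> A) else Suc 0 - (of_bool ((u, v) \<in> A) + of_bool ((v, u) \<in> A)))"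
      by (auto simp: X)
    show "wp (Seq (get_entry 16 6 14 15) (Seq (get_entry 17 6 15 14)
     (Seq (Cond 11 (Seq (Const 18 0) (Add 18 18 16)) (Seq (Add 18 16 17) (Sub 18 2 18)))
       (put_entry 10 14 15 18)))) (R, M) (\<lambda>t (R', M'). t \<le> 9 * n + 20 \<and> R' 15 = v \<and> R' 1 = n \<and> R' 2 = 1 \<and>
        ctx n b L A (R'(15 := Suc v, 5 := n - Suc v)) M' \<and>
        (R'(15 := Suc v, 5 := n - Suc v)) 11 = of_bool m \<and> (R'(15 := Suc v, 5 := n - Suc v)) 14 = u \<and>
        filled L n u (Suc v) M' X)"
      by (intro wp_Seq wp_get_entry[where n = n] wp_put_entry[where n = n] wp_Cond wp_straight)
        (use u v R R15 I' Auv C F in \<open>simp_all add: ctx_upd ctx_store_entry filled_step z\<close>)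
  qed (use R0 I R14 in \<open>auto simp: ctx_upd filled_row\<close>)
qed (use C m post ctxD[OF C] in \<open>auto simp: ctx_upd filled_0 filled_all\<close>)

text \<open>
  The state of an in-place update with pivot \<open>k\<close> after the entries before \<open>(u, v)\<close>. The update is sound
  in place since it does not change row and column \<open>k\<close>.
\<close>

definition wstep :: "nat \<Rightarrow> nat \<Rightarrow> nat \<Rightarrow> nat rel \<Rightarrow> nat rel" where
  "wstep k u v X = X \<union> {(x, y). (x < u \<or> x = u \<and> y < v) \<and> (x, k) \<in> X \<and> (k, y) \<in> X}"

lemma wstep_0: "wstep k 0 0 X = X"
  by (auto simp: wstep_def)

lemma wstep_pivot: "(x, k) \<in> wstep k u v X \<longleftrightarrow> (x, k) \<in> X" "(k, y) \<in> wstep k u v X \<longleftrightarrow> (k, y) \<in> X"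
  by (auto simp: wstep_def)

lemma wstep_Suc:
  "(u, k) \<in> X \<Longrightarrow> (k, v) \<in> X \<Longrightarrow> wstep k u (Suc v) X = insert (u, v) (wstep k u v X)"
  "(k, v) \<notin> X \<Longrightarrow> wstep k u (Suc v) X = wstep k u v X"
  by (auto simp: wstep_def less_Suc_eq)

lemma mat_wstep_row:
  "mat b n M (wstep k u n X) \<longleftrightarrow> mat b n M (wstep k (Suc u) 0 X)"
  unfolding mat_def wstep_def by (auto simp: less_Suc_eq)

lemma wstep_skip_row: "(u, k) \<notin> X \<Longrightarrow> wstep k (Suc u) 0 X = wstep k u 0 X"
  by (auto simp: wstep_def less_Suc_eq)

section \<open>Warshall's algorithm\<close>

primrec warshall_rel :: "nat \<Rightarrow> nat rel \<Rightarrow> nat \<Rightarrow> nat rel" where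
  "warshall_rel n X 0 = X"
| "warshall_rel n X (Suc k) = wstep k n 0 (warshall_rel n X k)"

text \<open>After \<open>k\<close> pivots the relation lies between \<open>X\<close> and
  \<open>X\<^sup>+\<close> and is closed under composition through intermediate vertices below
  \<open>k\<close>. For \<open>k = n\<close> it is therefore transitive, and no path has to be
  decomposed.\<close>

lemma warshall_rel_eq_trancl:
  assumes X: "X \<subseteq> {..<n} \<times> {..<n}"
  shows "warshall_rel n X n = X\<^sup>+"
proof -
  let ?W = "warshall_rel n X"
  have inv: "X \<subseteq> ?W k \<and> ?W k \<subseteq> X\<^sup>+ \<and> ?W k \<subseteq> {..<n} \<times> {..<n} \<and>
    (\<forall>i<k. \<forall>x y. (x, i) \<in> ?W k \<longrightarrow> (i, y) \<in> ?W k \<longrightarrow> (x, y) \<in> ?W k)" for k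
  proof (induction k)
    case (Suc k)
    let ?Y = "?W k"
    have eq: "?W (Suc k) = ?Y \<union> {(x, y). (x, k) \<in> ?Y \<and> (k, y) \<in> ?Y}"
      using Suc by (auto simp: wstep_def)
    have t: "(x, y) \<in> ?Y" if "i < k" "(x, i) \<in> ?Y" "(i, y) \<in> ?Y" for i x y using Suc that by blast
    have "(x, y) \<in> ?W (Suc k)" if i: "i < Suc k" and xi: "(x, i) \<in> ?W (Suc k)" and iy: "(i, y) \<in> ?W (Suc k)"
      for i x y
    proof (cases "i = k")
      case True
      then show ?thesis using xi iy unfolding eq by auto
    next
      case False
      then have "i < k" using i by simp
      then show ?thesis using xi iy t[of i] unfolding eq by blast
    qed
    moreover have "X \<subseteq> ?W (Suc k)" "?W (Suc k) \<subseteq> {..<n} \<times> {..<n}" unfolding eq using Suc by blast+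
    moreover have "?W (Suc k) \<subseteq> X\<^sup>+"
    proof -
      have "?Y \<subseteq> X\<^sup>+" using Suc by blast
      then show ?thesis unfolding eq by (auto intro: trancl_trans)
    qed
    ultimately show ?case by blast
  qed (use X in auto)
  have "trans (?W n)"
  proof (rule transI)
    fix x i y assume xy: "(x, i) \<in> ?W n" "(i, y) \<in> ?W n"
    then have "i < n" using inv[of n] by blast
    then show "(x, y) \<in> ?W n" using inv[of n] xy by blast
  qed
  then have "(?W n)\<^sup>+ = ?W n" by (rule trancl_id)
  moreover have "X\<^sup>+ \<subseteq> (?W n)\<^sup>+" using inv[of n] by (intro trancl_mono_subset) blast
  ultimately show ?thesis using inv[of n] by blast
qed

text \<open>Rows without the pivot are skipped. The language has no empty statement, so clearing a
  scratch register takes its place in the else branches.\<close>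

definition warshall :: ram where
  "warshall = for_loop 14 (for_loop 15 (Seq (get_entry 16 10 15 14) (Cond 16
     (for_loop 17 (Seq (get_entry 18 10 14 17) (Cond 18 (put_entry 10 15 17 2) (Const 18 0))))
     (Const 16 0))))"

lemma wp_warshall_row:
  assumes C: "ctx n b L A R M" and R: "R 14 = k" "R 15 = u" "k < n" "u < n"
    and B: "mat L n M (wstep k u 0 X)" and uk: "(u, k) \<in> X"
    and post: "\<And>t R' M'. t \<le> n * ((6 * n + 12) + 3) + 3 \<Longrightarrow> ctx n b L A R' M' \<Longrightarrow> R' 14 = k \<Longrightarrow>
      R' 15 = u \<Longrightarrow> mat L n M' (wstep k (Suc u) 0 X) \<Longrightarrow> Q t (R', M')"
  shows "wp (for_loop 17 (Seq (get_entry 18 10 14 17) (Cond 18 (put_entry 10 15 17 2) (Const 18 0)))) (R, M) Q"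
proof (rule wp_for_loop[where n = n and T = "6 * n + 12" and
    I = "\<lambda>v R M. ctx n b L A R M \<and> R 14 = k \<and> R 15 = u \<and> mat L n M (wstep k u v X)"])
  fix v R M
  assume v: "v < n" and R17: "R 17 = v" and
    I: "ctx n b L A R M \<and> R 14 = k \<and> R 15 = u \<and> mat L n M (wstep k u v X)"
  then have C: "ctx n b L A R M" and I': "R 14 = k" "R 15 = u" and B: "mat L n M (wstep k u v X)" by auto
  note R0 = ctxD[OF C]
  have e: "M (L + v + k * n) = of_bool ((k, v) \<in> X)"
    using matD[OF B \<open>k < n\<close> v] by (simp add: wstep_pivot)
  have B1: "mat L n (M(L + v + u * n := Suc 0)) (insert (u, v) (wstep k u v X))"
    using mat_insert[OF B \<open>u < n\<close> v] by simp
  show "wp (Seq (get_entry 18 10 14 17) (Cond 18 (put_entry 10 15 17 2) (Const 18 0))) (R, M)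
    (\<lambda>t (R', M'). t \<le> 6 * n + 12 \<and> R' 17 = v \<and> R' 1 = n \<and> R' 2 = 1 \<and>
      ctx n b L A (R'(17 := Suc v, 5 := n - Suc v)) M' \<and> (R'(17 := Suc v, 5 := n - Suc v)) 14 = k \<and>
      (R'(17 := Suc v, 5 := n - Suc v)) 15 = u \<and> mat L n M' (wstep k u (Suc v) X))"
    by (intro wp_Seq wp_get_entry[where n = n] wp_put_entry[where n = n] wp_Cond wp_straight)
      (use v R0 R17 I' C B B1 e uk \<open>k < n\<close> \<open>u < n\<close> in \<open>simp_all add: ctx_upd ctx_store_entry wstep_Suc\<close>)
qed (use C R B post ctxD[OF C] in \<open>auto simp: ctx_upd mat_wstep_row\<close>)

lemma wp_warshall:
  assumes C: "ctx n b L A R M" and B: "mat L n M X" and X: "X \<subseteq> {..<n} \<times> {..<n}"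
    and post: "\<And>t R' M'.
      t \<le> n * ((n * ((n * ((6 * n + 12) + 3) + 3 + (3 * n + 8)) + 3) + 3) + 3) + 3 \<Longrightarrow>
      ctx n b L A R' M' \<Longrightarrow> mat L n M' (X\<^sup>+) \<Longrightarrow> Q t (R', M')"
  shows "wp warshall (R, M) Q"
  unfolding warshall_def
proof (rule wp_for_loop[where n = n and T = "n * ((n * ((6 * n + 12) + 3) + 3 + (3 * n + 8)) + 3) + 3" and
    I = "\<lambda>k R M. ctx n b L A R M \<and> mat L n M (warshall_rel n X k)"])
  fix k R M
  assume k: "k < n" and R14: "R 14 = k" and I: "ctx n b L A R M \<and> mat L n M (warshall_rel n X k)"
  define Y where "Y = warshall_rel n X k"
  have Y: "warshall_rel n X (Suc k) = wstep k n 0 Y" by (simp add: Y_def)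
  note R0 = ctxD[OF conjunct1[OF I]]
  show "wp (for_loop 15 (Seq (get_entry 16 10 15 14) (Cond 16
     (for_loop 17 (Seq (get_entry 18 10 14 17) (Cond 18 (put_entry 10 15 17 2) (Const 18 0))))
     (Const 16 0)))) (R, M) (\<lambda>t (R', M'). t \<le> n * ((n * ((6 * n + 12) + 3) + 3 + (3 * n + 8)) + 3) + 3 \<and>
       R' 14 = k \<and> R' 1 = n \<and> R' 2 = 1 \<and>
       ctx n b L A (R'(14 := Suc k, 5 := n - Suc k)) M' \<and> mat L n M' (warshall_rel n X (Suc k)))"
  proof (rule wp_for_loop[where n = n and T = "n * ((6 * n + 12) + 3) + 3 + (3 * n + 8)" and
      I = "\<lambda>u R M. ctx n b L A R M \<and> R 14 = k \<and> mat L n M (wstep k u 0 Y)"])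
    fix u R M
    assume u: "u < n" and R15: "R 15 = u" and
      I: "ctx n b L A R M \<and> R 14 = k \<and> mat L n M (wstep k u 0 Y)"
    then have C: "ctx n b L A R M" and I': "R 14 = k" and B: "mat L n M (wstep k u 0 Y)" by auto
    note R0 = ctxD[OF C]
    have e: "M (L + k + u * n) = of_bool ((u, k) \<in> Y)"
      using matD[OF B u k] by (simp add: wstep_pivot)
    show "wp (Seq (get_entry 16 10 15 14) (Cond 16
       (for_loop 17 (Seq (get_entry 18 10 14 17) (Cond 18 (put_entry 10 15 17 2) (Const 18 0))))
       (Const 16 0))) (R, M) (\<lambda>t (R', M'). t \<le> n * ((6 * n + 12) + 3) + 3 + (3 * n + 8) \<and> R' 15 = u \<and>
         R' 1 = n \<and> R' 2 = 1 \<and> ctx n b L A (R'(15 := Suc u, 5 := n - Suc u)) M' \<and>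
         (R'(15 := Suc u, 5 := n - Suc u)) 14 = k \<and> mat L n M' (wstep k (Suc u) 0 Y))"
    proof (cases "(u, k) \<in> Y")
      case True
      show ?thesis
        apply (intro wp_Seq wp_get_entry[where n = n] wp_Cond wp_straight
            wp_warshall_row[where n = n and b = b and L = L and A = A and k = k and u = u and X = Y])
        using u k R0 R15 I' C B e True
        apply (simp_all add: ctx_upd)
        apply (auto dest: ctxD)
        done
    next
      case False
      show ?thesis
        \<comment> \<open>Register 16 is 0, so the branch with the row loop is discharged by
          contradiction.\<close>
        apply (rule wp_Seq, rule wp_get_entry[where n = n])
           prefer 4
           apply (rule wp_Cond, use e R0 R15 I' False in simp, rule wp_Const)
        using u k R0 R15 I' C B e False
        apply (simp_all add: ctx_upd wstep_skip_row)
        done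
    qed
  qed (use R0 I R14 in \<open>auto simp: ctx_upd Y wstep_0 Y_def[symmetric] dest: ctxD\<close>)
qed (use C B post ctxD[OF C] X in \<open>auto simp: ctx_upd warshall_rel_eq_trancl\<close>)

section \<open>The two tests on the transitive closure\<close>

definition diagonal_test :: ram where
  "diagonal_test = Seq (Const 0 1) (for_loop 14 (Seq (get_entry 16 10 14 14)
     (Cond 16 (Const 0 0) (Const 16 0))))"

lemma wp_diagonal_test:
  assumes C: "ctx n b L A R M" and B: "mat L n M X"
    and post: "\<And>t R' M'. t \<le> n * ((3 * n + 7) + 3) + 4 \<Longrightarrow>
      R' 0 = of_bool (\<forall>x<n. (x, x) \<notin> X) \<Longrightarrow> Q t (R', M')"
  shows "wp diagonal_test (R, M) Q"
  unfolding diagonal_test_def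
proof (rule wp_Seq, rule wp_Const, rule wp_for_loop[where n = n and T = "3 * n + 7" and
    I = "\<lambda>j R M. ctx n b L A R M \<and> mat L n M X \<and> R 0 = of_bool (\<forall>x<j. (x, x) \<notin> X)"])
  fix j R M
  assume j: "j < n" and R14: "R 14 = j" and
    I: "ctx n b L A R M \<and> mat L n M X \<and> R 0 = of_bool (\<forall>x<j. (x, x) \<notin> X)"
  then have C: "ctx n b L A R M" and B: "mat L n M X" and R0: "R 0 = of_bool (\<forall>x<j. (x, x) \<notin> X)" by auto
  have s: "(\<forall>x<Suc j. (x, x) \<notin> X) \<longleftrightarrow> (\<forall>x<j. (x, x) \<notin> X) \<and> (j, j) \<notin> X" by (auto simp: less_Suc_eq)
  show "wp (Seq (get_entry 16 10 14 14) (Cond 16 (Const 0 0) (Const 16 0))) (R, M)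
    (\<lambda>t (R', M'). t \<le> 3 * n + 7 \<and> R' 14 = j \<and> R' 1 = n \<and> R' 2 = 1 \<and>
      ctx n b L A (R'(14 := Suc j, 5 := n - Suc j)) M' \<and> mat L n M' X \<and>
      (R'(14 := Suc j, 5 := n - Suc j)) 0 = of_bool (\<forall>x<Suc j. (x, x) \<notin> X))"
    unfolding s
    by (intro wp_Seq wp_get_entry[where n = n] wp_Cond wp_straight)
      (use j R14 C B R0 ctxD[OF C] matD[OF B j j] in \<open>simp_all add: ctx_upd\<close>)
qed (use C B post ctxD[OF C] in \<open>auto simp: ctx_upd\<close>)

lemma card_Collect_less_Suc:
  "card {x. x < Suc j \<and> P x} = (if P j then Suc (card {x. x < j \<and> P x}) else card {x. x < j \<and> P x})"
proof -
  have "{x. x < Suc j \<and> P x} = (if P j then insert j {x. x < j \<and> P x} else {x. x < j \<and> P x})"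
    by (auto simp: less_Suc_eq)
  then show ?thesis by simp
qed

text \<open>The parity is kept in register 20 and toggled by subtraction from 1;
  \<open>v < x\<close> is tested as \<open>x - v \<noteq> 0\<close>.\<close>

definition out_parity :: ram where
  "out_parity = Seq (Const 20 0) (for_loop 17 (Seq (get_entry 16 6 15 17) (Cond 16 (Sub 20 2 20)
     (Seq (get_entry 16 6 17 15) (Cond 16 (Const 16 0)
       (Seq (Sub 18 17 15) (Cond 18 (Sub 20 2 20) (Const 18 0))))))))"

text \<open>These registers hold live values of the loops from which \<open>out_parity\<close> is
  called.\<close>

definition frame_out :: "(nat \<Rightarrow> nat) \<Rightarrow> (nat \<Rightarrow> nat) \<Rightarrow> bool" where
  "frame_out R R' \<longleftrightarrow> (\<forall>i \<in> {14, 15, 21, 22, 23, 24, 25}. R' i = R i)"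

lemma wp_out_parity:
  assumes C: "ctx n b L A R M" and v: "R 15 = v" "v < n"
    and post: "\<And>t R'. t \<le> n * ((6 * n + 20) + 3) + 4 \<Longrightarrow> ctx n b L A R' M \<Longrightarrow> frame_out R R' \<Longrightarrow>
      R' 20 = of_bool (odd_out n A v) \<Longrightarrow> Q t (R', M)"
  shows "wp out_parity (R, M) Q"
proof -
  define P where "P x \<longleftrightarrow> (v, x) \<in> A \<or> (x, v) \<notin> A \<and> v < x" for x
  define N where "N j = card {x. x < j \<and> P x}" for j
  have N: "N (Suc j) = (if P j then Suc (N j) else N j)" for j
    unfolding N_def by (rule card_Collect_less_Suc)
  have Nn: "odd_out n A v \<longleftrightarrow> odd (N n)" by (simp add: odd_out_def N_def P_def)
  show ?thesis
    unfolding out_parity_def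
  proof (rule wp_Seq, rule wp_Const, rule wp_for_loop[where n = n and T = "6 * n + 20" and
      I = "\<lambda>j R1 M1. ctx n b L A R1 M1 \<and> M1 = M \<and> frame_out R R1 \<and> R1 20 = of_bool (odd (N j))"])
    fix j R1 M1
    assume j: "j < n" and R17: "R1 17 = j" and
      I: "ctx n b L A R1 M1 \<and> M1 = M \<and> frame_out R R1 \<and> R1 20 = of_bool (odd (N j))"
    then have C1: "ctx n b L A R1 M" and F: "frame_out R R1" and R20: "R1 20 = of_bool (odd (N j))"
      and M1: "M1 = M" by auto
    have R15: "R1 15 = v" using F v by (simp add: frame_out_def)
    note e = matD[OF ctxD(6)[OF C1] v(2) j] matD[OF ctxD(6)[OF C1] j v(2)]
    have F': "frame_out R (R1(i := x))" if "i \<notin> {14, 15, 21, 22, 23, 24, 25}" "frame_out R R1" for i x R1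
      using that by (auto simp: frame_out_def)
    have P: "P j \<longleftrightarrow> (v, j) \<in> A \<or> (j, v) \<notin> A \<and> 0 < j - v" by (simp add: P_def)
    show "wp (Seq (get_entry 16 6 15 17) (Cond 16 (Sub 20 2 20)
       (Seq (get_entry 16 6 17 15) (Cond 16 (Const 16 0)
         (Seq (Sub 18 17 15) (Cond 18 (Sub 20 2 20) (Const 18 0))))))) (R1, M1)
      (\<lambda>t (R', M'). t \<le> 6 * n + 20 \<and> R' 17 = j \<and> R' 1 = n \<and> R' 2 = 1 \<and>
        ctx n b L A (R'(17 := Suc j, 5 := n - Suc j)) M' \<and> M' = M \<and>
        frame_out R (R'(17 := Suc j, 5 := n - Suc j)) \<and>
        (R'(17 := Suc j, 5 := n - Suc j)) 20 = of_bool (odd (N (Suc j))))"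
      by (intro wp_Seq wp_get_entry[where n = n] wp_Cond wp_straight)
        (use j R17 C1 M1 F R20 R15 v(2) ctxD[OF C1] e in \<open>simp_all add: ctx_upd F' N P\<close>)
  qed (use C v post ctxD[OF C] in \<open>auto simp: ctx_upd frame_out_def N_def Nn\<close>)
qed

text \<open>
  For the vertex \<open>u\<close> in register 14: register 23 tells whether \<open>u\<close> is the least element of its class
  \<open>C\<close>, and with \<open>W\<close> the vertices of odd out-degree, registers 24 and 25 hold the parities of
  \<open>|W \<inter> C|\<close> and \<open>|W \<inter> C| + |C|\<close>.
\<close>

definition class_row :: ram where
  "class_row = for_loop 15 (Seq (get_entry 16 10 14 15) (Cond 16
     (Seq (Sub 18 14 15) (Seq (Cond 18 (Const 23 0) (Const 18 0)) (Seq (Sub 25 2 25)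
       (Seq out_parity (Cond 20 (Seq (Sub 24 2 24) (Sub 25 2 25)) (Const 20 0))))))
     (Const 16 0)))"

lemma wp_class_row:
  assumes C: "ctx n b L A R M" and B: "mat L n M r" and u: "R 14 = u" "u < n"
    and R: "R 23 = 1" "R 24 = 0" "R 25 = 0"
    and post: "\<And>t R'. t \<le> n * ((n * ((6 * n + 20) + 3) + (3 * n + 20)) + 3) + 3 \<Longrightarrow> ctx n b L A R' M \<Longrightarrow>
      R' 14 = u \<Longrightarrow> R' 21 = R 21 \<Longrightarrow> R' 22 = R 22 \<Longrightarrow> R' 23 = of_bool (\<forall>v<u. (u, v) \<notin> r) \<Longrightarrow>
      R' 24 = of_bool (odd (card {v. v < n \<and> (u, v) \<in> r \<and> odd_out n A v})) \<Longrightarrow>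
      R' 25 = of_bool (odd (card {v. v < n \<and> (u, v) \<in> r \<and> odd_out n A v} + card {v. v < n \<and> (u, v) \<in> r})) \<Longrightarrow>
      Q t (R', M)"
  shows "wp class_row (R, M) Q"
proof -
  define N where "N j = card {v. v < j \<and> (u, v) \<in> r \<and> odd_out n A v}" for j
  define K where "K j = card {v. v < j \<and> (u, v) \<in> r}" for j
  \<comment> \<open>What register 23 has established after \<open>j\<close> columns; for
    \<open>j = n\<close> this is minimality of \<open>u\<close> in its class, as
    \<open>u < n\<close>.\<close>
  define Z where "Z j \<longleftrightarrow> (\<forall>v<j. v < u \<longrightarrow> (u, v) \<notin> r)" for j
  have N: "N (Suc j) = (if (u, j) \<in> r \<and> odd_out n A j then Suc (N j) else N j)" for j
    unfolding N_def by (rule card_Collect_less_Suc)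
  have K: "K (Suc j) = (if (u, j) \<in> r then Suc (K j) else K j)" for j
    unfolding K_def by (rule card_Collect_less_Suc)
  have Z: "Z (Suc j) \<longleftrightarrow> Z j \<and> (0 < u - j \<longrightarrow> (u, j) \<notin> r)" for j
    by (auto simp: Z_def less_Suc_eq)
  have Zn: "Z n \<longleftrightarrow> (\<forall>v<u. (u, v) \<notin> r)" using u(2) by (auto simp: Z_def)
  have start: "N 0 = 0" "K 0 = 0" "Z 0" by (simp_all add: N_def K_def Z_def)
  define J where "J j R1 \<longleftrightarrow> R1 14 = u \<and> R1 21 = R 21 \<and> R1 22 = R 22 \<and> R1 23 = of_bool (Z j) \<and>
    R1 24 = of_bool (odd (N j)) \<and> R1 25 = of_bool (odd (N j + K j))" for j and R1 :: "nat \<Rightarrow> nat"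
  show ?thesis
    unfolding class_row_def
  proof (rule wp_for_loop[where n = n and T = "n * ((6 * n + 20) + 3) + (3 * n + 20)" and
      I = "\<lambda>j R1 M1. ctx n b L A R1 M1 \<and> M1 = M \<and> J j R1"])
    fix j R1 M1
    assume j: "j < n" and R15: "R1 15 = j" and I: "ctx n b L A R1 M1 \<and> M1 = M \<and> J j R1"
    then have C1: "ctx n b L A R1 M" and M1: "M1 = M" and J: "J j R1" by auto
    note J' = J[unfolded J_def]
    note e = matD[OF B u(2) j]
    show "wp (Seq (get_entry 16 10 14 15) (Cond 16
       (Seq (Sub 18 14 15) (Seq (Cond 18 (Const 23 0) (Const 18 0)) (Seq (Sub 25 2 25)
         (Seq out_parity (Cond 20 (Seq (Sub 24 2 24) (Sub 25 2 25)) (Const 20 0))))))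
       (Const 16 0))) (R1, M1)
      (\<lambda>t (R', M'). t \<le> n * ((6 * n + 20) + 3) + (3 * n + 20) \<and> R' 15 = j \<and> R' 1 = n \<and> R' 2 = 1 \<and>
        ctx n b L A (R'(15 := Suc j, 5 := n - Suc j)) M' \<and> M' = M \<and>
        J (Suc j) (R'(15 := Suc j, 5 := n - Suc j)))"
    proof (cases "(u, j) \<in> r")
      case True
      show ?thesis
        apply (intro wp_Seq wp_get_entry[where n = n] wp_Cond wp_straight
            wp_out_parity[where n = n and b = b and L = L and A = A and v = j])
        using j R15 C1 M1 J' u(2) ctxD[OF C1] e True
        apply (simp_all add: ctx_upd J_def N K Z frame_out_def)
        apply (auto dest: ctxD)
        done
    next
      case False
      show ?thesis
        apply (rule wp_Seq, rule wp_get_entry[where n = n])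
           prefer 4
           apply (rule wp_Cond, use e J' R15 M1 ctxD[OF C1] False in simp, rule wp_Const)
        using j R15 C1 M1 J' u(2) ctxD[OF C1] e False
        apply (simp_all add: ctx_upd J_def N K Z)
        done
    qed
  next
    fix t R' M' assume t: "t \<le> n * ((n * ((6 * n + 20) + 3) + (3 * n + 20)) + 3) + 3"
      and I: "ctx n b L A R' M' \<and> M' = M \<and> J n R'"
    then have M': "M' = M" and C': "ctx n b L A R' M" by auto
    show "Q t (R', M')"
      unfolding M' by (rule post[OF t C']) (use I in \<open>simp_all add: J_def Zn N_def K_def\<close>)
  qed (use C u R ctxD[OF C] start in \<open>auto simp: ctx_upd J_def\<close>)
qed

text \<open>Registers 21 and 22 count the two kinds of classes. In truncated arithmetic
  \<open>2 * c1 - n\<close> and \<open>2 * c2 - n - 1\<close> both vanish iff the inequalities hold,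
  so one test of their sum decides.\<close>

definition class_test :: ram where
  "class_test = Seq (Const 21 0) (Seq (Const 22 0) (Seq
     (for_loop 14 (Seq (Const 23 1) (Seq (Const 24 0) (Seq (Const 25 0) (Seq class_row
       (Cond 23 (Seq (Add 21 21 24) (Add 22 22 25)) (Const 23 0)))))))
     (Seq (Add 21 21 21) (Seq (Sub 21 21 1) (Seq (Add 22 22 22) (Seq (Sub 22 22 1) (Seq (Sub 22 22 2)
       (Seq (Add 21 21 22) (Cond 21 (Const 0 0) (Const 0 1))))))))))"

lemma wp_class_test:
  assumes C: "ctx n b L A R M" and B: "mat L n M r"
    and odds: "odds = (\<lambda>u. card {v. v < n \<and> (u, v) \<in> r \<and> odd_out n A v})"
    and Rep: "Rep = {u. u < n \<and> (\<forall>v<u. (u, v) \<notin> r)}"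
    and post: "\<And>t R' M'. t \<le> n * ((n * ((n * ((6 * n + 20) + 3) + (3 * n + 20)) + 3) + 9) + 3) + 13 \<Longrightarrow>
      (R' 0 \<noteq> 0 \<longleftrightarrow> 2 * card {u \<in> Rep. odd (odds u)} \<le> n \<and>
          2 * card {u \<in> Rep. odd (odds u + card {v. v < n \<and> (u, v) \<in> r})} \<le> n + 1) \<Longrightarrow> Q t (R', M')"
  shows "wp class_test (R, M) Q"
proof -
  define rep where "rep u \<longleftrightarrow> (\<forall>v<u. (u, v) \<notin> r)" for u
  define P1 where "P1 u \<longleftrightarrow> odd (odds u)" for u
  define P2 where "P2 u \<longleftrightarrow> odd (odds u + card {v. v < n \<and> (u, v) \<in> r})" for u
  define c1 where "c1 j = card {u. u < j \<and> rep u \<and> P1 u}" for j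
  define c2 where "c2 j = card {u. u < j \<and> rep u \<and> P2 u}" for j
  have c1: "c1 (Suc j) = (if rep j \<and> P1 j then Suc (c1 j) else c1 j)" for j
    unfolding c1_def by (rule card_Collect_less_Suc)
  have c2: "c2 (Suc j) = (if rep j \<and> P2 j then Suc (c2 j) else c2 j)" for j
    unfolding c2_def by (rule card_Collect_less_Suc)
  have "{u \<in> Rep. odd (odds u)} = {u. u < n \<and> rep u \<and> P1 u}"
    "{u \<in> Rep. odd (odds u + card {v. v < n \<and> (u, v) \<in> r})} = {u. u < n \<and> rep u \<and> P2 u}"
    by (auto simp: Rep rep_def P1_def P2_def)
  then have cn: "card {u \<in> Rep. odd (odds u)} = c1 n"
    "card {u \<in> Rep. odd (odds u + card {v. v < n \<and> (u, v) \<in> r})} = c2 n"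
    by (simp_all add: c1_def c2_def)
  show ?thesis
    unfolding class_test_def
  proof (rule wp_Seq, rule wp_Const, rule wp_Seq, rule wp_Const, rule wp_Seq,
      rule wp_for_loop[where n = n and T = "n * ((n * ((6 * n + 20) + 3) + (3 * n + 20)) + 3) + 9" and
      I = "\<lambda>j R1 M1. ctx n b L A R1 M1 \<and> M1 = M \<and> R1 21 = c1 j \<and> R1 22 = c2 j"])
    fix j R1 M1
    assume j: "j < n" and R14: "R1 14 = j" and
      I: "ctx n b L A R1 M1 \<and> M1 = M \<and> R1 21 = c1 j \<and> R1 22 = c2 j"
    then have C1: "ctx n b L A R1 M" and M1: "M1 = M" and R1: "R1 21 = c1 j" "R1 22 = c2 j" by auto
    have Pj: "P1 j \<longleftrightarrow> odd (card {v. v < n \<and> (j, v) \<in> r \<and> odd_out n A v})"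
      "P2 j \<longleftrightarrow> odd (card {v. v < n \<and> (j, v) \<in> r \<and> odd_out n A v} + card {v. v < n \<and> (j, v) \<in> r})"
      by (simp_all add: P1_def P2_def odds)
    have row: "wp class_row (R1(23 := 1, 24 := 0, 25 := 0), M) Q'"
      if "\<And>t R'. t \<le> n * ((n * ((6 * n + 20) + 3) + (3 * n + 20)) + 3) + 3 \<Longrightarrow> ctx n b L A R' M \<Longrightarrow>
        R' 14 = j \<Longrightarrow> R' 21 = c1 j \<Longrightarrow> R' 22 = c2 j \<Longrightarrow> R' 23 = of_bool (rep j) \<Longrightarrow>
        R' 24 = of_bool (P1 j) \<Longrightarrow> R' 25 = of_bool (P2 j) \<Longrightarrow> Q' t (R', M)" for Q'
    proof (rule wp_class_row[where n = n and b = b and L = L and A = A and u = j and r = r])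
      fix t R'
      let ?R = "R1(23 := 1, 24 := 0, 25 := 0)"
      assume asm: "t \<le> n * ((n * ((6 * n + 20) + 3) + (3 * n + 20)) + 3) + 3" "ctx n b L A R' M" "R' 14 = j"
        "R' 21 = ?R 21" "R' 22 = ?R 22" "R' 23 = of_bool (\<forall>v<j. (j, v) \<notin> r)"
        "R' 24 = of_bool (odd (card {v. v < n \<and> (j, v) \<in> r \<and> odd_out n A v}))"
        "R' 25 = of_bool (odd (card {v. v < n \<and> (j, v) \<in> r \<and> odd_out n A v} + card {v. v < n \<and> (j, v) \<in> r}))"
      have "R' 21 = c1 j" "R' 22 = c2 j" using asm(4,5) R1 by simp_all
      then show "Q' t (R', M)"
        by (rule that[OF asm(1-3)]) (simp_all only: Pj rep_def asm(6-8))
    qed (use C1 B R14 j in \<open>simp_all add: ctx_upd\<close>)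
    show "wp (Seq (Const 23 1) (Seq (Const 24 0) (Seq (Const 25 0) (Seq class_row
       (Cond 23 (Seq (Add 21 21 24) (Add 22 22 25)) (Const 23 0)))))) (R1, M1)
      (\<lambda>t (R', M'). t \<le> n * ((n * ((6 * n + 20) + 3) + (3 * n + 20)) + 3) + 9 \<and> R' 14 = j \<and>
        R' 1 = n \<and> R' 2 = 1 \<and> ctx n b L A (R'(14 := Suc j, 5 := n - Suc j)) M' \<and> M' = M \<and>
        (R'(14 := Suc j, 5 := n - Suc j)) 21 = c1 (Suc j) \<and> (R'(14 := Suc j, 5 := n - Suc j)) 22 = c2 (Suc j))"
      unfolding M1
      apply (intro wp_Seq wp_Cond wp_straight row)
       apply (simp_all add: ctx_upd c1 c2 ctxD)
      done
  next
    fix t R' M' assume t: "t \<le> n * ((n * ((n * ((6 * n + 20) + 3) + (3 * n + 20)) + 3) + 9) + 3) + 3"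
      and I: "ctx n b L A R' M' \<and> M' = M \<and> R' 21 = c1 n \<and> R' 22 = c2 n" and R': "R' 1 = n" "R' 2 = 1"
    show "wp (Seq (Add 21 21 21) (Seq (Sub 21 21 1) (Seq (Add 22 22 22) (Seq (Sub 22 22 1) (Seq (Sub 22 22 2)
       (Seq (Add 21 21 22) (Cond 21 (Const 0 0) (Const 0 1)))))))) (R', M') (\<lambda>t'. Q (1 + (1 + (t + t'))))"
      by (intro wp_Seq wp_Cond wp_straight post[unfolded cn]) (use t I R' in auto)
  qed (use C ctxD[OF C] in \<open>auto simp: ctx_upd c1_def c2_def\<close>)
qed

text \<open>Register 3 receives \<open>p\<close>, and register 9 its lowest bit.\<close>

definition decode_input :: ram where
  "decode_input = Seq (Const 2 1) (Seq (Const 1 0) (Seq (Load 5 1) (Seq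
     (While 5 (Seq (Add 1 1 2) (Load 5 1)))
     (Seq (Add 6 1 2) (Seq (Const 10 0) (Seq (Add 10 10 0) (Seq (Const 7 0) (Seq (matrix_address 6 1 7)
       (Seq (Const 7 0) (Seq (Add 7 7 12) (Seq (Load 9 7)
         (Seq (Const 3 0) (Seq (Const 4 1) (Seq (Sub 8 10 7)
           (While 8 (Seq (Load 5 7) (Seq (Cond 5 (Add 3 3 4) (Const 5 0)) (Seq (Add 4 4 4)
             (Seq (Add 7 7 2) (Sub 8 8 2))))))))))))))))))))"

section \<open>Decoding of the input\<close>

fun bits_value :: "bool list \<Rightarrow> nat" where
  "bits_value [] = 0"
| "bits_value (x # xs) = of_bool x + 2 * bits_value xs"

lemma bits_value_binary: "bits_value (binary p) = p"
proof (induction p rule: binary.induct)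
  case (1 p)
  show ?case
  proof (cases "p = 0")
    case False
    then have "bits_value (binary p) = of_bool (odd p) + 2 * (p div 2)"
      using 1 by (subst binary.simps) simp
    then show ?thesis by (cases "even p") (auto elim!: evenE oddE)
  qed (simp add: binary.simps)
qed

lemma wp_decode_input:
  assumes len: "length w = n + 1 + n * n + length bs"
    and ones: "\<And>i. i < n \<Longrightarrow> w ! i" and zero: "\<not> w ! n"
    and bits: "\<And>i. i < length bs \<Longrightarrow> w ! (n + 1 + n * n + i) = bs ! i" and bs: "bs \<noteq> []"
    and A: "\<And>x y. x < n \<Longrightarrow> y < n \<Longrightarrow> w ! (n + 1 + y + x * n) \<longleftrightarrow> (x, y) \<in> A"
    and post: "\<And>t R' M'. t \<le> 3 * n + 3 * n + 7 * length w + 30 \<Longrightarrow> ctx n (n + 1) (length w) A R' M' \<Longrightarrow>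
      R' 3 = bits_value bs \<Longrightarrow> R' 9 = of_bool (hd bs) \<Longrightarrow> Q t (R', M')"
  shows "wp decode_input (initial_state w) Q"
proof -
  define M :: "nat \<Rightarrow> nat" where "M = (\<lambda>i. if i < length w then of_bool (w ! i) else 0)"
  define R0 :: "nat \<Rightarrow> nat" where "R0 = (\<lambda>_. 0)(0 := length w)"
  have init: "initial_state w = (R0, M)" by (simp add: initial_state_def M_def R0_def)
  define s where "s = n + 1 + n * n"
  have Mn: "M i = 1" if "i < n" for i using that ones len by (simp add: M_def)
  have Mz: "M n = 0" using zero len by (simp add: M_def)
  have Mb: "M (s + i) = of_bool (bs ! i)" if "i < length bs" for i
    using bits[OF that] that len by (simp add: M_def s_def)
  have matA: "mat (n + 1) n M A"
    unfolding mat_def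
  proof (intro allI impI)
    fix x y assume xy: "x < n" "y < n"
    have "y + x * n < Suc x * n" using xy by simp
    also have "\<dots> \<le> n * n" using xy by (intro mult_le_mono1) simp
    finally have "n + 1 + y + x * n < length w" using len by simp
    then show "M (n + 1 + y + x * n) = of_bool ((x, y) \<in> A)" unfolding M_def using A[OF xy] by simp
  qed
  define R1 where "R1 = R0(2 := 1, 1 := n, 5 := 0)"
  have scan: "wp (While 5 (Seq (Add 1 1 2) (Load 5 1))) (R0(2 := 1, 1 := 0, 5 := M 0), M) Q'"
    if "\<And>t. t \<le> 3 * n + 1 \<Longrightarrow> Q' t (R1, M)" for Q'
  proof (rule wp_While[where I = "\<lambda>j s. s = (R0(2 := 1, 1 := j, 5 := M j), M)" and m = n and T = 2])
    fix j s assume "j < n" "s = (R0(2 := 1, 1 := j, 5 := M j), M)"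
    then show "fst s 5 \<noteq> 0 \<and> wp (Seq (Add 1 1 2) (Load 5 1)) s
      (\<lambda>t s'. t \<le> 2 \<and> s' = (R0(2 := 1, 1 := Suc j, 5 := M (Suc j)), M))"
      using Mn[of j] by (auto intro!: wp_Seq wp_straight simp: fun_upd_twist)
  next
    fix t s' assume "t \<le> n * (2 + 1) + 1" "s' = (R0(2 := 1, 1 := n, 5 := M n), M)"
    then show "Q' t s'" using that[of t] by (simp add: Mz R1_def)
  qed (auto simp: Mz)
  define R2 where "R2 = R1(6 := n + 1, 10 := length w, 12 := s, 13 := 0, 7 := s, 9 := of_bool (hd bs),
    3 := 0, 4 := 1, 8 := length bs)"
  \<comment> \<open>Register 4 is the weight of the next bit. The sum of register 3 and the weighted
    value of the unread bits stays constant.\<close>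
  define J where "J j st \<longleftrightarrow> (\<exists>R. st = (R, M) \<and> R 1 = n \<and> R 2 = 1 \<and> R 6 = n + 1 \<and> R 10 = length w \<and>
    R 9 = of_bool (hd bs) \<and> R 7 = s + j \<and> R 8 = length bs - j \<and> R 4 > 0 \<and>
    R 3 + R 4 * bits_value (drop j bs) = bits_value bs)" for j and st :: ram_state
  have loop: "wp (While 8 (Seq (Load 5 7) (Seq (Cond 5 (Add 3 3 4) (Const 5 0)) (Seq (Add 4 4 4)
             (Seq (Add 7 7 2) (Sub 8 8 2)))))) (R2, M) Q'"
    if "\<And>t R'. t \<le> 7 * length bs + 1 \<Longrightarrow> R' 1 = n \<Longrightarrow> R' 2 = 1 \<Longrightarrow> R' 6 = n + 1 \<Longrightarrow> R' 10 = length w \<Longrightarrow>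
      R' 9 = of_bool (hd bs) \<Longrightarrow> R' 3 = bits_value bs \<Longrightarrow> Q' t (R', M)" for Q'
  proof (rule wp_While[where I = J and m = "length bs" and T = 6])
    show "J 0 (R2, M)" by (simp add: J_def R2_def R1_def)
  next
    fix j st assume j: "j < length bs" and J: "J j st"
    then obtain R where st: "st = (R, M)" and R: "R 1 = n" "R 2 = 1" "R 6 = n + 1" "R 10 = length w"
      "R 9 = of_bool (hd bs)" "R 7 = s + j" "R 8 = length bs - j" "R 4 > 0"
      "R 3 + R 4 * bits_value (drop j bs) = bits_value bs" unfolding J_def by blast
    have "drop j bs = bs ! j # drop (Suc j) bs" using j by (simp add: Cons_nth_drop_Suc)
    then have v: "R 3 + R 4 * of_bool (bs ! j) + (R 4 + R 4) * bits_value (drop (Suc j) bs) = bits_value bs"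
      using R(9) by (simp add: algebra_simps)
    have "wp (Seq (Load 5 7) (Seq (Cond 5 (Add 3 3 4) (Const 5 0)) (Seq (Add 4 4 4)
             (Seq (Add 7 7 2) (Sub 8 8 2))))) (R, M) (\<lambda>t s'. t \<le> 6 \<and> J (Suc j) s')"
      by (intro wp_Seq wp_Cond wp_straight)
        (use R(1-8) v Mb[OF j] in \<open>simp_all add: J_def\<close>)
    then show "fst st 8 \<noteq> 0 \<and> wp (Seq (Load 5 7) (Seq (Cond 5 (Add 3 3 4) (Const 5 0)) (Seq (Add 4 4 4)
             (Seq (Add 7 7 2) (Sub 8 8 2))))) st (\<lambda>t s'. t \<le> 6 \<and> J (Suc j) s')"
      using R(7) j st by simp
  next
    fix st assume "J (length bs) st" then show "fst st 8 = 0" by (auto simp: J_def)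
  next
    fix t s' assume "t \<le> length bs * (6 + 1) + 1" "J (length bs) s'"
    then show "Q' t s'" by (auto simp: J_def intro!: that)
  qed
  \<comment> \<open>Asking for row \<open>n\<close>, column 0 yields the address just behind the
    matrix, where the digits of \<open>p\<close> begin.\<close>
  have addr: "wp (matrix_address 6 1 7) (R1(6 := n + 1, 10 := length w, 7 := 0), M) Q'"
    if "\<And>t. t \<le> 3 * n + 4 \<Longrightarrow> Q' t (R1(6 := n + 1, 10 := length w, 7 := 0, 12 := s, 13 := 0), M)" for Q'
    by (rule wp_matrix_address) (use that in \<open>simp_all add: R1_def s_def\<close>)
  have R10: "R1 0 = length w" "R1 1 = n" "R1 2 = 1" by (simp_all add: R1_def R0_def)
  have hd: "M s = of_bool (hd bs)" using Mb[of 0] bs by (simp add: hd_conv_nth)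
  have lens: "length w - s = length bs" "s + length bs = length w" using len by (simp_all add: s_def)
  have tail: "wp (Seq (Add 6 1 2) (Seq (Const 10 0) (Seq (Add 10 10 0) (Seq (Const 7 0) (Seq (matrix_address 6 1 7)
       (Seq (Const 7 0) (Seq (Add 7 7 12) (Seq (Load 9 7)
         (Seq (Const 3 0) (Seq (Const 4 1) (Seq (Sub 8 10 7)
           (While 8 (Seq (Load 5 7) (Seq (Cond 5 (Add 3 3 4) (Const 5 0)) (Seq (Add 4 4 4)
             (Seq (Add 7 7 2) (Sub 8 8 2))))))))))))))))) (R1, M) Q'"
    if Q': "\<And>t R'. t \<le> 3 * n + 7 * length bs + 20 \<Longrightarrow> R' 1 = n \<Longrightarrow> R' 2 = 1 \<Longrightarrow> R' 6 = n + 1 \<Longrightarrow> R' 10 = length w \<Longrightarrow>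
      R' 9 = of_bool (hd bs) \<Longrightarrow> R' 3 = bits_value bs \<Longrightarrow> Q' t (R', M)" for Q'
  proof -
    have a: "wp (matrix_address 6 1 7) (R1(6 := R1 1 + R1 2, 10 := 0,
        10 := (R1(6 := R1 1 + R1 2, 10 := 0)) 10 + (R1(6 := R1 1 + R1 2, 10 := 0)) 0, 7 := 0), M) Q''"
      if "\<And>t. t \<le> 3 * n + 4 \<Longrightarrow> Q'' t (R1(6 := n + 1, 10 := length w, 7 := 0, 12 := s, 13 := 0), M)" for Q''
      using addr[of Q'', OF that] R10 by simp
    have b: "wp (While 8 (Seq (Load 5 7) (Seq (Cond 5 (Add 3 3 4) (Const 5 0)) (Seq (Add 4 4 4)
             (Seq (Add 7 7 2) (Sub 8 8 2)))))) (R, M) Q''"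
      if "R = R2" "\<And>t R'. t \<le> 7 * length bs + 1 \<Longrightarrow> R' 1 = n \<Longrightarrow> R' 2 = 1 \<Longrightarrow> R' 6 = n + 1 \<Longrightarrow> R' 10 = length w \<Longrightarrow>
      R' 9 = of_bool (hd bs) \<Longrightarrow> R' 3 = bits_value bs \<Longrightarrow> Q'' t (R', M)" for Q'' R
      unfolding that(1) by (rule loop, rule that(2))
    show ?thesis
      apply (rule wp_Seq, rule wp_Add, rule wp_Seq, rule wp_Const, rule wp_Seq, rule wp_Add, rule wp_Seq, rule wp_Const)
      apply (rule wp_Seq, rule a)
      apply (rule wp_Seq, rule wp_Const, rule wp_Seq, rule wp_Add, rule wp_Seq, rule wp_Load)
      apply (rule wp_Seq, rule wp_Const, rule wp_Seq, rule wp_Const, rule wp_Seq, rule wp_Sub)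
      apply (rule b)
       apply (simp add: R2_def hd lens fun_upd_twist)
      apply (rule Q')
            apply simp_all
      done
  qed
  show ?thesis
    unfolding init decode_input_def
    apply (rule wp_Seq, rule wp_Const, rule wp_Seq, rule wp_Const, rule wp_Seq, rule wp_Load, rule wp_Seq)
    apply (simp only: fun_upd_same)
    apply (rule scan, rule tail, rule post)
    using len matA
    apply (simp_all add: ctx_def)
    done
qed

text \<open>\<open>n - p = 0\<close> means \<open>n \<le> p\<close>, and \<open>p - 1 = 0\<close>
  means \<open>p = 1\<close> for positive \<open>p\<close>. Register 11 records this trivial case
  and also selects the mode of \<open>build_matrix\<close>. No loop runs \<open>p\<close>
  times.\<close>

definition decision_program :: ram where
  "decision_program = Seq decode_input (Seq (Sub 5 1 3)
     (Seq (Cond 5 (Seq (Sub 5 3 2) (Cond 5 (Const 11 0) (Const 11 1))) (Const 11 1))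
       (Cond 11 (Seq build_matrix (Seq warshall diagonal_test))
         (Cond 9 (Seq build_matrix (Seq warshall class_test)) (Const 0 1)))))"

text \<open>Stated over every commutative semiring so that one expression yields the polynomial, at
  \<open>[:0, 1:]\<close>, and its values. The bounds of both tests are added up although only one
  of them is run.\<close>

definition time_bound :: "'a::comm_semiring_1 \<Rightarrow> 'a" where
  "time_bound x = 13 * x + 60 + (x * ((x * ((9 * x + 20) + 3) + 3) + 3) + 3) +
     (x * ((x * ((x * ((6 * x + 12) + 3) + 3 + (3 * x + 8)) + 3) + 3) + 3) + 3) +
     ((x * ((3 * x + 7) + 3) + 4) +
      (x * ((x * ((x * ((6 * x + 20) + 3) + (3 * x + 20)) + 3) + 9) + 3) + 13))"

lemma poly_time_bound: "poly (time_bound [:0, 1:]) x = time_bound (x::nat)"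
  by (simp add: time_bound_def mult.commute)

lemma length_concat_uniform:
  "(\<And>xs. xs \<in> set xss \<Longrightarrow> length xs = n) \<Longrightarrow> length (concat xss) = length xss * n"
  by (induction xss) auto

lemma nth_concat_uniform:
  assumes "\<And>xs. xs \<in> set xss \<Longrightarrow> length xs = n" "x < length xss" "y < n"
  shows "concat xss ! (y + x * n) = xss ! x ! y"
  using assms
proof (induction xss arbitrary: x)
  case (Cons xs xss)
  show ?case
  proof (cases x)
    case 0
    then show ?thesis using Cons.prems by (simp add: nth_append)
  next
    case (Suc x')
    have "length xs = n" using Cons.prems by simp
    then have "concat (xs # xss) ! (y + x * n) = concat xss ! (y + x' * n)"
      using Suc by (simp add: nth_append)
    also have "\<dots> = xss ! x' ! y" using Cons Suc by simp
    finally show ?thesis using Suc by simp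
  qed
qed simp

lemma wp_decision_program:
  assumes p: "p > 0" "card (pverts D) \<noteq> p + 1" and D: "oriented_graph D"
  shows "wp decision_program (initial_state (encode (p, D)))
    (\<lambda>t (R, M). t \<le> time_bound (length (encode (p, D))) \<and> (R 0 \<noteq> 0 \<longleftrightarrow> eq_invertible p D))"
proof -
  define vs where "vs = sorted_list_of_set (pverts D)"
  define n where "n = length vs"
  define rows where "rows = map (\<lambda>u. map (\<lambda>v. (u, v) \<in> parcs D) vs) vs"
  define w where "w = encode (p, D)"
  define L where "L = length w"
  define A where "A = {(i, j). i < n \<and> j < n \<and> (vs ! i, vs ! j) \<in> parcs D}"
  have fin: "finite (pverts D)" by (rule oriented_graphD(1)[OF D])
  have vs: "distinct vs" "set vs = pverts D" using fin by (simp_all add: vs_def)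
  have w: "w = replicate n True @ [False] @ concat rows @ binary p"
    by (simp add: w_def encode_def Let_def n_def rows_def vs_def)
  have rows: "length xs = n" if "xs \<in> set rows" for xs using that by (auto simp: rows_def n_def)
  have lenr: "length rows = n" by (simp add: rows_def n_def)
  have lenc: "length (concat rows) = n * n" using length_concat_uniform[of rows n] rows lenr by simp
  have len: "length w = n + 1 + n * n + length (binary p)" by (simp add: w lenc)
  have bin: "binary p \<noteq> []" "hd (binary p) = odd p" using p(1) by (subst binary.simps, simp)+
  have bij: "bij_betw ((!) vs) {..<n} (pverts D)"
    using bij_betw_nth[OF vs(1), of "{..<n}" "pverts D"] vs(2) by (simp add: n_def)
  have inv: "eq_invertible p D \<longleftrightarrow> invertibility_test p n A"
    unfolding A_def by (rule eq_invertible_iff_test[OF D p bij])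
  have An: "A \<subseteq> {..<n} \<times> {..<n}" by (auto simp: A_def)
  have nL: "n \<le> L" using len by (simp add: L_def)
  \<comment> \<open>Decoding takes at most \<open>13 * L + 30\<close> steps since
    \<open>n \<le> L\<close>; the other 30 cover the branching between the routines. The bound is
    monotone, so \<open>n\<close> may be replaced by \<open>L\<close>.\<close>
  define T where "T = 13 * L + 60 + (n * ((n * ((9 * n + 20) + 3) + 3) + 3) + 3) +
     (n * ((n * ((n * ((6 * n + 12) + 3) + 3 + (3 * n + 8)) + 3) + 3) + 3) + 3) +
     ((n * ((3 * n + 7) + 3) + 4) +
      (n * ((n * ((n * ((6 * n + 20) + 3) + (3 * n + 20)) + 3) + 9) + 3) + 13))"
  have TL: "T \<le> time_bound L"
    unfolding T_def time_bound_def by (intro add_mono mult_mono order.refl nL) simp_all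
  define t1 where "t1 = n * ((n * ((9 * n + 20) + 3) + 3) + 3) + 3"
  define t2 where "t2 = n * ((n * ((n * ((6 * n + 12) + 3) + 3 + (3 * n + 8)) + 3) + 3) + 3) + 3"
  define t3 where "t3 = n * ((3 * n + 7) + 3) + 4"
  define t4 where "t4 = n * ((n * ((n * ((6 * n + 20) + 3) + (3 * n + 20)) + 3) + 9) + 3) + 13"
  have T: "T = 13 * L + 60 + t1 + t2 + (t3 + t4)" by (simp add: T_def t1_def t2_def t3_def t4_def)
  define r where "r = (nonadj {..<n} A)\<^sup>+"
  have acy: "acyclic A \<longleftrightarrow> (\<forall>x<n. (x, x) \<notin> A\<^sup>+)"
  proof -
    have "A\<^sup>+ \<subseteq> {..<n} \<times> {..<n}" by (rule trancl_subset_Sigma[OF An])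
    then show ?thesis by (auto simp: acyclic_def)
  qed
  have acyclic_branch: "wp (Seq build_matrix (Seq warshall diagonal_test)) (R, M) Q"
    if C: "ctx n (n + 1) L A R M" and m: "R 11 = 1"
      and Q: "\<And>t R' M'. t \<le> t1 + t2 + t3 \<Longrightarrow> (R' 0 \<noteq> 0 \<longleftrightarrow> acyclic A) \<Longrightarrow> Q t (R', M')" for R M Q
  proof (rule wp_Seq, rule wp_build_matrix[OF C, of True], simp add: m, rule refl)
    fix t R1 M1 assume t: "t \<le> n * ((n * ((9 * n + 20) + 3) + 3) + 3) + 3"
      and C1: "ctx n (n + 1) L A R1 M1"
      and B1: "mat L n M1 (if True then A else {(x, y). (x, y) \<notin> A \<and> (y, x) \<notin> A})"
    show "wp (Seq warshall diagonal_test) (R1, M1) (\<lambda>t'. Q (t + t'))"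
    proof (rule wp_Seq, rule wp_warshall[OF C1 _ An])
      show "mat L n M1 A" using B1 by simp
      fix t' R2 M2
      assume t': "t' \<le> n * ((n * ((n * ((6 * n + 12) + 3) + 3 + (3 * n + 8)) + 3) + 3) + 3) + 3"
        and C2: "ctx n (n + 1) L A R2 M2" and B2: "mat L n M2 (A\<^sup>+)"
      show "wp diagonal_test (R2, M2) (\<lambda>t''. Q (t + (t' + t'')))"
      proof (rule wp_diagonal_test[OF C2 B2], rule Q)
        fix t'' R3 assume "t'' \<le> n * ((3 * n + 7) + 3) + 4"
        then show "t + (t' + t'') \<le> t1 + t2 + t3"
          using t t' unfolding t1_def t2_def t3_def by linarith
      qed (auto simp: acy)
    qed
  qed
  have class_branch: "wp (Seq build_matrix (Seq warshall class_test)) (R, M) Q"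
    if C: "ctx n (n + 1) L A R M" and m: "R 11 = 0" and np: "\<not> (n \<le> p \<or> p = 1)" "odd p"
      and Q: "\<And>t R' M'. t \<le> t1 + t2 + t4 \<Longrightarrow> (R' 0 \<noteq> 0 \<longleftrightarrow> invertibility_test p n A) \<Longrightarrow> Q t (R', M')" for R M Q
  proof (rule wp_Seq, rule wp_build_matrix[OF C, of False], simp add: m, rule refl)
    fix t R1 M1 assume t: "t \<le> n * ((n * ((9 * n + 20) + 3) + 3) + 3) + 3"
      and C1: "ctx n (n + 1) L A R1 M1"
      and B1: "mat L n M1 (if False then A else {(x, y). (x, y) \<notin> A \<and> (y, x) \<notin> A})"
    show "wp (Seq warshall class_test) (R1, M1) (\<lambda>t'. Q (t + t'))"
    proof (rule wp_Seq, rule wp_warshall[OF C1])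
      show "mat L n M1 (nonadj {..<n} A)" by (rule mat_cong[OF B1]) (simp add: nonadj_def)
      show "nonadj {..<n} A \<subseteq> {..<n} \<times> {..<n}" by (auto simp: nonadj_def)
      fix t' R2 M2
      assume t': "t' \<le> n * ((n * ((n * ((6 * n + 12) + 3) + 3 + (3 * n + 8)) + 3) + 3) + 3) + 3"
        and C2: "ctx n (n + 1) L A R2 M2" and B2: "mat L n M2 ((nonadj {..<n} A)\<^sup>+)"
      show "wp class_test (R2, M2) (\<lambda>t''. Q (t + (t' + t'')))"
      proof (rule wp_class_test[OF C2 B2 refl refl], rule Q)
        fix t'' R3
        assume "t'' \<le> n * ((n * ((n * ((6 * n + 20) + 3) + (3 * n + 20)) + 3) + 9) + 3) + 13"
        then show "t + (t' + t'') \<le> t1 + t2 + t4"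
          using t t' unfolding t1_def t2_def t4_def by linarith
      qed (use np in \<open>simp add: invertibility_test_def Let_def\<close>)
    qed
  qed
  have "wp decision_program (initial_state w)
    (\<lambda>t (R, M). t \<le> T \<and> (R 0 \<noteq> 0 \<longleftrightarrow> invertibility_test p n A))"
    unfolding decision_program_def
  proof (rule wp_Seq, rule wp_decode_input[where n = n and bs = "binary p" and A = A])
    show "length w = n + 1 + n * n + length (binary p)" by (rule len)
    show "w ! i" if "i < n" for i using that by (simp add: w nth_append)
    show "\<not> w ! n" by (simp add: w nth_append)
    show "w ! (n + 1 + n * n + i) = binary p ! i" if "i < length (binary p)" for i
      by (simp add: w nth_append lenc)
    show "binary p \<noteq> []" by (rule bin)
    fix x y assume xy: "x < n" "y < n"
    have "y + x * n < Suc x * n" using xy by simp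
    also have "\<dots> \<le> n * n" using xy by (intro mult_le_mono1) simp
    finally have "y + x * n < length (concat rows)" using lenc by simp
    then have "w ! (n + 1 + y + x * n) = concat rows ! (y + x * n)" by (simp add: w nth_append)
    also have "\<dots> = rows ! x ! y" using rows lenr xy by (intro nth_concat_uniform) auto
    finally show "w ! (n + 1 + y + x * n) \<longleftrightarrow> (x, y) \<in> A"
      using xy by (simp add: rows_def A_def n_def)
  next
    fix t R M
    assume t: "t \<le> 3 * n + 3 * n + 7 * length w + 30" and C: "ctx n (n + 1) (length w) A R M"
      and R3: "R 3 = bits_value (binary p)" and R9: "R 9 = of_bool (hd (binary p))"
    have C: "ctx n (n + 1) L A R M" using C by (simp add: L_def)
    have R3: "R 3 = p" and R9: "R 9 = of_bool (odd p)" using R3 R9 bin by (simp_all add: bits_value_binary)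
    note R = ctxD[OF C]
    have t: "t \<le> 13 * L + 30" using t nL by (simp add: L_def)
    show "wp (Seq (Sub 5 1 3) (Seq (Cond 5 (Seq (Sub 5 3 2) (Cond 5 (Const 11 0) (Const 11 1))) (Const 11 1))
       (Cond 11 (Seq build_matrix (Seq warshall diagonal_test))
         (Cond 9 (Seq build_matrix (Seq warshall class_test)) (Const 0 1))))) (R, M)
      (\<lambda>t' (R', M'). t + t' \<le> T \<and> (R' 0 \<noteq> 0 \<longleftrightarrow> invertibility_test p n A))"
    proof -
      have rest: "wp (Cond 11 (Seq build_matrix (Seq warshall diagonal_test))
         (Cond 9 (Seq build_matrix (Seq warshall class_test)) (Const 0 1))) (R1, M)
        (\<lambda>t' (R', M'). t + (t0 + t') \<le> T \<and> (R' 0 \<noteq> 0 \<longleftrightarrow> invertibility_test p n A))"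
        if t0: "t0 \<le> 10" and C1: "ctx n (n + 1) L A R1 M" and R11: "R1 11 = of_bool (n \<le> p \<or> p = 1)"
          and R91: "R1 9 = of_bool (odd p)" for t0 R1
      proof (rule wp_Cond)
        assume "R1 11 \<noteq> 0"
        then have np: "n \<le> p \<or> p = 1" and R11: "R1 11 = 1" using R11 by (auto split: if_splits)
        show "wp (Seq build_matrix (Seq warshall diagonal_test)) (R1, M)
          (\<lambda>t'. case_prod (\<lambda>R' M'. t + (t0 + Suc t') \<le> T \<and> (R' 0 \<noteq> 0 \<longleftrightarrow> invertibility_test p n A)))"
          by (rule acyclic_branch[OF C1 R11])
            (use np t t0 in \<open>auto simp: invertibility_test_def T\<close>)
      next
        assume "R1 11 = 0"
        then have np: "\<not> (n \<le> p \<or> p = 1)" using R11 by (auto split: if_splits)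
        show "wp (Cond 9 (Seq build_matrix (Seq warshall class_test)) (Const 0 1)) (R1, M)
          (\<lambda>t'. case_prod (\<lambda>R' M'. t + (t0 + Suc t') \<le> T \<and> (R' 0 \<noteq> 0 \<longleftrightarrow> invertibility_test p n A)))"
        proof (rule wp_Cond)
          assume "R1 9 \<noteq> 0"
          then have "odd p" using R91 by (auto split: if_splits)
          then show "wp (Seq build_matrix (Seq warshall class_test)) (R1, M)
            (\<lambda>t'. case_prod (\<lambda>R' M'. t + (t0 + Suc (Suc t')) \<le> T \<and> (R' 0 \<noteq> 0 \<longleftrightarrow> invertibility_test p n A)))"
            by (intro class_branch[OF C1 \<open>R1 11 = 0\<close> np]) (use t t0 in \<open>auto simp: T\<close>)
        next
          assume "R1 9 = 0"
          then have "even p" using R91 by (auto split: if_splits)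
          then show "wp (Const 0 1) (R1, M)
            (\<lambda>t'. case_prod (\<lambda>R' M'. t + (t0 + Suc (Suc t')) \<le> T \<and> (R' 0 \<noteq> 0 \<longleftrightarrow> invertibility_test p n A)))"
            by (intro wp_Const) (use np t t0 in \<open>auto simp: invertibility_test_def T\<close>)
        qed
      qed
      have cond: "wp (Cond 5 (Seq (Sub 5 3 2) (Cond 5 (Const 11 0) (Const 11 1))) (Const 11 1))
          (R(5 := n - p), M) Q"
        if Q: "\<And>t' R1. t' \<le> 5 \<Longrightarrow> ctx n (n + 1) L A R1 M \<Longrightarrow> R1 11 = of_bool (n \<le> p \<or> p = 1) \<Longrightarrow>
          R1 9 = of_bool (odd p) \<Longrightarrow> Q t' (R1, M)" for Q
        apply (intro wp_Cond wp_Seq wp_straight Q)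
        using C R3 R9 R p(1)
        apply (auto simp: ctx_upd)
        done
      show ?thesis
        apply (rule wp_Seq, rule wp_Sub, rule wp_Seq)
        using R R3 apply (simp only:)
        apply (rule cond)
        subgoal for t' R1
          using rest[of "1 + t'" R1] by (simp add: case_prod_unfold add.assoc)
        done
    qed
  qed
  then show ?thesis
    unfolding inv w_def[symmetric] L_def[symmetric]
    by (rule wp_mono) (use TL in auto)
qed

theorem theorem1p4:
  shows "polytime_decidable_on
    {(p, D). p > 0 \<and> oriented_graph D \<and> card (pverts D) \<noteq> p + 1}
    encode
    (\<lambda>(p, D). eq_invertible p D)"
  unfolding polytime_decidable_on_def
proof (rule exI[of _ decision_program], rule exI[of _ "time_bound [:0, 1:]"], rule ballI)
  fix x assume x: "x \<in> {(p, D :: nat pair_pre_digraph). p > 0 \<and> oriented_graph D \<and> card (pverts D) \<noteq> p + 1}"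
  obtain p D where pD: "x = (p, D)" by force
  have "wp decision_program (initial_state (encode (p, D)))
    (\<lambda>t (R, M). t \<le> time_bound (length (encode (p, D))) \<and> (R 0 \<noteq> 0 \<longleftrightarrow> eq_invertible p D))"
    using x pD by (intro wp_decision_program) auto
  then show "\<exists>t R M. runs decision_program (initial_state (encode x)) t (R, M) \<and>
      t \<le> poly (time_bound [:0, 1:]) (length (encode x)) \<and>
      (R 0 \<noteq> 0 \<longleftrightarrow> (case x of (p, D) \<Rightarrow> eq_invertible p D))"
    unfolding wp_def pD poly_time_bound by auto
qed

end
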